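(* Consider a sequence, indexed by the dimension $\ell$, of linearizations $L$ and superoperators $\mathcal S$ as in the context (with $n,d$ and all objects depending on $\ell$). Let $z\in\mathbb H$, let $M\in\mathcal M$ be the unique solution of the Dyson equation, and assume: (C1) there is $s>0$ (depending on $\ell$) with $\|\mathcal S(W)\|\le s\|W\|$ for all $W\in\mathbb C^{\ell\times\ell}$ and $\limsup_{\ell\to\infty}s<\infty$; moreover $\limsup_{\ell\to\infty}\|\mathbb EL\|<\infty$ and $\limsup_{\ell\to\infty}\mathbb E\|(L-z\Lambda)^{-1}\|^2<\infty$. (C2) for every $z\in\mathbb H$ there exist a function $f$ and a sequence $\{\tau_k\}\subseteq\mathbb R_{>0}$ (both independent of $\ell$) such that $\tau_k\to0$, $f(\tau_k)\to0$, and $\|M^{(\tau_k)}(z)-M(z)\|\le f(\tau_k)+o_\ell(1)$ for all $k\in\mathbb N$ and every sufficiently large $\ell$. (C3) there exist $\gamma\in\mathbb N$, $g\sim\mathcal N(0,I_\gamma)$ and a measurable map $\mathcal C:\mathbb R^\gamma\to\mathbb R^{\ell\times\ell}$ with $\mathcal C(x)=\mathcal C(x)^\top$ for all $x$ and $\mathbb E[\mathcal C(g)]=0$ such that $L\equiv L(g)=\mathcal C(g)+\mathbb EL$. Suppose that the mapping $g\in(\mathbb R^\gamma,\|\cdot\|_2)\mapsto\mathcal S((L(g)-z\Lambda-i\tau I_\ell)^{-1})\in(\mathbb C^{\ell\times\ell},\|\cdot\|)$ is $\lambda$-Lipschitz and $$\lim_{\ell\to\infty}\sqrt{\ell}\,\lambda=\lim_{\ell\to\infty}\|\tilde{\mathcal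 S}\|=\lim_{\ell\to\infty}\|\Delta(L,\tau;z)\|=0$$ for every $\tau\in\mathbb R_{>0}$ small enough (where $\lambda$ may depend on $\ell$ and $\tau$). Additionally, suppose that the mapping $g\in(\mathbb R^\gamma,\|\cdot\|_2)\mapsto(L(g)-z\Lambda)^{-1}\in(\mathbb C^{\ell\times\ell},\|\cdot\|_F)$ is $c\,\ell^{-r}$-Lipschitz for some $c,r\in\mathbb R_{>0}$ (independent of $\ell$). Then $\operatorname{tr}\big(U((L-z\Lambda)^{-1}-M(z))\big)\to0$ almost surely as $\ell\to\infty$ for every sequence of (deterministic) matrices $U\in\mathbb C^{\ell\times\ell}$ with $\|U\|_*\le1$.
   Context: Notation: $\|\cdot\|$ is the spectral norm on matrices, $\|\cdot\|_F$ Frobenius, $\|\cdot\|_*$ nuclear; the norm of an operator on matrices, such as $\|\tilde{\mathcal S}\|$, is the one induced by the spectral norm. $\Im[W]=(W-W^* )/(2i)$; $\succeq,\succ$ is the Loewner order. $\mathbb H$ is the open upper half-plane. For $W\in\mathbb C^{\ell\times\ell}$, $\ell=n+d$, $W_{1,1}$ is the upper-left $n\times n$ block, etc. Let $L=\begin{bmatrix}A&B^\top\\ B&Q\end{bmatrix}\in\mathbb R^{\ell\times\ell}$ be random real symmetric, $A\in\mathbb R^{n\times n}$ symmetric, $B\in\mathbb R^{d\times n}$, $Q\in\mathbb R^{d\times d}$ symmetric, $Q$ and $\mathbb EQ$ non-singular, entries with finite second moments. $\Lambda=\mathrm{diag}\{I_n,0_{d\times d}\}$. The superoperator $\mathcal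 S:\mathbb C^{\ell\times\ell}\to\mathbb C^{\ell\times\ell}$ is a positivity-preserving linear map (maps positive semidefinite matrices to positive semidefinite matrices) of the form $$\mathcal S(M)=\begin{bmatrix}\mathcal S_{1,1}(M)&\mathbb E[(A-\mathbb EA)M_{1,1}(B-\mathbb EB)^\top]\\ \mathbb E[(B-\mathbb EB)M_{1,1}(A-\mathbb EA)]&\mathbb E[(B-\mathbb EB)M_{1,1}(B-\mathbb EB)^\top]\end{bmatrix}$$ with $\mathcal S_{1,1}:\mathbb C^{\ell\times\ell}\to\mathbb C^{n\times n}$ a given positivity-preserving linear map; expectations are over $L$ only. $\mathcal M$ is the set of holomorphic $M:\mathbb H\to\mathcal A=\{W\in\mathbb C^{\ell\times\ell}:\Im[W]\succeq0,\Im[W_{1,1}]\succ0\}$. There is a unique $M\in\mathcal M$ with $(\mathbb EL-\mathcal S(M(z))-z\Lambda)M(z)=I_\ell$ for all $z\in\mathbb H$ (the Dyson equation). For $\tau>0$, $M^{(\tau)}$ is the unique holomorphic function $\mathbb H\to\{W:\Im[W]\succ0\}$ with $(\mathbb EL-\mathcal S(M^{(\tau)}(z))-z\Lambda-i\tau I_\ell)M^{(\tau)}(z)=I_\ell$ for all $z\in\mathbb H$. Define $\tilde{\mathcal S}(M)=\mathbb E[(L-\mathbb EL)M(L-\mathbb EL)]-\mathcal S(M)$ for $M\in\mathbb C^{\ell\times\ell}$, and, with $\tilde L$ an i.i.d. copy of $L$, $$\Delta(L,\tau;z)=\mathbb E[(L-\mathbb EL)(L-z\Lambda-i\tau I_\ell)^{-1}]+\mathbb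 E[(\tilde L-\mathbb EL)(L-z\Lambda-i\tau I_\ell)^{-1}(\tilde L-\mathbb EL)(L-z\Lambda-i\tau I_\ell)^{-1}].$$ *)

theory Defs
  imports
    "HOL-Probability.Probability"
    "Jordan_Normal_Form.Schur_Decomposition"
    "Jordan_Normal_Form.Spectral_Radius"
begin

section \<open>Matrices, norms and the Loewner order\<close>

abbreviation cmat :: "real mat \<Rightarrow> complex mat" where
  "cmat \<equiv> map_mat complex_of_real"

definition mtrace :: "complex mat \<Rightarrow> complex" where
  "mtrace W = (\<Sum>i<dim_row W. W $$ (i, i))"

text \<open>The inverse as a total function; the value at singular matrices is an arbitrary convention.\<close>

definition minv :: "complex mat \<Rightarrow> complex mat" where
  "minv W = (case mat_inverse W of Some X \<Rightarrow> X | None \<Rightarrow> 0\<^sub>m (dim_row W) (dim_row W))"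

definition vnorm :: "complex Matrix.vec \<Rightarrow> real" where
  "vnorm v = sqrt (\<Sum>i<dim_vec v. (cmod (vec_index v i))\<^sup>2)"

definition spec_norm :: "complex mat \<Rightarrow> real" where
  "spec_norm W = (SUP v \<in> {v \<in> carrier_vec (dim_col W). vnorm v \<le> 1}. vnorm (W *\<^sub>v v))"

definition frob_norm :: "complex mat \<Rightarrow> real" where
  "frob_norm W = sqrt (\<Sum>i<dim_row W. \<Sum>j<dim_col W. (cmod (W $$ (i, j)))\<^sup>2)"

text \<open>Sum of the singular values: the square roots of the eigenvalues of \<open>W\<^sup>* W\<close>,
  counted with algebraic multiplicity.\<close>

definition nuc_norm :: "complex mat \<Rightarrow> real" where
  "nuc_norm W = (\<Sum>x \<in> spectrum (mat_adjoint W * W).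
      real (order x (char_poly (mat_adjoint W * W))) * sqrt (Re x))"

text \<open>Norm of an operator on \<open>l \<times> l\<close> matrices induced by the spectral norm.\<close>

definition op_norm :: "nat \<Rightarrow> (complex mat \<Rightarrow> complex mat) \<Rightarrow> real" where
  "op_norm l T = (SUP W \<in> {W \<in> carrier_mat l l. spec_norm W \<le> 1}. spec_norm (T W))"

definition psd :: "nat \<Rightarrow> complex mat \<Rightarrow> bool" where
  "psd l W \<longleftrightarrow> W \<in> carrier_mat l l \<and> mat_adjoint W = W \<and>
     (\<forall>v \<in> carrier_vec l. Re ((W *\<^sub>v v) \<bullet>c v) \<ge> 0)"

definition pd :: "nat \<Rightarrow> complex mat \<Rightarrow> bool" where
  "pd l W \<longleftrightarrow> W \<in> carrier_mat l l \<and> mat_adjoint W = W \<and>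
     (\<forall>v \<in> carrier_vec l. v \<noteq> 0\<^sub>v l \<longrightarrow> Re ((W *\<^sub>v v) \<bullet>c v) > 0)"

definition im_part :: "complex mat \<Rightarrow> complex mat" where
  "im_part W = (1 / (2 * \<i>)) \<cdot>\<^sub>m (W - mat_adjoint W)"

definition block11 :: "nat \<Rightarrow> complex mat \<Rightarrow> complex mat" where
  "block11 n W = Matrix.mat n n (\<lambda>(i, j). W $$ (i, j))"

definition pos_linear :: "nat \<Rightarrow> nat \<Rightarrow> (complex mat \<Rightarrow> complex mat) \<Rightarrow> bool" where
  "pos_linear l m T \<longleftrightarrow>
     (\<forall>W \<in> carrier_mat l l. T W \<in> carrier_mat m m) \<and>
     (\<forall>V \<in> carrier_mat l l. \<forall>W \<in> carrier_mat l l. T (V + W) = T V + T W) \<and>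
     (\<forall>a. \<forall>W \<in> carrier_mat l l. T (a \<cdot>\<^sub>m W) = a \<cdot>\<^sub>m T W) \<and>
     (\<forall>W. psd l W \<longrightarrow> psd m (T W))"


section \<open>Random matrices\<close>

text \<open>Entrywise expectation of a random \<open>r \<times> c\<close> matrix.\<close>

definition mexp ::
    "'w measure \<Rightarrow> nat \<Rightarrow> nat \<Rightarrow> ('w \<Rightarrow> 'b::{banach, second_countable_topology} mat) \<Rightarrow> 'b mat" where
  "mexp P r c X = Matrix.mat r c (\<lambda>(i, j). LINT \<omega>|P. X \<omega> $$ (i, j))"

definition linearization ::
    "'w measure \<Rightarrow> nat \<Rightarrow> nat \<Rightarrow> ('w \<Rightarrow> real mat) \<Rightarrow> ('w \<Rightarrow> real mat) \<Rightarrow> ('w \<Rightarrow> real mat)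
      \<Rightarrow> ('w \<Rightarrow> real mat) \<Rightarrow> bool" where
  "linearization P n d A B Q L \<longleftrightarrow>
     (\<forall>\<omega> \<in> space P.
        A \<omega> \<in> carrier_mat n n \<and> B \<omega> \<in> carrier_mat d n \<and> Q \<omega> \<in> carrier_mat d d \<and>
        transpose_mat (A \<omega>) = A \<omega> \<and> transpose_mat (Q \<omega>) = Q \<omega> \<and>
        L \<omega> = four_block_mat (A \<omega>) (transpose_mat (B \<omega>)) (B \<omega>) (Q \<omega>)) \<and>
     (AE \<omega> in P. invertible_mat (Q \<omega>)) \<and>
     invertible_mat (mexp P d d Q) \<and>
     (\<forall>i<n + d. \<forall>j<n + d.
        (\<lambda>\<omega>. L \<omega> $$ (i, j)) \<in> borel_measurable P \<and>
        integrable P (\<lambda>\<omega>. (L \<omega> $$ (i, j))\<^sup>2))"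

definition Lam :: "nat \<Rightarrow> nat \<Rightarrow> complex mat" where
  "Lam n d = four_block_mat (1\<^sub>m n) (0\<^sub>m n d) (0\<^sub>m d n) (0\<^sub>m d d)"

text \<open>\<open>X - z \<Lambda> - \<i> \<tau> I\<close>; the unregularized pencil \<open>X - z \<Lambda>\<close> is the case \<open>\<tau> = 0\<close>.\<close>

definition pencil :: "nat \<Rightarrow> nat \<Rightarrow> complex mat \<Rightarrow> real \<Rightarrow> complex \<Rightarrow> complex mat" where
  "pencil n d X \<tau> z = X - z \<cdot>\<^sub>m Lam n d - (\<i> * complex_of_real \<tau>) \<cdot>\<^sub>m 1\<^sub>m (n + d)"

definition resolvent :: "nat \<Rightarrow> nat \<Rightarrow> real mat \<Rightarrow> real \<Rightarrow> complex \<Rightarrow> complex mat" where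
  "resolvent n d X \<tau> z = minv (pencil n d (cmat X) \<tau> z)"


section \<open>The superoperator and the Dyson equation\<close>

definition superoperator ::
    "'w measure \<Rightarrow> nat \<Rightarrow> nat \<Rightarrow> ('w \<Rightarrow> real mat) \<Rightarrow> ('w \<Rightarrow> real mat)
      \<Rightarrow> (complex mat \<Rightarrow> complex mat) \<Rightarrow> (complex mat \<Rightarrow> complex mat) \<Rightarrow> bool" where
  "superoperator P n d A B S11 S \<longleftrightarrow>
     pos_linear (n + d) n S11 \<and> pos_linear (n + d) (n + d) S \<and>
     (let A0 = (\<lambda>\<omega>. cmat (A \<omega> - mexp P n n A)); B0 = (\<lambda>\<omega>. cmat (B \<omega> - mexp P d n B)) in
      \<forall>W \<in> carrier_mat (n + d) (n + d).
        S W = four_block_mat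
          (S11 W)
          (mexp P n d (\<lambda>\<omega>. A0 \<omega> * block11 n W * transpose_mat (B0 \<omega>)))
          (mexp P d n (\<lambda>\<omega>. B0 \<omega> * block11 n W * A0 \<omega>))
          (mexp P d d (\<lambda>\<omega>. B0 \<omega> * block11 n W * transpose_mat (B0 \<omega>))))"

definition uhp :: "complex set" where
  "uhp = {w. Im w > 0}"

definition holomorphic_mat :: "nat \<Rightarrow> (complex \<Rightarrow> complex mat) \<Rightarrow> bool" where
  "holomorphic_mat l M \<longleftrightarrow>
     (\<forall>w \<in> uhp. M w \<in> carrier_mat l l) \<and>
     (\<forall>i<l. \<forall>j<l. (\<lambda>w. M w $$ (i, j)) holomorphic_on uhp)"

definition dyson_eq ::
    "nat \<Rightarrow> nat \<Rightarrow> real mat \<Rightarrow> (complex mat \<Rightarrow> complex mat) \<Rightarrow> real \<Rightarrow> (complex \<Rightarrow> complex mat) \<Rightarrow> bool"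
  where
  "dyson_eq n d EL S \<tau> M \<longleftrightarrow>
     (\<forall>w \<in> uhp. pencil n d (cmat EL - S (M w)) \<tau> w * M w = 1\<^sub>m (n + d))"

definition dyson_solution ::
    "nat \<Rightarrow> nat \<Rightarrow> real mat \<Rightarrow> (complex mat \<Rightarrow> complex mat) \<Rightarrow> (complex \<Rightarrow> complex mat) \<Rightarrow> bool" where
  "dyson_solution n d EL S M \<longleftrightarrow>
     holomorphic_mat (n + d) M \<and>
     (\<forall>w \<in> uhp. psd (n + d) (im_part (M w)) \<and> pd n (im_part (block11 n (M w)))) \<and>
     dyson_eq n d EL S 0 M"

definition reg_dyson_solution ::
    "nat \<Rightarrow> nat \<Rightarrow> real mat \<Rightarrow> (complex mat \<Rightarrow> complex mat) \<Rightarrow> real \<Rightarrow> (complex \<Rightarrow> complex mat) \<Rightarrow> bool"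
  where
  "reg_dyson_solution n d EL S \<tau> M \<longleftrightarrow>
     holomorphic_mat (n + d) M \<and>
     (\<forall>w \<in> uhp. pd (n + d) (im_part (M w))) \<and>
     dyson_eq n d EL S \<tau> M"

definition S_tilde ::
    "'w measure \<Rightarrow> nat \<Rightarrow> ('w \<Rightarrow> real mat) \<Rightarrow> (complex mat \<Rightarrow> complex mat) \<Rightarrow> complex mat \<Rightarrow> complex mat"
  where
  "S_tilde P l L S W =
     (let L0 = (\<lambda>\<omega>. cmat (L \<omega> - mexp P l l L)) in
      mexp P l l (\<lambda>\<omega>. L0 \<omega> * W * L0 \<omega>) - S W)"

text \<open>In the second term the independent copy of \<open>L\<close> is realized as the second coordinate
  on the product space \<open>P \<Otimes>\<^sub>M P\<close>.\<close>

definition Delta ::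
    "'w measure \<Rightarrow> nat \<Rightarrow> nat \<Rightarrow> ('w \<Rightarrow> real mat) \<Rightarrow> real \<Rightarrow> complex \<Rightarrow> complex mat" where
  "Delta P n d L \<tau> z =
     (let l = n + d;
          L0 = (\<lambda>\<omega>. cmat (L \<omega> - mexp P l l L));
          R = (\<lambda>\<omega>. resolvent n d (L \<omega>) \<tau> z) in
      mexp P l l (\<lambda>\<omega>. L0 \<omega> * R \<omega>) +
      mexp (P \<Otimes>\<^sub>M P) l l (\<lambda>(\<omega>, \<omega>'). L0 \<omega>' * R \<omega> * L0 \<omega>' * R \<omega>))"


section \<open>Gaussian vectors and Lipschitz maps\<close>

text \<open>A vector in \<open>\<real>\<^sup>m\<close> is an extensional function on \<open>{..<m}\<close>, so that the dimension can depend on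
  an index.\<close>

definition euc :: "nat \<Rightarrow> (nat \<Rightarrow> real) set" where
  "euc m = {..<m} \<rightarrow>\<^sub>E UNIV"

definition euc_borel :: "nat \<Rightarrow> (nat \<Rightarrow> real) measure" where
  "euc_borel m = PiM {..<m} (\<lambda>_. borel)"

definition std_gauss :: "nat \<Rightarrow> (nat \<Rightarrow> real) measure" where
  "std_gauss m = PiM {..<m} (\<lambda>_. density lborel std_normal_density)"

definition lipschitz_euc ::
    "nat \<Rightarrow> (nat \<Rightarrow> real) set \<Rightarrow> (complex mat \<Rightarrow> real) \<Rightarrow> real \<Rightarrow> ((nat \<Rightarrow> real) \<Rightarrow> complex mat) \<Rightarrow> bool"
  where
  "lipschitz_euc m D nrm K F \<longleftrightarrow>
     0 \<le> K \<and> (\<forall>x \<in> D. \<forall>y \<in> D. nrm (F x - F y) \<le> K * L2_set (\<lambda>i. x i - y i) {..<m})"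

end

theory Submission
  imports
    Defs
    "HOL-Complex_Analysis.Complex_Analysis"
    "HOL-Real_Asymp.Real_Asymp"
begin

text \<open>Let \<open>R\<^sub>\<tau> = (L - z \<Lambda> - \<i>\<tau>)\<^sup>-\<^sup>1\<close> and \<open>F = E R\<^sub>\<tau>\<close>. Multiplying out, \<open>F\<close> solves the regularized Dyson
  equation up to the error \<open>E[(S\<^sup>~(R\<^sub>\<tau>) + S(R\<^sub>\<tau>) - S(F)) R\<^sub>\<tau>] - \<Delta>\<close>, where \<open>S\<^sup>~\<close> and \<open>\<Delta>\<close> vanish in the limit by
  assumption. The remaining term is a fluctuation: a \<open>\<lambda>\<close>-Lipschitz matrix function of a Gaussian vector
  deviates from its mean by \<open>O(\<lambda> \<surd>l)\<close> in spectral norm. The regularized equation is stable with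
  constants independent of the dimension, because its fixed-point map sends a bounded domain strictly
  inside itself and hence contracts, as in the Earle--Hamilton theorem; so \<open>F\<close> is close to the
  regularized solution. The resolvent identity bounds \<open>E R\<^sub>\<tau> - E R\<^sub>0\<close> by \<open>\<tau> E \<bar>R\<^sub>0\<bar>\<^sup>2\<close>, and (C2) then gives
  \<open>E R\<^sub>0 - M \<rightarrow> 0\<close>. Finally \<open>tr (U R\<^sub>0)\<close> is \<open>c l\<^bsup>-r\<^esup>\<close>-Lipschitz in the Gaussian vector by trace duality, so its
  deviations have summable tails and Borel--Cantelli applies.\<close>

section \<open>Vectors, norms and the pencil\<close>

text \<open>The order of limits shapes everything. At fixed \<open>\<tau> > 0\<close> each resolvent
  is bounded by \<open>1 / \<tau>\<close> and has a definite imaginary part in every dimension; at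
  \<open>\<tau> = 0\<close> the pencil is definite only on the first block and the norm of its
  inverse is controlled only in mean square. So l tends to infinity while \<open>\<tau>\<close>
  stays fixed, and \<open>\<tau>\<close> tends to 0 afterwards. All stability constants must
  therefore depend on \<open>\<tau>\<close>, \<open>z\<close> and uniform bounds on the data alone.
  The factor sqrt l is the price of the spectral norm: a net in the unit ball has exponentially many
  points in l, and a union bound over pairs of them adds a deviation of that order. Concentration
  comes from an inequality for products of integrals that tensorizes, leaving dimension one, where
  it reduces to Brunn-Minkowski on the line. No derivative is taken, so a Lipschitz bound outside a
  null set suffices; the unregularized resolvent has no better, its value being a mere convention at
  singular pencils. Contraction is measured by holomorphic discs through the iterates instead of an
  invariant metric; a scalar Cauchy estimate then yields explicit rates.\<close>

no_notation inner (infix \<open>\<bullet>\<close> 70)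
no_notation vec_nth (infixl \<open>$\<close> 90)
no_notation fps_nth (infixl \<open>$\<close> 75)

declare minus_carrier_mat [simp]

lemma mult_vec_carrier_square [simp]:
  "A \<in> carrier_mat n n \<Longrightarrow> v \<in> carrier_vec n \<Longrightarrow> A *\<^sub>v v \<in> carrier_vec n"
  by (rule mult_mat_vec_carrier)

lemma mult_carrier_square [simp]:
  "A \<in> carrier_mat n n \<Longrightarrow> B \<in> carrier_mat n n \<Longrightarrow> A * B \<in> carrier_mat n n"
  by (rule mult_carrier_mat)

section \<open>Complex vectors: inner product and Euclidean norm\<close>

lemma cscalar_prod_sum:
  assumes "dim_vec w = n"
  shows "v \<bullet>c w = (\<Sum>i<n. v $ i * cnj (w $ i))"
  using assms by (simp add: scalar_prod_def atLeast0LessThan)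

lemma vnorm_L2: "vnorm v = L2_set (\<lambda>i. cmod (v $ i)) {..<dim_vec v}"
  by (simp add: vnorm_def L2_set_def)

lemma vnorm_nonneg [simp]: "0 \<le> vnorm v"
  by (simp add: vnorm_L2)

lemma vnorm_zero [simp]: "vnorm (0\<^sub>v n) = 0"
  by (simp add: vnorm_def)

lemma cscalar_prod_self: "v \<bullet>c v = complex_of_real ((vnorm v)\<^sup>2)"
proof -
  have "(vnorm v)\<^sup>2 = (\<Sum>i<dim_vec v. (cmod (v $ i))\<^sup>2)"
    by (simp add: vnorm_def sum_nonneg)
  then show ?thesis
    by (simp add: cscalar_prod_sum[OF refl] complex_norm_square[symmetric] del: of_real_power)
qed

lemma cscalar_prod_swap:
  assumes "dim_vec v = dim_vec w"
  shows "w \<bullet>c v = cnj (v \<bullet>c w)"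
  using assms by (simp add: cscalar_prod_sum[OF refl] mult.commute)

lemma cscalar_prod_swap_carrier:
  assumes "v \<in> carrier_vec n" "w \<in> carrier_vec n"
  shows "w \<bullet>c v = cnj (v \<bullet>c w)"
  using assms by (intro cscalar_prod_swap) simp

lemma cauchy_schwarz_vec:
  assumes "dim_vec v = dim_vec w"
  shows "cmod (v \<bullet>c w) \<le> vnorm v * vnorm w"
proof -
  have "cmod (v \<bullet>c w) \<le> (\<Sum>i<dim_vec w. \<bar>cmod (v $ i)\<bar> * \<bar>cmod (w $ i)\<bar>)"
    unfolding cscalar_prod_sum[OF refl] by (rule order_trans[OF norm_sum]) (simp add: norm_mult)
  also have "\<dots> \<le> vnorm v * vnorm w"
    unfolding vnorm_L2 assms by (rule L2_set_mult_ineq)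
  finally show ?thesis .
qed

lemma vnorm_triangle:
  assumes "dim_vec v = dim_vec w"
  shows "vnorm (v + w) \<le> vnorm v + vnorm w"
proof -
  have "vnorm (v + w) \<le> L2_set (\<lambda>i. cmod (v $ i) + cmod (w $ i)) {..<dim_vec w}"
    unfolding vnorm_L2 using assms by (auto intro!: L2_set_mono norm_triangle_ineq)
  also have "\<dots> \<le> vnorm v + vnorm w"
    unfolding vnorm_L2 assms by (rule L2_set_triangle_ineq)
  finally show ?thesis .
qed

lemma vnorm_smult [simp]: "vnorm (a \<cdot>\<^sub>v v) = cmod a * vnorm v"
  by (auto simp: vnorm_L2 norm_mult L2_set_right_distrib intro!: L2_set_cong)

lemma vnorm_eq_0: "vnorm v = 0 \<longleftrightarrow> v = 0\<^sub>v (dim_vec v)"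
proof
  assume "vnorm v = 0"
  then have "(\<Sum>i<dim_vec v. (cmod (v $ i))\<^sup>2) = 0" by (simp add: vnorm_def)
  then show "v = 0\<^sub>v (dim_vec v)"
    by (intro eq_vecI) (auto simp: sum_nonneg_eq_0_iff)
qed (metis vnorm_zero)

lemma norm_index_le_vnorm:
  assumes "i < dim_vec v"
  shows "cmod (v $ i) \<le> vnorm v"
  unfolding vnorm_L2 using assms by (intro member_le_L2_set) auto

lemma vnorm_unit_vec [simp]: "i < n \<Longrightarrow> vnorm (unit_vec n i) = 1"
  by (simp add: vnorm_def sum.If_cases if_distrib[of cmod] if_distrib[of "\<lambda>x. x^2"] 
      unit_vec_def cong: if_cong)

lemma mult_mat_vec_sum:
  assumes "W \<in> carrier_mat n m" "v \<in> carrier_vec m" "i < n"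
  shows "(W *\<^sub>v v) $ i = (\<Sum>j<m. W $$ (i, j) * v $ j)"
  using assms by (auto simp: scalar_prod_def atLeast0LessThan intro!: sum.cong)

lemma mult_mat_index:
  assumes "V \<in> carrier_mat n m" "W \<in> carrier_mat m k" "i < n" "j < k"
  shows "(V * W) $$ (i, j) = (\<Sum>a<m. V $$ (i, a) * W $$ (a, j))"
  using assms by (auto simp: scalar_prod_def atLeast0LessThan intro!: sum.cong)

lemma cscalar_mat_sum:
  assumes "W \<in> carrier_mat n m" "v \<in> carrier_vec m" "u \<in> carrier_vec n"
  shows "(W *\<^sub>v v) \<bullet>c u = (\<Sum>i<n. \<Sum>j<m. W $$ (i, j) * v $ j * cnj (u $ i))"
  using assms by (subst cscalar_prod_sum[of _ n])
    (auto simp del: index_mult_mat_vec simp: mult_mat_vec_sum[OF assms(1,2)] sum_distrib_right intro!: sum.cong)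

section \<open>Frobenius and spectral norms\<close>

lemma frob_norm_L2:
  "frob_norm W = L2_set (\<lambda>i. L2_set (\<lambda>j. cmod (W $$ (i, j))) {..<dim_col W}) {..<dim_row W}"
  by (simp add: frob_norm_def L2_set_def sum_nonneg)

lemma frob_norm_nonneg [simp]: "0 \<le> frob_norm W"
  by (simp add: frob_norm_L2)

lemma vnorm_mult_frob:
  assumes "W \<in> carrier_mat n m" "v \<in> carrier_vec m"
  shows "vnorm (W *\<^sub>v v) \<le> frob_norm W * vnorm v"
proof -
  have dims: "dim_vec (W *\<^sub>v v) = n" "dim_row W = n" "dim_col W = m" "dim_vec v = m" using assms by auto
  have "vnorm (W *\<^sub>v v) \<le> L2_set (\<lambda>i. L2_set (\<lambda>j. cmod (W $$ (i, j))) {..<m} * vnorm v) {..<n}"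
    unfolding vnorm_L2 dims
  proof (rule L2_set_mono)
    fix i assume "i \<in> {..<n}"
    then have "cmod ((W *\<^sub>v v) $ i) \<le> (\<Sum>j<m. \<bar>cmod (W $$ (i, j))\<bar> * \<bar>cmod (v $ j)\<bar>)"
      by (subst mult_mat_vec_sum[OF assms]) (auto intro!: order_trans[OF norm_sum] simp: norm_mult)
    also have "\<dots> \<le> L2_set (\<lambda>j. cmod (W $$ (i, j))) {..<m} * L2_set (\<lambda>i. cmod (v $ i)) {..<m}"
      by (rule L2_set_mult_ineq)
    finally show "cmod ((W *\<^sub>v v) $ i) \<le> \<dots>" .
  qed simp
  also have "\<dots> = frob_norm W * vnorm v"
    by (simp add: frob_norm_L2 dims L2_set_left_distrib)
  finally show ?thesis .
qed

text \<open>Makes the supremum in \<open>spec_norm\<close> a genuine least upper bound; the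
  Frobenius norm serves as bound, by Cauchy-Schwarz in every row.\<close>

lemma spec_norm_bdd:
  "bdd_above ((\<lambda>v. vnorm (W *\<^sub>v v)) ` {v \<in> carrier_vec (dim_col W). vnorm v \<le> 1})"
proof (rule bdd_aboveI2)
  fix v assume "v \<in> {v \<in> carrier_vec (dim_col W). vnorm v \<le> 1}"
  then have v: "v \<in> carrier_vec (dim_col W)" "vnorm v \<le> 1" by auto
  show "vnorm (W *\<^sub>v v) \<le> frob_norm W"
    using vnorm_mult_frob[OF _ v(1), of W "dim_row W"] v(2) mult_left_le[OF v(2), of "frob_norm W"]
    by (auto intro: order_trans)
qed

lemma vnorm_le_spec:
  assumes "W \<in> carrier_mat n m" "v \<in> carrier_vec m"
  shows "vnorm (W *\<^sub>v v) \<le> spec_norm W * vnorm v"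
proof (cases "vnorm v = 0")
  case True
  then show ?thesis using vnorm_mult_frob[OF assms] by simp
next
  case False
  then have pos: "vnorm v > 0" using vnorm_nonneg[of v] by linarith
  define u where "u = complex_of_real (1 / vnorm v) \<cdot>\<^sub>v v"
  have "u \<in> {v \<in> carrier_vec (dim_col W). vnorm v \<le> 1}"
    using assms pos by (auto simp: u_def norm_divide)
  then have "vnorm (W *\<^sub>v u) \<le> spec_norm W"
    unfolding spec_norm_def by (rule cSUP_upper[OF _ spec_norm_bdd])
  moreover have "W *\<^sub>v u = complex_of_real (1 / vnorm v) \<cdot>\<^sub>v (W *\<^sub>v v)"
    unfolding u_def using assms by (rule mult_mat_vec)
  ultimately show ?thesis using pos by (simp add: norm_divide field_simps)
qed

lemma spec_norm_le:
  assumes "W \<in> carrier_mat n m" "0 \<le> c"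
    "\<And>v. v \<in> carrier_vec m \<Longrightarrow> vnorm (W *\<^sub>v v) \<le> c * vnorm v"
  shows "spec_norm W \<le> c"
  unfolding spec_norm_def
proof (rule cSUP_least)
  show "{v \<in> carrier_vec (dim_col W). vnorm v \<le> 1} \<noteq> {}"
    using vnorm_zero by (auto intro!: exI[of _ "0\<^sub>v (dim_col W)"])
  fix v assume "v \<in> {v \<in> carrier_vec (dim_col W). vnorm v \<le> 1}"
  then show "vnorm (W *\<^sub>v v) \<le> c"
    using assms(1) assms(3)[of v] mult_left_le[of "vnorm v" c] assms(2) by auto
qed

lemma spec_norm_nonneg [simp]: "0 \<le> spec_norm W"
  unfolding spec_norm_def
  by (rule cSUP_upper2[OF spec_norm_bdd, of "0\<^sub>v (dim_col W)"]) auto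

lemma spec_le_frob: "spec_norm W \<le> frob_norm W"
  by (rule spec_norm_le[of W "dim_row W" "dim_col W"]) (auto intro: vnorm_mult_frob)

lemma spec_form:
  assumes "W \<in> carrier_mat n m" "v \<in> carrier_vec m" "u \<in> carrier_vec n"
  shows "cmod ((W *\<^sub>v v) \<bullet>c u) \<le> spec_norm W * vnorm v * vnorm u"
proof -
  have "cmod ((W *\<^sub>v v) \<bullet>c u) \<le> vnorm (W *\<^sub>v v) * vnorm u"
    using assms by (intro cauchy_schwarz_vec) auto
  also have "\<dots> \<le> spec_norm W * vnorm v * vnorm u"
    using assms by (intro mult_right_mono vnorm_le_spec) auto
  finally show ?thesis .
qed

text \<open>Testing with u = W v recovers the norm from the sesquilinear form. Norm bounds thus
  reduce to scalar ones, which is how expectations and holomorphic families of matrices are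
  estimated below, with no loss depending on the dimension.\<close>

lemma spec_norm_le_form:
  assumes W: "W \<in> carrier_mat n m" and c: "0 \<le> c"
    and *: "\<And>u v. v \<in> carrier_vec m \<Longrightarrow> u \<in> carrier_vec n \<Longrightarrow> cmod ((W *\<^sub>v v) \<bullet>c u) \<le> c * vnorm v * vnorm u"
  shows "spec_norm W \<le> c"
proof (rule spec_norm_le[OF W c])
  fix v :: "complex Matrix.vec" assume v: "v \<in> carrier_vec m"
  have "(vnorm (W *\<^sub>v v))\<^sup>2 \<le> c * vnorm v * vnorm (W *\<^sub>v v)"
    using *[OF v, of "W *\<^sub>v v"] W v by (simp add: cscalar_prod_self norm_power)
  then show "vnorm (W *\<^sub>v v) \<le> c * vnorm v"
    using c by (cases "vnorm (W *\<^sub>v v) = 0")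
      (auto simp: power2_eq_square mult_le_cancel_right order.strict_iff_order)
qed

lemma spec_norm_triangle:
  assumes "V \<in> carrier_mat n m" "W \<in> carrier_mat n m"
  shows "spec_norm (V + W) \<le> spec_norm V + spec_norm W"
proof (rule spec_norm_le)
  fix v :: "complex Matrix.vec" assume v: "v \<in> carrier_vec m"
  have "vnorm ((V + W) *\<^sub>v v) \<le> vnorm (V *\<^sub>v v) + vnorm (W *\<^sub>v v)"
    unfolding add_mult_distrib_mat_vec[OF assms v] using assms by (intro vnorm_triangle) auto
  also have "\<dots> \<le> (spec_norm V + spec_norm W) * vnorm v"
    using vnorm_le_spec[OF assms(1) v] vnorm_le_spec[OF assms(2) v] by (simp add: algebra_simps)
  finally show "vnorm ((V + W) *\<^sub>v v) \<le> (spec_norm V + spec_norm W) * vnorm v" .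
qed (use assms in auto)

lemma smult_mat_mult_vec:
  fixes W :: "'a :: comm_semiring_0 mat"
  assumes "W \<in> carrier_mat n m" "v \<in> carrier_vec m"
  shows "(a \<cdot>\<^sub>m W) *\<^sub>v v = a \<cdot>\<^sub>v (W *\<^sub>v v)"
  using assms by (auto intro!: eq_vecI)

lemma spec_norm_smult_le:
  assumes "W \<in> carrier_mat n m"
  shows "spec_norm (a \<cdot>\<^sub>m W) \<le> cmod a * spec_norm W"
proof (rule spec_norm_le)
  fix v :: "complex Matrix.vec" assume v: "v \<in> carrier_vec m"
  show "vnorm (a \<cdot>\<^sub>m W *\<^sub>v v) \<le> cmod a * spec_norm W * vnorm v"
    unfolding smult_mat_mult_vec[OF assms v] using vnorm_le_spec[OF assms v]
    by (simp add: mult.assoc mult_left_mono)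
qed (use assms in auto)

lemma spec_norm_minus:
  assumes "V \<in> carrier_mat n m" "W \<in> carrier_mat n m"
  shows "spec_norm (V - W) \<le> spec_norm V + spec_norm W"
proof -
  have "V - W = V + (-1) \<cdot>\<^sub>m W" using assms by auto
  then show ?thesis
    using spec_norm_triangle[of V n m "(-1) \<cdot>\<^sub>m W"] spec_norm_smult_le[OF assms(2), of "-1"] assms by simp
qed

lemma spec_norm_minus_commute:
  assumes "V \<in> carrier_mat n m" "W \<in> carrier_mat n m"
  shows "spec_norm (V - W) = spec_norm (W - V)"
proof -
  have *: "spec_norm (V - W) \<le> spec_norm (W - V)" if "V \<in> carrier_mat n m" "W \<in> carrier_mat n m" for V W
  proof -
    have "V - W = (-1) \<cdot>\<^sub>m (W - V)" using that by auto
    then show ?thesis using spec_norm_smult_le[of "W - V" n m "-1"] that by simp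
  qed
  then show ?thesis using assms by (intro antisym) auto
qed

lemma spec_norm_triangle_diff:
  assumes "U \<in> carrier_mat n m" "V \<in> carrier_mat n m" "W \<in> carrier_mat n m"
  shows "spec_norm (U - W) \<le> spec_norm (U - V) + spec_norm (V - W)"
proof -
  have "U - W = (U - V) + (V - W)" using assms by (intro eq_matI) auto
  then show ?thesis using spec_norm_triangle[of "U - V" n m "V - W"] assms by simp
qed

lemma spec_norm_mult:
  assumes "V \<in> carrier_mat n m" "W \<in> carrier_mat m k"
  shows "spec_norm (V * W) \<le> spec_norm V * spec_norm W"
proof (rule spec_norm_le)
  fix v :: "complex Matrix.vec" assume v: "v \<in> carrier_vec k"
  have "vnorm (V * W *\<^sub>v v) \<le> spec_norm V * vnorm (W *\<^sub>v v)"
    unfolding assoc_mult_mat_vec[OF assms v] using assms v by (intro vnorm_le_spec) auto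
  also have "\<dots> \<le> spec_norm V * spec_norm W * vnorm v"
    using vnorm_le_spec[OF assms(2) v] by (simp add: mult.assoc mult_left_mono)
  finally show "vnorm (V * W *\<^sub>v v) \<le> spec_norm V * spec_norm W * vnorm v" .
qed (use assms in auto)

lemma spec_norm_one: "spec_norm (1\<^sub>m n) \<le> 1"
  by (rule spec_norm_le[of _ n n]) auto

lemma spec_norm_zero [simp]: "spec_norm (0\<^sub>m n m) = 0"
proof (rule antisym)
  show "spec_norm (0\<^sub>m n m) \<le> 0"
    using spec_le_frob[of "0\<^sub>m n m"] by (simp add: frob_norm_def)
qed simp

lemma norm_index_le_spec:
  assumes "W \<in> carrier_mat n m" "i < n" "j < m"
  shows "cmod (W $$ (i, j)) \<le> spec_norm W"
proof -
  have "(W *\<^sub>v unit_vec m j) $ i = W $$ (i, j)"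
    using assms by simp
  then have "cmod (W $$ (i, j)) \<le> vnorm (W *\<^sub>v unit_vec m j)"
    using norm_index_le_vnorm[of i "W *\<^sub>v unit_vec m j"] assms by simp
  also have "\<dots> \<le> spec_norm W * vnorm (unit_vec m j :: complex Matrix.vec)"
    using assms by (intro vnorm_le_spec) auto
  finally show ?thesis using assms by simp
qed

lemma spec_norm_le_entries:
  assumes "W \<in> carrier_mat n m"
  shows "spec_norm W \<le> (\<Sum>i<n. \<Sum>j<m. cmod (W $$ (i, j)))"
proof -
  have "frob_norm W \<le> (\<Sum>i<n. L2_set (\<lambda>j. cmod (W $$ (i, j))) {..<m})"
    using assms unfolding frob_norm_L2 by (auto intro!: L2_set_le_sum)
  also have "\<dots> \<le> (\<Sum>i<n. \<Sum>j<m. cmod (W $$ (i, j)))"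
    by (intro sum_mono L2_set_le_sum) auto
  finally show ?thesis using spec_le_frob[of W] by linarith
qed

section \<open>Adjoints and imaginary parts\<close>

lemma dim_mat_adjoint [simp]: "dim_row (mat_adjoint W) = dim_col W" "dim_col (mat_adjoint W) = dim_row W"
  by (auto simp: mat_adjoint_def)

lemma mat_adjoint_carrier [simp]: "W \<in> carrier_mat n m \<Longrightarrow> mat_adjoint W \<in> carrier_mat m n"
  by (metis carrier_matD carrier_matI dim_mat_adjoint)

lemma index_mat_adjoint [simp]:
  assumes "i < dim_col W" "j < dim_row W"
  shows "mat_adjoint W $$ (i, j) = cnj (W $$ (j, i))"
  using assms by (simp add: mat_adjoint_def mat_of_rows_def)

lemma adjoint_form:
  fixes W :: "complex mat"
  assumes "W \<in> carrier_mat n m" "v \<in> carrier_vec n" "u \<in> carrier_vec m"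
  shows "(mat_adjoint W *\<^sub>v v) \<bullet>c u = v \<bullet>c (W *\<^sub>v u)"
proof -
  have "v \<bullet>c (W *\<^sub>v u) = cnj ((W *\<^sub>v u) \<bullet>c v)"
    using assms by (intro cscalar_prod_swap) auto
  also have "\<dots> = (\<Sum>i<n. \<Sum>j<m. cnj (W $$ (i, j)) * cnj (u $ j) * v $ i)"
    by (subst cscalar_mat_sum[OF assms(1,3,2)]) simp
  also have "\<dots> = (\<Sum>j<m. \<Sum>i<n. cnj (W $$ (i, j)) * cnj (u $ j) * v $ i)"
    by (rule sum.swap)
  also have "\<dots> = (mat_adjoint W *\<^sub>v v) \<bullet>c u"
    using assms by (subst cscalar_mat_sum[of _ m n]) (auto intro!: sum.cong)
  finally show ?thesis by simp
qed

lemma im_part_carrier [simp]: "W \<in> carrier_mat n n \<Longrightarrow> im_part W \<in> carrier_mat n n"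
  unfolding im_part_def by auto

lemma cscalar_distrib:
  fixes w :: "complex Matrix.vec"
  assumes "u \<in> carrier_vec n" "v \<in> carrier_vec n" "w \<in> carrier_vec n"
  shows "(u + v) \<bullet>c w = u \<bullet>c w + v \<bullet>c w" "(u - v) \<bullet>c w = u \<bullet>c w - v \<bullet>c w"
    "(a \<cdot>\<^sub>v u) \<bullet>c w = a * (u \<bullet>c w)"
  using assms by (auto simp: cscalar_prod_sum[of w n] sum.distrib sum_subtractf algebra_simps sum_distrib_left
      intro!: sum.cong)

lemma im_part_form:
  assumes "W \<in> carrier_mat n n" "v \<in> carrier_vec n"
  shows "(im_part W *\<^sub>v v) \<bullet>c v = complex_of_real (Im ((W *\<^sub>v v) \<bullet>c v))"
proof -
  have "(im_part W *\<^sub>v v) \<bullet>c v = 1 / (2 * \<i>) * ((W *\<^sub>v v) \<bullet>c v - (mat_adjoint W *\<^sub>v v) \<bullet>c v)"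
    unfolding im_part_def using assms
    by (subst smult_mat_mult_vec[of _ n n])
      (auto simp: minus_mult_distrib_mat_vec[of _ n n] cscalar_distrib(3)[of _ n] cscalar_distrib(2)[of "W *\<^sub>v v" n "mat_adjoint W *\<^sub>v v"])
  also have "(mat_adjoint W *\<^sub>v v) \<bullet>c v = cnj ((W *\<^sub>v v) \<bullet>c v)"
    using assms by (subst adjoint_form[OF assms(1)]) (auto intro!: cscalar_prod_swap)
  finally show ?thesis by (simp add: complex_eq_iff)
qed

lemma im_part_hermitian:
  assumes "W \<in> carrier_mat n n"
  shows "mat_adjoint (im_part W) = im_part W"
  unfolding im_part_def using assms by (intro eq_matI) (auto simp: field_simps)

lemma psd_im_part_iff:
  assumes "W \<in> carrier_mat n n"
  shows "psd n (im_part W) \<longleftrightarrow> (\<forall>v \<in> carrier_vec n. 0 \<le> Im ((W *\<^sub>v v) \<bullet>c v))"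
  using assms by (auto simp: psd_def im_part_hermitian im_part_form)

lemma pd_imp_psd: "pd n W \<Longrightarrow> psd n W"
proof -
  assume W: "pd n W"
  have "0 \<le> Re ((W *\<^sub>v v) \<bullet>c v)" if "v \<in> carrier_vec n" for v
  proof (cases "v = 0\<^sub>v n")
    case True
    have "cmod ((W *\<^sub>v v) \<bullet>c v) \<le> spec_norm W * vnorm v * vnorm v"
      using W that by (intro spec_form[of _ n n]) (auto simp: pd_def)
    then show ?thesis using True by simp
  qed (use W that in \<open>auto simp: pd_def intro: less_imp_le\<close>)
  then show ?thesis using W by (auto simp: pd_def psd_def)
qed


section \<open>Inverse matrices\<close>

lemma minv_eq:
  assumes W: "W \<in> carrier_mat n n"
  shows "minv W = inverse (det W) \<cdot>\<^sub>m adj_mat W"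
proof (cases "det W = 0")
  case True
  \<comment> \<open>At a singular matrix \<open>minv\<close> is by convention the zero matrix, and
    \<open>inverse 0 = 0\<close> makes Cramer's rule give the same. The formula is therefore
    unconditional, and \<open>minv\<close> becomes measurable without any assumption of
    invertibility.\<close>
  have "mat_inverse W = None"
  proof (rule ccontr)
    assume "mat_inverse W \<noteq> None"
    then obtain X where X: "mat_inverse W = Some X" by auto
    from mat_inverse(2)[OF W X] W have "W \<in> Units (ring_mat TYPE(complex) n ())"
      by (auto simp: Units_def ring_mat_def)
    from unit_imp_det_non_zero[OF this] True show False by simp
  qed
  then show ?thesis using W True adj_mat(1)[OF W] by (auto simp: minv_def intro!: eq_matI)
next
  case False
  then have "W \<in> Units (ring_mat TYPE(complex) n ())" by (rule det_non_zero_imp_unit[OF W])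
  then obtain X where X: "mat_inverse W = Some X"
    using mat_inverse(1)[OF W, of "()"] by (cases "mat_inverse W") auto
  from mat_inverse(2)[OF W X] have XW: "X * W = 1\<^sub>m n" and Xc: "X \<in> carrier_mat n n" by auto
  have adjc: "adj_mat W \<in> carrier_mat n n" by (rule adj_mat(1)[OF W])
  have "adj_mat W = (X * W) * adj_mat W" using adjc XW by simp
  also have "\<dots> = X * (W * adj_mat W)" using W Xc adjc by (intro assoc_mult_mat)
  also have "\<dots> = det W \<cdot>\<^sub>m X" using adj_mat(2)[OF W] Xc by (auto intro!: eq_matI)
  finally have "inverse (det W) \<cdot>\<^sub>m adj_mat W = X" using False Xc by (auto intro!: eq_matI)
  then show ?thesis by (simp add: minv_def X)
qed

lemma minv_carrier [simp]: "W \<in> carrier_mat n n \<Longrightarrow> minv W \<in> carrier_mat n n"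
  using adj_mat(1)[of W n] by (simp add: minv_eq)

lemma minv_inverse:
  assumes W: "W \<in> carrier_mat n n" and "det W \<noteq> 0"
  shows "W * minv W = 1\<^sub>m n" "minv W * W = 1\<^sub>m n"
proof -
  show "W * minv W = 1\<^sub>m n"
    using assms adj_mat(1,2)[OF W] by (auto simp: minv_eq[OF W] mult_smult_distrib[of _ n n _ n] intro!: eq_matI)
  show "minv W * W = 1\<^sub>m n"
    using assms adj_mat(1,3)[OF W] by (auto simp: minv_eq[OF W] mult_smult_assoc_mat[of _ n n _ n] intro!: eq_matI)
qed

lemma minv_vec:
  assumes "W \<in> carrier_mat n n" "det W \<noteq> 0" "v \<in> carrier_vec n"
  shows "W *\<^sub>v (minv W *\<^sub>v v) = v" "minv W *\<^sub>v (W *\<^sub>v v) = v"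
  using assms minv_inverse[OF assms(1,2)]
  by (simp_all add: assoc_mult_mat_vec[of _ n n _ n, symmetric])

lemma minv_unique:
  assumes W: "W \<in> carrier_mat n n" and X: "X \<in> carrier_mat n n" and d: "det W \<noteq> 0" and WX: "W * X = 1\<^sub>m n"
  shows "X = minv W"
proof -
  have "X = (minv W * W) * X" using X minv_inverse[OF W d] by simp
  also have "\<dots> = minv W * (W * X)" using W X by (intro assoc_mult_mat[of _ n n _ n _ n]) auto
  finally show ?thesis using W WX right_mult_one_mat[of "minv W" n n] by simp
qed

lemma invertible_mat_iff_det:
  fixes W :: "'a :: field mat"
  assumes W: "W \<in> carrier_mat n n"
  shows "invertible_mat W \<longleftrightarrow> det W \<noteq> 0"
proof
  assume "det W \<noteq> 0"
  from det_non_zero_imp_unit[OF W this, of "()"] obtain X where "X \<in> carrier_mat n n" "X * W = 1\<^sub>m n" "W * X = 1\<^sub>m n"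
    by (auto simp: Units_def ring_mat_def)
  then show "invertible_mat W"
    using W by (auto simp: invertible_mat_def inverts_mat_def)
next
  assume "invertible_mat W"
  then obtain X where X: "W * X = 1\<^sub>m n" "X * W = 1\<^sub>m (dim_row X)"
    using W by (auto simp: invertible_mat_def inverts_mat_def)
  then have "dim_row X = n" "dim_col X = n"
    using W by (metis carrier_matD(2) index_mult_mat(3) index_one_mat(3))+
  then have Xc: "X \<in> carrier_mat n n" by auto
  from det_mult[OF W Xc] X(1) show "det W \<noteq> 0" by auto
qed

lemma minv_diff:
  assumes X: "X \<in> carrier_mat n n" "det X \<noteq> 0" and Y: "Y \<in> carrier_mat n n" "det Y \<noteq> 0"
  shows "minv X - minv Y = minv X * (Y - X) * minv Y"
proof -
  have "minv X * (Y - X) * minv Y = (minv X * Y - minv X * X) * minv Y"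
    using X Y by (subst mult_minus_distrib_mat[of _ n n _ n]) auto
  also have "\<dots> = minv X * Y * minv Y - minv X * X * minv Y"
    using X Y by (subst minus_mult_distrib_mat[of _ n n _ _ n]) auto
  also have "minv X * Y * minv Y = minv X"
    using X Y by (subst assoc_mult_mat[of _ n n _ n _ n]) (auto simp: minv_inverse right_mult_one_mat[of _ n n])
  also have "minv X * X * minv Y = minv Y"
    using X Y by (simp add: minv_inverse left_mult_one_mat[of _ n n])
  finally show ?thesis by simp
qed

section \<open>Dissipative matrices: numerical range in a lower half-plane\<close>

definition dissipative :: "nat \<Rightarrow> real \<Rightarrow> complex mat \<Rightarrow> bool" where
  "dissipative n \<tau> X \<longleftrightarrow> X \<in> carrier_mat n n \<and>
     (\<forall>v \<in> carrier_vec n. Im ((X *\<^sub>v v) \<bullet>c v) \<le> - \<tau> * (vnorm v)\<^sup>2)"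

text \<open>Cauchy-Schwarz against v itself, as in the Lax-Milgram lemma: the form at v has modulus
  at least that of its imaginary part.\<close>

lemma dissipative_lower:
  assumes "dissipative n \<tau> X" "v \<in> carrier_vec n"
  shows "\<tau> * vnorm v \<le> vnorm (X *\<^sub>v v)"
proof (cases "vnorm v = 0")
  case False
  then have pos: "vnorm v > 0" using vnorm_nonneg[of v] by linarith
  have "\<tau> * (vnorm v)\<^sup>2 \<le> cmod ((X *\<^sub>v v) \<bullet>c v)"
    using assms abs_Im_le_cmod[of "(X *\<^sub>v v) \<bullet>c v"] by (force simp: dissipative_def)
  also have "\<dots> \<le> vnorm (X *\<^sub>v v) * vnorm v"
    using assms by (intro cauchy_schwarz_vec) (auto simp: dissipative_def)
  finally show ?thesis using pos by (simp add: power2_eq_square)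
qed simp

lemma dissipative_det:
  assumes "dissipative n \<tau> X" "\<tau> > 0"
  shows "det X \<noteq> 0"
proof
  have X: "X \<in> carrier_mat n n" using assms by (simp add: dissipative_def)
  assume "det X = 0"
  then obtain v where v: "v \<in> carrier_vec n" "v \<noteq> 0\<^sub>v n" "X *\<^sub>v v = 0\<^sub>v n"
    using det_0_iff_vec_prod_zero[OF X] by auto
  then have "vnorm v = 0"
    using dissipative_lower[OF assms(1) v(1)] assms(2) vnorm_nonneg[of v]
    by (simp add: mult_le_0_iff)
  then show False using v vnorm_eq_0[of v] by simp
qed

text \<open>All three follow on substituting v = X w. The last two combine: the imaginary part of
  \<open>minv X\<close> is at least \<open>\<tau>\<close> divided by the squared norm of X, a
  positive amount controlled by a norm bound alone. This is where the fixed-point map of the Dyson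
  equation gains its room.\<close>

lemma dissipative_minv:
  assumes D: "dissipative n \<tau> X" and "\<tau> > 0"
  shows "spec_norm (minv X) \<le> 1 / \<tau>"
    and "\<And>v. v \<in> carrier_vec n \<Longrightarrow> \<tau> * (vnorm (minv X *\<^sub>v v))\<^sup>2 \<le> Im ((minv X *\<^sub>v v) \<bullet>c v)"
    and "\<And>v. v \<in> carrier_vec n \<Longrightarrow> vnorm v \<le> spec_norm X * vnorm (minv X *\<^sub>v v)"
proof -
  have X: "X \<in> carrier_mat n n" using D by (simp add: dissipative_def)
  note inv = minv_vec[OF X dissipative_det[OF assms]]
  show "spec_norm (minv X) \<le> 1 / \<tau>"
  proof (rule spec_norm_le[of _ n n])
    fix v :: "complex Matrix.vec" assume v: "v \<in> carrier_vec n"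
    show "vnorm (minv X *\<^sub>v v) \<le> 1 / \<tau> * vnorm v"
      using dissipative_lower[OF D mult_vec_carrier_square[OF minv_carrier[OF X] v]] inv(1)[OF v] \<open>\<tau> > 0\<close>
      by (simp add: field_simps)
  qed (use X \<open>\<tau> > 0\<close> in auto)
  fix v :: "complex Matrix.vec" assume v: "v \<in> carrier_vec n"
  let ?w = "minv X *\<^sub>v v"
  have w: "?w \<in> carrier_vec n" using X v by simp
  have "Im ((X *\<^sub>v ?w) \<bullet>c ?w) \<le> - \<tau> * (vnorm ?w)\<^sup>2"
    using D w by (simp add: dissipative_def)
  moreover have "?w \<bullet>c v = cnj (v \<bullet>c ?w)" by (rule cscalar_prod_swap_carrier[OF v w])
  ultimately show "\<tau> * (vnorm ?w)\<^sup>2 \<le> Im (?w \<bullet>c v)" by (simp add: inv(1)[OF v])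
  show "vnorm v \<le> spec_norm X * vnorm ?w"
    using vnorm_le_spec[OF X w] by (simp add: inv(1)[OF v])
qed

lemma shift_form:
  fixes X :: "complex mat"
  assumes X: "X \<in> carrier_mat n n" and v: "v \<in> carrier_vec n"
  shows "(X - a \<cdot>\<^sub>m 1\<^sub>m n) *\<^sub>v v = X *\<^sub>v v - a \<cdot>\<^sub>v v"
proof -
  have "(X - a \<cdot>\<^sub>m 1\<^sub>m n) *\<^sub>v v = X *\<^sub>v v - (a \<cdot>\<^sub>m 1\<^sub>m n) *\<^sub>v v"
    using assms by (intro minus_mult_distrib_mat_vec) auto
  then show ?thesis using v by (simp add: smult_mat_mult_vec[of _ n n])
qed

text \<open>For dissipative \<open>X\<close> the cross term in \<open>|(X - \<i>\<tau>)v|\<^sup>2\<close> has a sign.\<close>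

lemma dissipative_shift:
  assumes D: "dissipative n 0 X" and d: "det X \<noteq> 0" and t: "\<tau> > 0"
  defines "Y \<equiv> X - (\<i> * complex_of_real \<tau>) \<cdot>\<^sub>m 1\<^sub>m n"
  shows "spec_norm (minv Y) \<le> spec_norm (minv X)"
    and "spec_norm (minv Y - minv X) \<le> \<tau> * (spec_norm (minv X))\<^sup>2"
proof -
  have X: "X \<in> carrier_mat n n" using D by (simp add: dissipative_def)
  have Y: "Y \<in> carrier_mat n n" using X by (simp add: Y_def)
  have YD: "dissipative n \<tau> Y"
    unfolding dissipative_def
  proof (intro conjI ballI Y)
    fix v :: "complex Matrix.vec" assume v: "v \<in> carrier_vec n"
    have "(Y *\<^sub>v v) \<bullet>c v = (X *\<^sub>v v) \<bullet>c v - (\<i> * complex_of_real \<tau>) * (v \<bullet>c v)"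
      unfolding Y_def shift_form[OF X v] using X v by (simp add: cscalar_distrib[of _ n])
    then show "Im ((Y *\<^sub>v v) \<bullet>c v) \<le> - \<tau> * (vnorm v)\<^sup>2"
      using D v by (auto simp: dissipative_def cscalar_prod_self simp del: of_real_power)
  qed
  note dY = dissipative_det[OF YD t]
  have lower: "vnorm (X *\<^sub>v v) \<le> vnorm (Y *\<^sub>v v)" if v: "v \<in> carrier_vec n" for v
  proof -
    let ?a = "X *\<^sub>v v" and ?b = "(\<i> * complex_of_real \<tau>) \<cdot>\<^sub>v v"
    have a: "?a \<in> carrier_vec n" and b: "?b \<in> carrier_vec n" using X v by auto
    have "complex_of_real ((vnorm (?a - ?b))\<^sup>2) = (?a - ?b) \<bullet>c (?a - ?b)"
      by (rule cscalar_prod_self[symmetric])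
    also have "\<dots> = ?a \<bullet>c (?a - ?b) - ?b \<bullet>c (?a - ?b)" using a b by (intro cscalar_distrib) auto
    also have "?a \<bullet>c (?a - ?b) = cnj ((?a - ?b) \<bullet>c ?a)" using a b by (intro cscalar_prod_swap_carrier[of _ n]) auto
    also have "?b \<bullet>c (?a - ?b) = cnj ((?a - ?b) \<bullet>c ?b)" using a b by (intro cscalar_prod_swap_carrier[of _ n]) auto
    also have "(?a - ?b) \<bullet>c ?a = ?a \<bullet>c ?a - ?b \<bullet>c ?a" using a b by (intro cscalar_distrib) auto
    also have "(?a - ?b) \<bullet>c ?b = ?a \<bullet>c ?b - ?b \<bullet>c ?b" using a b by (intro cscalar_distrib) auto
    also have "?a \<bullet>c ?b = cnj (?b \<bullet>c ?a)" using a b by (intro cscalar_prod_swap_carrier[of _ n]) auto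
    finally have "(vnorm (?a - ?b))\<^sup>2 = (vnorm ?a)\<^sup>2 - 2 * Re (?b \<bullet>c ?a) + (vnorm ?b)\<^sup>2"
      by (simp only: cscalar_prod_self complex_eq_iff) simp
    moreover have "?b \<bullet>c ?a = \<i> * complex_of_real \<tau> * cnj (?a \<bullet>c v)"
      using a v carrier_matD[OF X] by (subst cscalar_distrib(3)[of _ n]) (auto intro!: cscalar_prod_swap_carrier[of _ n])
    moreover have "\<tau> * Im (?a \<bullet>c v) \<le> 0"
      using D v t by (auto simp: dissipative_def mult_le_0_iff)
    ultimately have "(vnorm ?a)\<^sup>2 \<le> (vnorm (?a - ?b))\<^sup>2"
      by (simp del: vnorm_smult) (rule order_trans[of _ 0], simp_all del: vnorm_smult)
    then show ?thesis unfolding Y_def shift_form[OF X v] by (rule power2_le_imp_le) simp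
  qed
  show le: "spec_norm (minv Y) \<le> spec_norm (minv X)"
  proof (rule spec_norm_le[of _ n n])
    fix v :: "complex Matrix.vec" assume v: "v \<in> carrier_vec n"
    let ?w = "minv Y *\<^sub>v v"
    have w: "?w \<in> carrier_vec n" using Y v by simp
    have "vnorm ?w = vnorm (minv X *\<^sub>v (X *\<^sub>v ?w))" using minv_vec(2)[OF X d w] by simp
    also have "\<dots> \<le> spec_norm (minv X) * vnorm (X *\<^sub>v ?w)" using X w by (intro vnorm_le_spec[of _ n n]) auto
    also have "\<dots> \<le> spec_norm (minv X) * vnorm (Y *\<^sub>v ?w)" by (intro mult_left_mono lower w) simp
    finally show "vnorm ?w \<le> spec_norm (minv X) * vnorm v" by (simp add: minv_vec(1)[OF Y dY v])
  qed (use Y in auto)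
  have XY: "X - Y = (\<i> * complex_of_real \<tau>) \<cdot>\<^sub>m 1\<^sub>m n" using X by (auto simp: Y_def intro!: eq_matI)
  have "spec_norm (minv Y - minv X) \<le> spec_norm (minv Y) * spec_norm (X - Y) * spec_norm (minv X)"
    unfolding minv_diff[OF Y dY X d]
    using X Y by (intro order_trans[OF spec_norm_mult[of _ n n _ n]] mult_right_mono spec_norm_mult) auto
  also have "spec_norm (X - Y) \<le> \<tau>"
    unfolding XY using spec_norm_smult_le[of "1\<^sub>m n" n n "\<i> * complex_of_real \<tau>"] spec_norm_one[of n] t
    by (simp add: norm_mult) (metis dual_order.trans mult.right_neutral mult_le_cancel_left_pos)
  finally show "spec_norm (minv Y - minv X) \<le> \<tau> * (spec_norm (minv X))\<^sup>2"
    using le t by (auto simp: power2_eq_square algebra_simps mult_left_mono mult_right_mono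
      intro: order_trans[OF _ mult_mono])
qed

section \<open>The pencil\<close>

lemma Lam_index:
  assumes "i < n + d" "j < n + d"
  shows "Lam n d $$ (i, j) = (if i = j \<and> i < n then 1 else 0)"
  using assms by (auto simp: Lam_def)

lemma Lam_carrier [simp]: "Lam n d \<in> carrier_mat (n + d) (n + d)"
  by (auto simp: Lam_def)

lemma Lam_form:
  assumes "v \<in> carrier_vec (n + d)"
  shows "(Lam n d *\<^sub>v v) \<bullet>c v = complex_of_real (\<Sum>i<n. (cmod (v $ i))\<^sup>2)"
proof -
  have "(Lam n d *\<^sub>v v) \<bullet>c v
      = (\<Sum>i<n + d. \<Sum>j<n + d. (if j = i then (if i < n then v $ i * cnj (v $ i) else 0) else 0))"
    unfolding cscalar_mat_sum[OF Lam_carrier assms assms]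
    by (intro sum.cong) (auto simp: Lam_index)
  also have "\<dots> = (\<Sum>i<n. v $ i * cnj (v $ i))"
    by (simp add: sum.delta' sum.If_cases) (auto intro!: sum.cong)
  finally show ?thesis by (simp add: complex_norm_square[symmetric] del: of_real_power)
qed

lemma spec_norm_Lam: "spec_norm (Lam n d) \<le> 1"
proof (rule spec_norm_le[of _ "n + d" "n + d"])
  fix v :: "complex Matrix.vec" assume v: "v \<in> carrier_vec (n + d)"
  have "(Lam n d *\<^sub>v v) $ i = (if i < n then v $ i else 0)" if "i < n + d" for i
    using v that by (subst mult_mat_vec_sum[OF Lam_carrier v]) (auto simp: Lam_index if_distrib sum.delta' if_distribR cong: if_cong)
  then show "vnorm (Lam n d *\<^sub>v v) \<le> 1 * vnorm v"
    using v carrier_matD[OF Lam_carrier[of n d]]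
    by (auto simp: vnorm_L2 simp del: index_mult_mat_vec intro!: L2_set_mono)
qed auto

lemma pencil_carrier [simp]: "X \<in> carrier_mat (n + d) (n + d) \<Longrightarrow> pencil n d X \<tau> z \<in> carrier_mat (n + d) (n + d)"
  by (simp add: pencil_def)

text \<open>Separates the three sources of imaginary part. \<open>Lam\<close> contributes only on
  the first n coordinates, so at \<open>\<tau> = 0\<close> the pencil is dissipative only in the
  weak sense and its invertibility calls for a separate argument.\<close>

lemma pencil_form:
  assumes X: "X \<in> carrier_mat (n + d) (n + d)" and v: "v \<in> carrier_vec (n + d)"
  shows "Im ((pencil n d X \<tau> z *\<^sub>v v) \<bullet>c v)
    = Im ((X *\<^sub>v v) \<bullet>c v) - Im z * (\<Sum>i<n. (cmod (v $ i))\<^sup>2) - \<tau> * (vnorm v)\<^sup>2"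
proof -
  have "pencil n d X \<tau> z *\<^sub>v v = X *\<^sub>v v - z \<cdot>\<^sub>v (Lam n d *\<^sub>v v) - (\<i> * complex_of_real \<tau>) \<cdot>\<^sub>v v"
    unfolding pencil_def using X v
    by (simp add: shift_form minus_mult_distrib_mat_vec[of _ "n + d" "n + d"] smult_mat_mult_vec[of _ "n + d" "n + d"])
  moreover have "X *\<^sub>v v \<in> carrier_vec (n + d)" "Lam n d *\<^sub>v v \<in> carrier_vec (n + d)"
    using X v by (auto intro: mult_mat_vec_carrier)
  ultimately have "(pencil n d X \<tau> z *\<^sub>v v) \<bullet>c v
      = (X *\<^sub>v v) \<bullet>c v - z * ((Lam n d *\<^sub>v v) \<bullet>c v) - (\<i> * complex_of_real \<tau>) * (v \<bullet>c v)"
    using v by (simp add: cscalar_distrib[of _ "n + d" _ v])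
  then show ?thesis
    by (simp add: Lam_form[OF v] cscalar_prod_self del: of_real_power of_real_sum)
qed

lemma spec_norm_pencil:
  assumes X: "X \<in> carrier_mat (n + d) (n + d)" and t: "\<tau> \<ge> 0"
  shows "spec_norm (pencil n d X \<tau> z) \<le> spec_norm X + cmod z + \<tau>"
proof -
  have "spec_norm (pencil n d X \<tau> z) \<le> spec_norm (X - z \<cdot>\<^sub>m Lam n d) + spec_norm ((\<i> * complex_of_real \<tau>) \<cdot>\<^sub>m 1\<^sub>m (n + d))"
    unfolding pencil_def using X by (intro spec_norm_minus[of _ "n + d" "n + d"]) auto
  also have "spec_norm (X - z \<cdot>\<^sub>m Lam n d) \<le> spec_norm X + spec_norm (z \<cdot>\<^sub>m Lam n d)"
    using X by (intro spec_norm_minus[of _ "n + d" "n + d"]) auto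
  also have "spec_norm (z \<cdot>\<^sub>m Lam n d) \<le> cmod z"
    using spec_norm_smult_le[OF Lam_carrier, of z n d] spec_norm_Lam[of n d] mult_left_le[of "spec_norm (Lam n d)" "cmod z"] by simp
  also have "spec_norm ((\<i> * complex_of_real \<tau>) \<cdot>\<^sub>m 1\<^sub>m (n + d)) \<le> \<tau>"
    using spec_norm_smult_le[of "1\<^sub>m (n + d)" "n + d" "n + d" "\<i> * complex_of_real \<tau>"] spec_norm_one[of "n + d"] t
      mult_left_le[of "spec_norm (1\<^sub>m (n + d))" \<tau>] by (simp add: norm_mult)
  finally show ?thesis by simp
qed

lemma pencil_dissipative:
  assumes X: "X \<in> carrier_mat (n + d) (n + d)" and z: "z \<in> uhp"
    and im: "\<And>v. v \<in> carrier_vec (n + d) \<Longrightarrow> Im ((X *\<^sub>v v) \<bullet>c v) \<le> 0"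
  shows "dissipative (n + d) \<tau> (pencil n d X \<tau> z)"
  unfolding dissipative_def
proof (intro conjI ballI)
  fix v :: "complex Matrix.vec" assume v: "v \<in> carrier_vec (n + d)"
  have "0 \<le> Im z * (\<Sum>i<n. (cmod (v $ i))\<^sup>2)" using z by (simp add: uhp_def sum_nonneg)
  then show "Im ((pencil n d X \<tau> z *\<^sub>v v) \<bullet>c v) \<le> - \<tau> * (vnorm v)\<^sup>2"
    using im[OF v] by (simp add: pencil_form[OF X v])
qed (use X in auto)

lemma hermitian_form:
  assumes "X \<in> carrier_mat n n" "mat_adjoint X = X" "v \<in> carrier_vec n"
  shows "Im ((X *\<^sub>v v) \<bullet>c v) = 0"
proof -
  have "(X *\<^sub>v v) \<bullet>c v = v \<bullet>c (X *\<^sub>v v)" using adjoint_form[OF assms(1,3,3)] assms(2) by simp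
  also have "\<dots> = cnj ((X *\<^sub>v v) \<bullet>c v)" using assms by (intro cscalar_prod_swap_carrier[of _ n]) auto
  finally show ?thesis by (simp add: complex_eq_iff)
qed

lemma adjoint_cmat:
  assumes "X \<in> carrier_mat n n" "transpose_mat X = X"
  shows "mat_adjoint (cmat X) = cmat X"
proof (rule eq_matI)
  fix i j assume "i < dim_row (cmat X)" "j < dim_col (cmat X)"
  then show "mat_adjoint (cmat X) $$ (i, j) = cmat X $$ (i, j)"
    using assms(1) by simp (metis assms(1,2) carrier_matD index_transpose_mat(1))
qed (use assms in auto)

text \<open>A null vector makes the form vanish, and its imaginary part is -Im z times the squared
  length of the first n coordinates; so these are zero. The remaining d coordinates then form a null
  vector of Q.\<close>

lemma pencil_invertible:
  assumes X: "X \<in> carrier_mat (n + d) (n + d)" "transpose_mat X = X"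
    and Q: "Q \<in> carrier_mat d d" "invertible_mat Q"
    and XQ: "\<And>i j. i < d \<Longrightarrow> j < d \<Longrightarrow> X $$ (n + i, n + j) = Q $$ (i, j)"
    and z: "z \<in> uhp"
  shows "det (pencil n d (cmat X) 0 z) \<noteq> 0"
proof
  let ?P = "pencil n d (cmat X) 0 z"
  have P: "?P \<in> carrier_mat (n + d) (n + d)" using X by simp
  assume "det ?P = 0"
  then obtain v where v: "v \<in> carrier_vec (n + d)" "v \<noteq> 0\<^sub>v (n + d)" "?P *\<^sub>v v = 0\<^sub>v (n + d)"
    using det_0_iff_vec_prod_zero[OF P] by auto
  have "Im ((?P *\<^sub>v v) \<bullet>c v) = 0"
    unfolding v(3) using v(1) by (simp add: cscalar_prod_sum)
  then have "(\<Sum>i<n. (cmod (v $ i))\<^sup>2) = 0"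
    using X v z hermitian_form[OF _ adjoint_cmat[OF X] v(1)] pencil_form[of "cmat X" n d v 0 z] by (simp add: uhp_def)
  then have v0: "v $ i = 0" if "i < n" for i using that by (auto simp: sum_nonneg_eq_0_iff)
  define w where "w = Matrix.vec d (\<lambda>i. v $ (n + i))"
  have "cmat Q *\<^sub>v w = 0\<^sub>v d"
  proof (rule eq_vecI)
    fix i assume "i < dim_vec (0\<^sub>v d :: complex Matrix.vec)"
    then have i: "i < d" by simp
    have "(cmat Q *\<^sub>v w) $ i = (\<Sum>j<d. cmat Q $$ (i, j) * w $ j)"
      using Q i by (intro mult_mat_vec_sum) (auto simp: w_def)
    also have "\<dots> = (\<Sum>j<d. ?P $$ (n + i, n + j) * v $ (n + j))"
      using Q X i by (intro sum.cong) (auto simp: w_def pencil_def Lam_index XQ Lam_def)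
    also have "\<dots> = (\<Sum>j\<in>{n..<n + d}. ?P $$ (n + i, j) * v $ j)"
      by (rule sum.reindex_bij_witness[of _ "\<lambda>j. j - n" "\<lambda>j. n + j"]) auto
    also have "\<dots> = (\<Sum>j<n + d. ?P $$ (n + i, j) * v $ j)"
      by (rule sum.mono_neutral_left) (auto simp: v0)
    also have "\<dots> = (?P *\<^sub>v v) $ (n + i)" using i by (intro mult_mat_vec_sum[symmetric, OF P v(1)]) auto
    finally show "(cmat Q *\<^sub>v w) $ i = 0\<^sub>v d $ i" using i by (simp add: v(3))
  qed (use Q in auto)
  moreover have "w \<noteq> 0\<^sub>v d"
  proof
    assume w: "w = 0\<^sub>v d"
    have "v = 0\<^sub>v (n + d)"
    proof (rule eq_vecI)
      fix i assume i: "i < dim_vec (0\<^sub>v (n + d) :: complex Matrix.vec)"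
      show "v $ i = 0\<^sub>v (n + d) $ i"
      proof (cases "i < n")
        case False
        then have "n + (i - n) = i" "i - n < d" using i by auto
          then have "v $ i = w $ (i - n)" unfolding w_def by (metis index_vec)
        then show ?thesis using w i False by simp
      qed (use i v0 in simp)
    qed (use v in auto)
    then show False using v by simp
  qed
  ultimately have "det (cmat Q) = 0"
    using Q by (subst det_0_iff_vec_prod_zero[of _ d]) (auto simp: w_def intro!: exI[of _ w])
  moreover have "det (cmat Q) = complex_of_real (det Q)"
    by (rule of_real_hom.hom_det)
  ultimately show False using Q invertible_mat_iff_det[OF Q(1)] by simp
qed

section \<open>Diagonalization of Hermitian matrices and trace duality\<close>

lemma mat_adjoint_mult:
  fixes A B :: "complex mat"
  assumes A: "A \<in> carrier_mat n m" and B: "B \<in> carrier_mat m k"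
  shows "mat_adjoint (A * B) = mat_adjoint B * mat_adjoint A"
proof (rule eq_matI)
  fix i j assume "i < dim_row (mat_adjoint B * mat_adjoint A)" "j < dim_col (mat_adjoint B * mat_adjoint A)"
  then have ij: "i < k" "j < n" using A B by auto
  have "mat_adjoint (A * B) $$ (i, j) = cnj ((A * B) $$ (j, i))"
    using A B ij by (intro index_mat_adjoint) auto
  also have "\<dots> = (\<Sum>a<m. mat_adjoint B $$ (i, a) * mat_adjoint A $$ (a, j))"
    using A B ij by (subst mult_mat_index[OF A B]) (auto simp: mult.commute intro!: sum.cong)
  also have "\<dots> = (mat_adjoint B * mat_adjoint A) $$ (i, j)"
    using A B ij by (intro mult_mat_index[symmetric]) auto
  finally show "mat_adjoint (A * B) $$ (i, j) = (mat_adjoint B * mat_adjoint A) $$ (i, j)" .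
qed (use A B in auto)

lemma mat_adjoint_adjoint: "mat_adjoint (mat_adjoint A) = (A :: complex mat)"
  by (rule eq_matI) auto

text \<open>Complete v to a basis and orthogonalize. \<open>gram_schmidt\<close> keeps the first
  vector but does not normalize, hence the division of each column by its length. Prescribing column
  0 lets the diagonalization split off one eigenvector.\<close>

lemma unitary_with_first_column:
  assumes v: "v \<in> carrier_vec n" and v0: "v \<noteq> 0\<^sub>v n"
  shows "\<exists>W \<in> carrier_mat n n. mat_adjoint W * W = 1\<^sub>m n \<and>
    (\<forall>i<n. W $$ (i, 0) = v $ i / complex_of_real (vnorm v))"
proof -
  interpret cof_vec_space n "TYPE(complex)" .
  note bc = basis_completion[OF v v0]
  define ws where "ws = gram_schmidt n (basis_completion v)"
  from gram_schmidt_result[OF bc(2,4,5) refl] bc(6)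
  have ws: "set ws \<subseteq> carrier_vec n" "corthogonal ws" "length ws = n" by (auto simp: ws_def)
  have n: "n > 0" using v v0 by (cases n) auto
  obtain vs where "basis_completion v = v # vs"
    using bc(6,7) n by (cases "basis_completion v") auto
  then have "hd ws = v" using v by (simp add: ws_def)
  then have ws0: "ws ! 0 = v" using ws(3) n by (cases ws) auto
  have wsc: "ws ! i \<in> carrier_vec n" if "i < n" for i using ws that by auto
  have nz: "vnorm (ws ! i) \<noteq> 0" if "i < n" for i
    using corthogonalD[OF ws(2), of i i] ws(3) that by (auto simp: cscalar_prod_self)
  define W where "W = Matrix.mat n n (\<lambda>(i, j). ws ! j $ i / complex_of_real (vnorm (ws ! j)))"
  have W: "W \<in> carrier_mat n n" by (simp add: W_def)
  have "mat_adjoint W * W = 1\<^sub>m n"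
  proof (rule eq_matI)
    fix i j assume ij: "i < dim_row (1\<^sub>m n :: complex mat)" "j < dim_col (1\<^sub>m n :: complex mat)"
    then have ij: "i < n" "j < n" by auto
    have "(mat_adjoint W * W) $$ (i, j) = (\<Sum>a<n. mat_adjoint W $$ (i, a) * W $$ (a, j))"
      using W ij by (intro mult_mat_index[of _ n n _ n]) auto
    also have "\<dots> = (\<Sum>a<n. (ws ! j $ a * cnj (ws ! i $ a)) / (vnorm (ws ! i) * vnorm (ws ! j)))"
      using W ij by (intro sum.cong) (auto simp: W_def)
    also have "\<dots> = (ws ! j \<bullet>c ws ! i) / (vnorm (ws ! i) * vnorm (ws ! j))"
      using wsc[of i] ij by (subst cscalar_prod_sum[of _ n]) (auto simp: sum_divide_distrib)
    also have "\<dots> = 1\<^sub>m n $$ (i, j)"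
      using corthogonalD[OF ws(2), of j i] ws(3) nz[of i] ij by (auto simp: cscalar_prod_self power2_eq_square)
    finally show "(mat_adjoint W * W) $$ (i, j) = 1\<^sub>m n $$ (i, j)" .
  qed (use W in auto)
  moreover have "\<forall>i<n. W $$ (i, 0) = v $ i / complex_of_real (vnorm v)"
    using n by (simp add: W_def ws0)
  ultimately show ?thesis using W by (intro bexI[of _ W] conjI)
qed

definition diag_list :: "complex list \<Rightarrow> complex mat" where
  "diag_list es = Matrix.mat (length es) (length es) (\<lambda>(i, j). if i = j then es ! i else 0)"

lemma diag_list_simps [simp]:
  "dim_row (diag_list es) = length es" "dim_col (diag_list es) = length es"
  "diag_list es \<in> carrier_mat (length es) (length es)"
  "i < length es \<Longrightarrow> j < length es \<Longrightarrow> diag_list es $$ (i, j) = (if i = j then es ! i else 0)"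
  by (auto simp: diag_list_def)

lemma mult_block_diag:
  assumes "X \<in> carrier_mat k k" "X' \<in> carrier_mat k k" "Y \<in> carrier_mat m m" "Y' \<in> carrier_mat m m"
  shows "four_block_mat X (0\<^sub>m k m) (0\<^sub>m m k) Y * four_block_mat X' (0\<^sub>m k m) (0\<^sub>m m k) Y'
    = four_block_mat (X * X') (0\<^sub>m k m) (0\<^sub>m m k) (Y * (Y' :: 'a :: semiring_1 mat))"
proof -
  have "X * 0\<^sub>m k m = 0\<^sub>m k m" "Y * 0\<^sub>m m k = 0\<^sub>m m k" "0\<^sub>m k m * 0\<^sub>m m k = (0\<^sub>m k k :: 'a mat)"
    "0\<^sub>m m k * 0\<^sub>m k m = (0\<^sub>m m m :: 'a mat)" "0\<^sub>m k m * Y' = 0\<^sub>m k m" "0\<^sub>m m k * X' = 0\<^sub>m m k"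
    using assms by (auto intro: right_mult_zero_mat left_mult_zero_mat)
  then show ?thesis
    using assms mult_carrier_mat[OF assms(1,2)] mult_carrier_mat[OF assms(3,4)]
    by (subst mult_four_block_mat[of _ k k _ m _ m _ _ k _ m]) auto
qed

text \<open>Induction by deflation: in a unitary basis starting with an eigenvector the matrix is
  block diagonal. The factorization of the characteristic polynomial is carried along with the
  eigenvectors because \<open>nuc_norm\<close> counts eigenvalues by algebraic multiplicity.\<close>

theorem hermitian_diagonalization:
  assumes "A \<in> carrier_mat n n" "mat_adjoint A = A"
  shows "\<exists>W es. W \<in> carrier_mat n n \<and> mat_adjoint W * W = 1\<^sub>m n \<and> length es = n \<and>
    char_poly A = (\<Prod>e\<leftarrow>es. [:- e, 1:]) \<and> A * W = W * diag_list es"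
  using assms
proof (induction n arbitrary: A)
  case 0
  have "char_poly A = 1"
    using degree_monic_char_poly[OF 0(1)] monic_degree_0[of "char_poly A"] by simp
  moreover have "mat_adjoint (1\<^sub>m 0) * 1\<^sub>m 0 = (1\<^sub>m 0 :: complex mat)" "A * 1\<^sub>m 0 = 1\<^sub>m 0 * diag_list []"
    using 0 by (auto intro!: eq_matI)
  ultimately show ?case
    by (intro exI[of _ "1\<^sub>m 0"] exI[of _ "[]"]) simp
next
  case (Suc m)
  define n where "n = Suc m"
  have A: "A \<in> carrier_mat n n" using Suc by (simp add: n_def)
  have "degree (char_poly A) \<noteq> 0" using degree_monic_char_poly[OF A] by (simp add: n_def)
  then obtain e where "poly (char_poly A) e = 0"
    using Fundamental_Theorem_Algebra.fundamental_theorem_of_algebra[of "char_poly A"] by (auto simp: constant_degree)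
  then obtain v where v: "v \<in> carrier_vec n" "v \<noteq> 0\<^sub>v n" "A *\<^sub>v v = e \<cdot>\<^sub>v v"
    using eigenvalue_root_char_poly[OF A] A by (auto simp: eigenvalue_def eigenvector_def)
  obtain W where W: "W \<in> carrier_mat n n" and WW: "mat_adjoint W * W = 1\<^sub>m n"
    and W0: "\<And>i. i < n \<Longrightarrow> W $$ (i, 0) = v $ i / complex_of_real (vnorm v)"
    using unitary_with_first_column[OF v(1,2)] by auto
  define V where "V = mat_adjoint W"
  have V: "V \<in> carrier_mat n n" using W by (simp add: V_def)
  have VW: "V * W = 1\<^sub>m n" using WW by (simp add: V_def)
  have WV: "W * V = 1\<^sub>m n" by (rule mat_mult_left_right_inverse[OF V W VW])
  define A' where "A' = V * (A * W)"
  have A': "A' \<in> carrier_mat n n" using A V W by (simp add: A'_def)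
  have herm: "mat_adjoint A' = A'"
    unfolding A'_def using A V W Suc.prems(2)
    by (simp add: mat_adjoint_mult[of _ n n _ n] mat_adjoint_adjoint V_def assoc_mult_mat[of _ n n _ n _ n])
  have AW: "A * W = W * A'"
  proof -
    have "W * A' = (W * V) * (A * W)"
      unfolding A'_def using A V W by (intro assoc_mult_mat[symmetric]) auto
    then show ?thesis using A W WV by (simp add: left_mult_one_mat[of _ n n])
  qed
  have AWV: "A = W * A' * V"
  proof -
    have "W * A' * V = A * (W * V)"
      unfolding AW[symmetric] using A V W by (intro assoc_mult_mat)
    then show ?thesis using A WV by simp
  qed
  have col0: "A' $$ (i, 0) = (if i = 0 then e else 0)" if i: "i < n" for i
  proof -
    have AW0: "(A * W) $$ (k, 0) = e * W $$ (k, 0)" if k: "k < n" for k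
    proof -
      have "(A * W) $$ (k, 0) = (\<Sum>a<n. A $$ (k, a) * W $$ (a, 0))"
        using A W k by (intro mult_mat_index[of _ n n _ n]) (auto simp: n_def)
      also have "\<dots> = (\<Sum>a<n. A $$ (k, a) * v $ a) / vnorm v"
        by (simp add: W0 sum_divide_distrib)
      also have "(\<Sum>a<n. A $$ (k, a) * v $ a) = (A *\<^sub>v v) $ k"
        using A v k by (intro mult_mat_vec_sum[symmetric]) auto
      finally show ?thesis using v k by (simp add: W0)
    qed
    have "A' $$ (i, 0) = (\<Sum>k<n. V $$ (i, k) * (A * W) $$ (k, 0))"
      unfolding A'_def using A V W i by (intro mult_mat_index[of _ n n _ n]) (auto simp: n_def)
    also have "\<dots> = e * (\<Sum>k<n. V $$ (i, k) * W $$ (k, 0))"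
      by (simp add: AW0 sum_distrib_left mult.left_commute)
    also have "(\<Sum>k<n. V $$ (i, k) * W $$ (k, 0)) = (V * W) $$ (i, 0)"
      using V W i by (intro mult_mat_index[symmetric, of _ n n _ n]) (auto simp: n_def)
    finally show ?thesis using i by (simp add: VW)
  qed
  \<comment> \<open>Hermitian symmetry turns the zeros of the first column into zeros of the first
    row; at the corner it shows that e equals its conjugate.\<close>
  have row0: "A' $$ (0, j) = (if j = 0 then e else 0)" if j: "j < n" for j
  proof -
    have "A' $$ (0, j) = cnj (A' $$ (j, 0))"
      using A' j herm index_mat_adjoint[of 0 A' j] by (simp add: n_def)
    also have "\<dots> = (if j = 0 then cnj e else 0)" using col0[OF j] by simp
    finally show ?thesis using col0[of 0] by (auto simp: n_def split: if_splits)
  qed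
  define A1 where "A1 = Matrix.mat 1 1 (\<lambda>_. e)"
  define A4 where "A4 = Matrix.mat m m (\<lambda>(i, j). A' $$ (Suc i, Suc j))"
  have A4: "A4 \<in> carrier_mat m m" by (simp add: A4_def)
  have A1: "A1 \<in> carrier_mat 1 1" by (simp add: A1_def)
  have block: "A' = four_block_mat A1 (0\<^sub>m 1 m) (0\<^sub>m m 1) A4"
  proof (rule eq_matI)
    fix i j assume "i < dim_row (four_block_mat A1 (0\<^sub>m 1 m) (0\<^sub>m m 1) A4)" "j < dim_col (four_block_mat A1 (0\<^sub>m 1 m) (0\<^sub>m m 1) A4)"
    then have "i < n" "j < n" by (auto simp: A1_def A4_def n_def)
    then show "A' $$ (i, j) = four_block_mat A1 (0\<^sub>m 1 m) (0\<^sub>m m 1) A4 $$ (i, j)"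
      using col0[of i] row0[of j] by (cases i; cases j) (auto simp: A1_def A4_def n_def)
  qed (use A' in \<open>auto simp: A1_def A4_def n_def\<close>)
  have A4h: "mat_adjoint A4 = A4"
  proof (rule eq_matI)
    fix i j assume "i < dim_row A4" "j < dim_col A4"
    then have ij: "i < m" "j < m" by (auto simp: A4_def)
    have "A' $$ (Suc i, Suc j) = mat_adjoint A' $$ (Suc i, Suc j)" by (simp add: herm)
    also have "\<dots> = cnj (A' $$ (Suc j, Suc i))" using A' ij by (intro index_mat_adjoint) (auto simp: n_def)
    finally show "mat_adjoint A4 $$ (i, j) = A4 $$ (i, j)" using ij by (simp add: A4_def)
  qed (auto simp: A4_def)
  obtain W4 es where W4: "W4 \<in> carrier_mat m m" "mat_adjoint W4 * W4 = 1\<^sub>m m" "length es = m"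
    "char_poly A4 = (\<Prod>e\<leftarrow>es. [:- e, 1:])" "A4 * W4 = W4 * diag_list es"
    using Suc.IH[OF A4 A4h] by blast
  define F where "F = four_block_mat (1\<^sub>m 1) (0\<^sub>m 1 m) (0\<^sub>m m 1) W4"
  have F: "F \<in> carrier_mat n n" using W4 by (auto simp: F_def n_def)
  have Fadj: "mat_adjoint F = four_block_mat (1\<^sub>m 1) (0\<^sub>m 1 m) (0\<^sub>m m 1) (mat_adjoint W4)"
    using W4(1) by (intro eq_matI) (auto simp: F_def)
  have diag: "diag_list (e # es) = four_block_mat A1 (0\<^sub>m 1 m) (0\<^sub>m m 1) (diag_list es)"
    using W4(3) by (intro eq_matI) (auto simp: A1_def nth_Cons')
  have De: "diag_list es \<in> carrier_mat m m" using W4(3) by auto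
  have FF: "mat_adjoint F * F = 1\<^sub>m n"
    unfolding Fadj unfolding F_def using W4 by (subst mult_block_diag) (auto simp: n_def)
  have AF: "A' * F = F * diag_list (e # es)"
    unfolding block F_def diag using W4(1,5) A1 A4 De by (simp add: mult_block_diag)
  have "similar_mat A A'"
    by (rule similar_matI[of _ _ W V n]) (use A A' V W VW WV AWV in auto)
  then have cp: "char_poly A = char_poly A'" by (rule char_poly_similar)
  have "char_poly A1 = [:- e, 1:]"
    by (simp add: char_poly_def char_poly_matrix_def A1_def det_single)
  then have cp': "char_poly A' = (\<Prod>e\<leftarrow>e # es. [:- e, 1:])"
    unfolding block using W4(4) by (subst char_poly_four_block_zeros_col[OF A1 _ A4]) auto
  have D: "diag_list (e # es) \<in> carrier_mat n n" using W4(3) diag_list_simps(3)[of "e # es"] by (simp add: n_def)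
  have "mat_adjoint (W * F) * (W * F) = mat_adjoint F * ((V * W) * F)"
    unfolding mat_adjoint_mult[OF W F] V_def[symmetric] using W F V
    by (simp add: assoc_mult_mat[of _ n n _ n _ n])
  also have "\<dots> = 1\<^sub>m n" using F FF by (simp add: VW left_mult_one_mat[of _ n n])
  finally have 1: "mat_adjoint (W * F) * (W * F) = 1\<^sub>m n" .
  have "A * (W * F) = (A * W) * F" using A W F by (intro assoc_mult_mat[symmetric])
  also have "\<dots> = W * (A' * F)" unfolding AW using W A' F by (intro assoc_mult_mat)
  also have "\<dots> = (W * F) * diag_list (e # es)"
    unfolding AF using W F D by (intro assoc_mult_mat[symmetric])
  finally have 2: "A * (W * F) = (W * F) * diag_list (e # es)" .
  have 3: "W * F \<in> carrier_mat n n" using W F by simp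
  show ?case
    unfolding n_def[symmetric]
    by (rule exI[of _ "W * F"], rule exI[of _ "e # es"])
      (use 1 2 3 W4(3) cp cp' in \<open>simp add: n_def\<close>)
qed

section \<open>Traces and singular values\<close>

lemma mtrace_mult:
  assumes A: "A \<in> carrier_mat n m" and B: "B \<in> carrier_mat m n"
  shows "mtrace (A * B) = (\<Sum>i<n. \<Sum>j<m. A $$ (i, j) * B $$ (j, i))"
proof -
  have "mtrace (A * B) = (\<Sum>i<n. (A * B) $$ (i, i))"
    using A by (simp add: mtrace_def del: index_mult_mat(1))
  also have "\<dots> = (\<Sum>i<n. \<Sum>j<m. A $$ (i, j) * B $$ (j, i))"
    by (rule sum.cong[OF refl]) (rule mult_mat_index[OF A B], simp_all)
  finally show ?thesis .
qed

lemma mtrace_mult_commute: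
  assumes "A \<in> carrier_mat n m" "B \<in> carrier_mat m n"
  shows "mtrace (A * B) = mtrace (B * A)"
  unfolding mtrace_mult[OF assms] mtrace_mult[OF assms(2,1)]
  by (subst sum.swap) (simp only: mult.commute)

text \<open>Turns the algebraic multiplicities in \<open>nuc_norm\<close> into repetitions in the
  list of eigenvalues, so that the sum over the spectrum becomes one over an eigenbasis.\<close>

lemma order_char_poly_count:
  "order x (\<Prod>e\<leftarrow>es. [:- e, 1:]) = count_list es (x :: complex)"
proof (induction es)
  case (Cons e es)
  have "(\<Prod>e\<leftarrow>es. [:- e, 1:]) \<noteq> 0" by (auto simp: prod_list_zero_iff)
  then have "[:- e, 1:] * (\<Prod>e\<leftarrow>es. [:- e, 1:]) \<noteq> 0" by (simp del: mult_pCons_left)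
  moreover have "order x [:- e, 1:] = (if x = e then 1 else 0)"
    by (auto simp: Order_Polynomial.order_linear order_0I)
  ultimately show ?case using Cons by (auto simp: order_mult simp del: mult_pCons_left)
qed simp

lemma sum_count_list:
  fixes f :: "'a \<Rightarrow> real"
  assumes "finite S" "set xs \<subseteq> S"
  shows "(\<Sum>x\<in>S. real (count_list xs x) * f x) = sum_list (map f xs)"
  using assms(2)
proof (induction xs)
  case (Cons a xs)
  have "(\<Sum>x\<in>S. real (count_list (a # xs) x) * f x)
      = (\<Sum>x\<in>S. real (count_list xs x) * f x + (if x = a then f x else 0))"
    by (intro sum.cong) (auto simp: algebra_simps)
  then show ?case using Cons assms(1) by (simp add: sum.distrib)
qed simp

text \<open>Evaluate the trace in an orthonormal eigenbasis of \<open>U\<^sup>* U\<close>.\<close>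

theorem trace_duality:
  assumes U: "U \<in> carrier_mat n n" and X: "X \<in> carrier_mat n n"
  shows "cmod (mtrace (U * X)) \<le> nuc_norm U * spec_norm X"
proof -
  define H where "H = mat_adjoint U * U"
  have H: "H \<in> carrier_mat n n" using U by (simp add: H_def)
  have "mat_adjoint H = H"
    unfolding H_def using U by (simp add: mat_adjoint_mult[of _ n n _ n] mat_adjoint_adjoint)
  then obtain W es where W: "W \<in> carrier_mat n n" "mat_adjoint W * W = 1\<^sub>m n" and es: "length es = n"
    and cp: "char_poly H = (\<Prod>e\<leftarrow>es. [:- e, 1:])" and HW: "H * W = W * diag_list es"
    using hermitian_diagonalization[OF H] by blast
  have WW: "W * mat_adjoint W = 1\<^sub>m n"
    by (rule mat_mult_left_right_inverse[OF mat_adjoint_carrier[OF W(1)] W])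
  have colW: "col W j \<in> carrier_vec n" if "j < n" for j using W that by auto
  have orth: "col W j \<bullet>c col W j = 1" if j: "j < n" for j
  proof -
    have "col W j \<bullet>c col W j = (\<Sum>i<n. mat_adjoint W $$ (j, i) * W $$ (i, j))"
      using W j by (subst cscalar_prod_sum[of _ n]) (auto simp: mult.commute)
    also have "\<dots> = (mat_adjoint W * W) $$ (j, j)"
      using W j by (intro mult_mat_index[symmetric, of _ n n _ n]) auto
    finally show ?thesis using W j by simp
  qed
  have nW: "vnorm (col W j) = 1" if j: "j < n" for j
  proof -
    have "(vnorm (col W j))\<^sup>2 = 1"
      using orth[OF j] unfolding cscalar_prod_self by (simp only: of_real_eq_1_iff)
    then show ?thesis using vnorm_nonneg[of "col W j"] by (simp add: power2_eq_1_iff)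
  qed
  have Hcol: "H *\<^sub>v col W j = es ! j \<cdot>\<^sub>v col W j" if j: "j < n" for j
  proof -
    have "H *\<^sub>v col W j = col (H * W) j" using H W j by (intro col_mult2[symmetric]) auto
    also have "\<dots> = es ! j \<cdot>\<^sub>v col W j"
      unfolding HW
    proof (rule eq_vecI)
      fix i assume "i < dim_vec (es ! j \<cdot>\<^sub>v col W j)"
      then have i: "i < n" using W by simp
      have "col (W * diag_list es) j $ i = (W * diag_list es) $$ (i, j)"
        using W es i j by simp
      also have "\<dots> = (\<Sum>a<n. W $$ (i, a) * diag_list es $$ (a, j))"
        using W es i j by (intro mult_mat_index[of _ n n _ n]) auto
      also have "\<dots> = (\<Sum>a<n. if a = j then W $$ (i, a) * es ! a else 0)"
        using es j by (intro sum.cong) auto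
      finally show "col (W * diag_list es) j $ i = (es ! j \<cdot>\<^sub>v col W j) $ i"
        using W i j by (simp add: mult.commute)
    qed (use W es in auto)
    finally show ?thesis .
  qed
  \<comment> \<open>The singular values are the lengths of U w for the eigenvectors w, because the
    squared length of U w is the form of \<open>mat_adjoint U * U\<close> at the unit vector
    w.\<close>
  have sing: "sqrt (Re (es ! j)) = vnorm (U *\<^sub>v col W j)" if j: "j < n" for j
  proof -
    have "complex_of_real ((vnorm (U *\<^sub>v col W j))\<^sup>2) = (U *\<^sub>v col W j) \<bullet>c (U *\<^sub>v col W j)"
      by (rule cscalar_prod_self[symmetric])
    also have "\<dots> = (mat_adjoint U *\<^sub>v (U *\<^sub>v col W j)) \<bullet>c col W j"
      using U colW[OF j] by (intro adjoint_form[symmetric, of _ n n]) auto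
    also have "mat_adjoint U *\<^sub>v (U *\<^sub>v col W j) = H *\<^sub>v col W j"
      unfolding H_def using U colW[OF j] by (intro assoc_mult_mat_vec[symmetric, of _ n n _ n]) auto
    also have "\<dots> \<bullet>c col W j = es ! j"
      using colW[OF j] by (simp add: Hcol[OF j] cscalar_distrib(3)[of _ n] orth[OF j])
    finally have "Re (es ! j) = (vnorm (U *\<^sub>v col W j))\<^sup>2" by (metis Re_complex_of_real)
    then show ?thesis by simp
  qed
  have "spectrum H = set es"
    using eigenvalue_root_char_poly[OF H] by (auto simp: spectrum_def cp poly_prod_list prod_list_zero_iff)
  then have "nuc_norm U = (\<Sum>x\<in>set es. real (count_list es x) * sqrt (Re x))"
    by (simp add: nuc_norm_def H_def[symmetric] cp order_char_poly_count)
  also have "\<dots> = sum_list (map (\<lambda>x. sqrt (Re x)) es)"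
    by (rule sum_count_list) auto
  also have "\<dots> = (\<Sum>j<n. sqrt (Re (es ! j)))"
    by (simp add: sum_list_sum_nth es atLeast0LessThan)
  finally have nuc: "nuc_norm U = (\<Sum>j<n. vnorm (U *\<^sub>v col W j))" using sing by simp
  have XU: "X * U \<in> carrier_mat n n" using X U by simp
  \<comment> \<open>Cyclicity brings X U between the unitary and its adjoint, so the trace becomes
    the sum of the forms of X at U w and w; each is at most the norm of X times one singular
    value.\<close>
  have "mtrace (U * X) = mtrace (X * U)" by (rule mtrace_mult_commute[OF U X])
  also have "X * U = ((X * U) * W) * mat_adjoint W"
  proof -
    have "((X * U) * W) * mat_adjoint W = (X * U) * (W * mat_adjoint W)"
      using XU W by (intro assoc_mult_mat) auto
    then show ?thesis using right_mult_one_mat[OF XU] by (simp only: WW)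
  qed
  also have "mtrace \<dots> = mtrace (mat_adjoint W * ((X * U) * W))"
    using XU W by (intro mtrace_mult_commute[of _ n n]) auto
  also have "\<dots> = (\<Sum>j<n. (X *\<^sub>v (U *\<^sub>v col W j)) \<bullet>c col W j)"
    unfolding mtrace_def
  proof (rule sum.cong)
    fix j assume "j \<in> {..<n}"
    then have j: "j < n" by simp
    have "(mat_adjoint W * (X * U * W)) $$ (j, j) = (\<Sum>i<n. mat_adjoint W $$ (j, i) * (X * U * W) $$ (i, j))"
      using XU W j by (intro mult_mat_index[of _ n n _ n]) auto
    also have "\<dots> = (\<Sum>i<n. col (X * U * W) j $ i * cnj (col W j $ i))"
      using XU W j carrier_matD[OF XU] by (intro sum.cong) auto
    also have "\<dots> = col (X * U * W) j \<bullet>c col W j"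
      using W by (intro cscalar_prod_sum[symmetric]) auto
    also have "col (X * U * W) j = X *\<^sub>v (U *\<^sub>v col W j)"
    proof -
      have "col (X * U * W) j = (X * U) *\<^sub>v col W j" by (rule col_mult2[OF XU W(1) j])
      also have "\<dots> = X *\<^sub>v (U *\<^sub>v col W j)" by (rule assoc_mult_mat_vec[OF X U colW[OF j]])
      finally show ?thesis .
    qed
    finally show "(mat_adjoint W * (X * U * W)) $$ (j, j) = (X *\<^sub>v (U *\<^sub>v col W j)) \<bullet>c col W j" .
  qed (use W in auto)
  finally have "cmod (mtrace (U * X)) \<le> (\<Sum>j<n. cmod ((X *\<^sub>v (U *\<^sub>v col W j)) \<bullet>c col W j))"
    by (metis norm_sum)
  also have "\<dots> \<le> (\<Sum>j<n. spec_norm X * vnorm (U *\<^sub>v col W j))"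
  proof (rule sum_mono)
    fix j assume "j \<in> {..<n}"
    then have j: "j < n" by simp
    show "cmod ((X *\<^sub>v (U *\<^sub>v col W j)) \<bullet>c col W j) \<le> spec_norm X * vnorm (U *\<^sub>v col W j)"
      using spec_form[OF X mult_vec_carrier_square[OF U colW[OF j]] colW[OF j]] nW[OF j] by simp
  qed
  finally show ?thesis by (simp add: nuc sum_distrib_left mult.commute)
qed

section \<open>A quantitative Earle--Hamilton theorem\<close>

text \<open>Analytic discs in D. They take the place of the invariant metric in the usual proof of
  Earle-Hamilton; holomorphy is entrywise, so that complex analysis of one variable
  suffices.\<close>

definition matrix_disc :: "nat \<Rightarrow> complex mat set \<Rightarrow> (complex \<Rightarrow> complex mat) \<Rightarrow> bool" where
  "matrix_disc l D \<phi> \<longleftrightarrow> (\<forall>\<zeta> \<in> ball 0 1. \<phi> \<zeta> \<in> carrier_mat l l \<and> \<phi> \<zeta> \<in> D) \<and>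
     (\<forall>i<l. \<forall>j<l. (\<lambda>\<zeta>. \<phi> \<zeta> $$ (i, j)) holomorphic_on ball 0 1)"

text \<open>Every form of the disc at vectors v and u is a scalar holomorphic function bounded by m
  |v| |u|. Around a point of modulus at most 1/4 a circle of radius 1/2 still lies inside the unit
  disc, so Cauchy's inequality bounds the derivative by 2 m |v| |u|. Working with forms keeps the
  constant independent of l.\<close>

lemma matrix_disc_lipschitz:
  assumes disc: "matrix_disc l D \<phi>" and bound: "\<And>W. W \<in> D \<Longrightarrow> spec_norm W \<le> m"
    and ab: "a \<in> cball 0 (1/4)" "b \<in> cball 0 (1/4)"
  shows "spec_norm (\<phi> a - \<phi> b) \<le> 2 * m * cmod (a - b)"
proof -
  have carr: "\<phi> \<zeta> \<in> carrier_mat l l" "spec_norm (\<phi> \<zeta>) \<le> m" if "cmod \<zeta> < 1" for \<zeta>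
    using disc bound that by (auto simp: matrix_disc_def)
  have m: "0 \<le> m" using order_trans[OF spec_norm_nonneg carr(2)[of 0]] by simp
  have a: "cmod a < 1" and b: "cmod b < 1" using ab by (auto simp: dist_norm)
  show ?thesis
  proof (rule spec_norm_le_form)
    fix u v :: "complex Matrix.vec" assume u: "u \<in> carrier_vec l" and v: "v \<in> carrier_vec l"
    define f where "f \<zeta> = (\<phi> \<zeta> *\<^sub>v v) \<bullet>c u" for \<zeta>
    have f_sum: "f \<zeta> = (\<Sum>i<l. \<Sum>j<l. \<phi> \<zeta> $$ (i, j) * v $ j * cnj (u $ i))" if "\<zeta> \<in> ball 0 1" for \<zeta>
      unfolding f_def using carr[of \<zeta>] that u v by (intro cscalar_mat_sum) auto
    have hol: "f holomorphic_on ball 0 1"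
    proof (rule holomorphic_transform)
      show "(\<lambda>\<zeta>. \<Sum>i<l. \<Sum>j<l. \<phi> \<zeta> $$ (i, j) * v $ j * cnj (u $ i)) holomorphic_on ball 0 1"
        using disc by (intro holomorphic_intros) (auto simp: matrix_disc_def)
    qed (rule f_sum[symmetric])
    let ?B = "m * vnorm v * vnorm u"
    have fB: "cmod (f \<zeta>) \<le> ?B" if "cmod \<zeta> < 1" for \<zeta>
    proof -
      have "cmod (f \<zeta>) \<le> spec_norm (\<phi> \<zeta>) * vnorm v * vnorm u"
        unfolding f_def using carr[OF that] u v by (intro spec_form) auto
      also have "\<dots> \<le> ?B" using carr[OF that] by (intro mult_right_mono) auto
      finally show ?thesis .
    qed
    have deriv: "cmod (deriv f \<zeta>) \<le> 2 * ?B" if \<zeta>: "\<zeta> \<in> cball 0 (1/4)" for \<zeta>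
    proof -
      have sub: "cball \<zeta> (1/2) \<subseteq> ball 0 1"
      proof
        fix x assume "x \<in> cball \<zeta> (1/2)"
        then have "cmod (\<zeta> - x) \<le> 1/2" "cmod \<zeta> \<le> 1/4" using \<zeta> by (auto simp: dist_norm)
        then have "cmod x < 1" using norm_triangle_ineq2[of x \<zeta>] by (simp add: norm_minus_commute)
        then show "x \<in> ball 0 1" by simp
      qed
      then have "cmod ((deriv ^^ 1) f \<zeta>) \<le> fact 1 * ?B / (1/2) ^ 1"
      proof (intro Cauchy_inequality)
        show "f holomorphic_on ball \<zeta> (1/2)"
          using sub ball_subset_cball by (blast intro: holomorphic_on_subset[OF hol])
        show "continuous_on (cball \<zeta> (1/2)) f"
          using sub by (blast intro: holomorphic_on_imp_continuous_on holomorphic_on_subset[OF hol])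
        fix x assume "cmod (\<zeta> - x) = 1/2"
        then have "x \<in> cball \<zeta> (1/2)" by (simp add: dist_norm)
        then show "cmod (f x) \<le> ?B" using sub by (intro fB) auto
      qed simp
      then show ?thesis by simp
    qed
    have "cmod (f a - f b) \<le> 2 * ?B * cmod (a - b)"
    proof (rule field_differentiable_bound)
      fix \<zeta> :: complex assume \<zeta>: "\<zeta> \<in> cball 0 (1/4)"
      then have "\<zeta> \<in> ball 0 1" by auto
      then show "(f has_field_derivative deriv f \<zeta>) (at \<zeta> within cball 0 (1/4))"
        using hol holomorphic_derivI[OF hol] by blast
    qed (use ab deriv in auto)
    moreover have "((\<phi> a - \<phi> b) *\<^sub>v v) \<bullet>c u = f a - f b"
      unfolding f_def using carr(1)[OF a] carr(1)[OF b] u v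
      by (simp add: minus_mult_distrib_mat_vec[of _ l l] cscalar_distrib(2)[of "\<phi> a *\<^sub>v v" l "\<phi> b *\<^sub>v v"])
    ultimately have "cmod (((\<phi> a - \<phi> b) *\<^sub>v v) \<bullet>c u) \<le> 2 * ?B * cmod (a - b)" by (simp only:)
    also have "\<dots> = 2 * m * cmod (a - b) * vnorm v * vnorm u" by (simp only: mult_ac)
    finally show "cmod (((\<phi> a - \<phi> b) *\<^sub>v v) \<bullet>c u) \<le> 2 * m * cmod (a - b) * vnorm v * vnorm u" .
  qed (use m carr(1)[OF a] carr(1)[OF b] in auto)
qed

lemma partial_geometric_le:
  fixes q :: real
  assumes "0 \<le> q" "q < 1"
  shows "(\<Sum>i<k. q ^ i) \<le> 1 / (1 - q)"
proof -
  have "(\<Sum>i<k. q ^ i) \<le> (\<Sum>i. q ^ i)"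
    using assms by (intro sum_le_suminf summable_geometric) auto
  also have "\<dots> = 1 / (1 - q)" using assms by (intro suminf_geometric) auto
  finally show ?thesis .
qed

text \<open>D acts as a bounded convex domain and h as a map into its
  \<open>\<epsilon>\<close>-interior; \<open>h_strict\<close> with V = 0 places h W itself in D.
  Holomorphy of h is required along discs only, which avoids calculus in the space of
  matrices.\<close>

locale strict_self_map =
  fixes l :: nat and D :: "complex mat set" and h :: "complex mat \<Rightarrow> complex mat" and m \<epsilon> :: real
  assumes D_carrier: "W \<in> D \<Longrightarrow> W \<in> carrier_mat l l"
    and D_bound: "W \<in> D \<Longrightarrow> spec_norm W \<le> m"
    and D_convex: "V \<in> D \<Longrightarrow> W \<in> D \<Longrightarrow> 0 \<le> s \<Longrightarrow> s \<le> 1 \<Longrightarrow>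
      complex_of_real (1 - s) \<cdot>\<^sub>m V + complex_of_real s \<cdot>\<^sub>m W \<in> D"
    and h_carrier: "W \<in> D \<Longrightarrow> h W \<in> carrier_mat l l"
    and h_holomorphic: "matrix_disc l D \<phi> \<Longrightarrow> i < l \<Longrightarrow> j < l \<Longrightarrow>
      (\<lambda>\<zeta>. h (\<phi> \<zeta>) $$ (i, j)) holomorphic_on ball 0 1"
    and h_strict: "W \<in> D \<Longrightarrow> V \<in> carrier_mat l l \<Longrightarrow> spec_norm V \<le> \<epsilon> \<Longrightarrow> h W + V \<in> D"
    and m_pos: "0 < m" and eps_pos: "0 < \<epsilon>"
begin

text \<open>Chosen so that moving the parameter from b to (1 + t) b costs exactly
  \<open>\<epsilon> * b\<close>: discs are Lipschitz with constant 2 m on the quarter disc, and 2 m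
  t b = \<open>\<epsilon> * b\<close>.\<close>

definition t :: real where "t = \<epsilon> / (2 * m)"

lemma t_pos: "0 < t"
  using m_pos eps_pos by (simp add: t_def)

lemma h_in: "W \<in> D \<Longrightarrow> h W \<in> D"
  using h_strict[of W "0\<^sub>m l l"] h_carrier[of W] eps_pos by simp

lemma funpow_in: "W \<in> D \<Longrightarrow> (h ^^ k) W \<in> D"
  by (induction k) (auto simp: h_in)

text \<open>The gain \<open>\<epsilon>\<close> of the map \<open>h\<close> is spent on bending \<open>h \<circ> \<phi>\<close> so that it reaches \<open>h (\<phi> a)\<close> at an
  earlier parameter.\<close>

lemma disc_step:
  assumes disc: "matrix_disc l D \<phi>" and a: "0 < a" "a \<le> 1/4"
  shows "\<exists>\<psi>. matrix_disc l D \<psi> \<and> \<psi> 0 = h (\<phi> 0) \<and>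
    \<psi> (complex_of_real (a / (1 + t))) = h (\<phi> (complex_of_real a))"
proof -
  define b where "b = a / (1 + t)"
  have b: "0 < b" "b \<le> a" "a - b = t * b"
    using a t_pos by (auto simp: b_def field_simps)
  have in_D: "\<phi> \<zeta> \<in> D" if "cmod \<zeta> < 1" for \<zeta> using disc that by (auto simp: matrix_disc_def)
  have disc_h: "matrix_disc l D (h \<circ> \<phi>)"
    unfolding matrix_disc_def using in_D h_in h_carrier h_holomorphic[OF disc] by auto
  define E where "E = h (\<phi> (complex_of_real a)) - h (\<phi> (complex_of_real b))"
  have ab: "cmod (complex_of_real a) < 1" "cmod (complex_of_real b) < 1" using a b by auto
  have ha: "h (\<phi> (complex_of_real a)) \<in> carrier_mat l l" and hb: "h (\<phi> (complex_of_real b)) \<in> carrier_mat l l"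
    using h_carrier in_D ab by auto
  have E: "E \<in> carrier_mat l l" using hb by (simp add: E_def)
  have "spec_norm E \<le> 2 * m * cmod (complex_of_real a - complex_of_real b)"
    unfolding E_def using matrix_disc_lipschitz[OF disc_h D_bound, of "complex_of_real a" "complex_of_real b"] a b
    by (auto simp: dist_norm)
  also have "cmod (complex_of_real a - complex_of_real b) = t * b"
    using b t_pos by (metis abs_of_nonneg less_imp_le mult_nonneg_nonneg norm_of_real of_real_diff)
  finally have Eb: "spec_norm E \<le> \<epsilon> * b" using m_pos by (simp add: t_def field_simps)
  \<comment> \<open>A linear correction: nothing at 0, the whole difference E at b. Within the unit
    disc its norm stays below that of E divided by b, hence below \<open>\<epsilon>\<close>, which
    \<open>h_strict\<close> absorbs.\<close>
  define \<psi> where "\<psi> \<zeta> = h (\<phi> \<zeta>) + (\<zeta> / complex_of_real b) \<cdot>\<^sub>m E" for \<zeta>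
  have "matrix_disc l D \<psi>"
    unfolding matrix_disc_def
  proof (intro conjI ballI allI impI)
    fix \<zeta> :: complex assume "\<zeta> \<in> ball 0 1"
    then have \<zeta>: "cmod \<zeta> < 1" by simp
    have "spec_norm ((\<zeta> / complex_of_real b) \<cdot>\<^sub>m E) \<le> cmod (\<zeta> / complex_of_real b) * spec_norm E"
      by (rule spec_norm_smult_le[OF E])
    also have "\<dots> \<le> cmod (\<zeta> / complex_of_real b) * (\<epsilon> * b)"
      using Eb by (intro mult_left_mono) auto
    also have "\<dots> \<le> \<epsilon>" using \<zeta> b eps_pos by (simp add: norm_divide)
    finally show "\<psi> \<zeta> \<in> D" unfolding \<psi>_def using E by (intro h_strict in_D \<zeta>) auto
    then show "\<psi> \<zeta> \<in> carrier_mat l l" by (rule D_carrier)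
  next
    fix i j assume ij: "i < l" "j < l"
    have eq: "\<psi> \<zeta> $$ (i, j) = h (\<phi> \<zeta>) $$ (i, j) + \<zeta> / complex_of_real b * E $$ (i, j)" for \<zeta>
      unfolding \<psi>_def using E ij by simp
    show "(\<lambda>\<zeta>. \<psi> \<zeta> $$ (i, j)) holomorphic_on ball 0 1"
      unfolding eq using b by (intro holomorphic_intros h_holomorphic[OF disc] ij) auto
  qed
  moreover have "\<psi> 0 = h (\<phi> 0)"
    using E h_carrier[OF in_D[of 0]] by (auto simp: \<psi>_def intro!: eq_matI)
  moreover have "\<psi> (complex_of_real b) = h (\<phi> (complex_of_real a))"
    using ha hb b by (auto simp: \<psi>_def E_def intro!: eq_matI)
  ultimately show ?thesis by (auto simp: b_def)
qed

text \<open>Points lying r deep in D. A straight disc of radius r around such a point stays in D,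
  which provides the discs that start the iteration.\<close>

definition inner_part :: "real \<Rightarrow> complex mat set" where
  "inner_part r = {W \<in> carrier_mat l l. \<forall>V \<in> carrier_mat l l. spec_norm V \<le> r \<longrightarrow> W + V \<in> D}"

lemma inner_subset: "0 \<le> r \<Longrightarrow> W \<in> inner_part r \<Longrightarrow> W \<in> D"
proof -
  assume *: "0 \<le> r" "W \<in> inner_part r"
  then have "\<forall>V \<in> carrier_mat l l. spec_norm V \<le> r \<longrightarrow> W + V \<in> D" by (simp add: inner_part_def)
  from bspec[OF this, of "0\<^sub>m l l"] have "W + 0\<^sub>m l l \<in> D" using * by simp
  moreover have "W \<in> carrier_mat l l" using * by (simp add: inner_part_def)
  ultimately show "W \<in> D" by simp
qed

lemma h_inner: "W \<in> D \<Longrightarrow> h W \<in> inner_part \<epsilon>"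
  by (auto simp: inner_part_def h_carrier h_strict)

lemma inner_convex:
  assumes "V \<in> inner_part r" "W \<in> inner_part r" "0 \<le> s" "s \<le> 1"
  shows "complex_of_real (1 - s) \<cdot>\<^sub>m V + complex_of_real s \<cdot>\<^sub>m W \<in> inner_part r"
proof -
  have "(complex_of_real (1 - s) \<cdot>\<^sub>m V + complex_of_real s \<cdot>\<^sub>m W) + X \<in> D"
    if X: "X \<in> carrier_mat l l" "spec_norm X \<le> r" for X
  proof -
    have "(complex_of_real (1 - s) \<cdot>\<^sub>m V + complex_of_real s \<cdot>\<^sub>m W) + X
      = complex_of_real (1 - s) \<cdot>\<^sub>m (V + X) + complex_of_real s \<cdot>\<^sub>m (W + X)"
      using assms X by (intro eq_matI) (auto simp: inner_part_def algebra_simps)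
    also have "\<dots> \<in> D" using assms X by (intro D_convex) (auto simp: inner_part_def)
    finally show ?thesis .
  qed
  moreover have "complex_of_real (1 - s) \<cdot>\<^sub>m V + complex_of_real s \<cdot>\<^sub>m W \<in> carrier_mat l l"
    using assms(2) by (simp add: inner_part_def)
  ultimately show ?thesis unfolding inner_part_def by blast
qed

text \<open>One disc joins the two k-th iterates, the one of x at the centre and the one of y at a
  parameter that shrinks by the factor 1 + t with each step. The position of this parameter plays
  the role of the distance in the Earle-Hamilton metric.\<close>

lemma disc_iterate:
  assumes x: "x \<in> inner_part r" and r: "0 < r" and y: "y \<in> carrier_mat l l"
    and a: "0 < a" "a \<le> 1/4" and xy: "spec_norm (y - x) \<le> a * r"
  shows "\<exists>\<phi>. matrix_disc l D \<phi> \<and> \<phi> 0 = (h ^^ k) x \<and> \<phi> (complex_of_real (a / (1 + t) ^ k)) = (h ^^ k) y"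
proof (induction k)
  case 0
  have xc: "x \<in> carrier_mat l l" using x by (simp add: inner_part_def)
  define \<phi> where "\<phi> \<zeta> = x + (\<zeta> / complex_of_real a) \<cdot>\<^sub>m (y - x)" for \<zeta>
  have "matrix_disc l D \<phi>"
    unfolding matrix_disc_def
  proof (intro conjI ballI allI impI)
    fix \<zeta> :: complex assume "\<zeta> \<in> ball 0 1"
    then have \<zeta>: "cmod \<zeta> < 1" by simp
    have "spec_norm ((\<zeta> / complex_of_real a) \<cdot>\<^sub>m (y - x)) \<le> cmod (\<zeta> / complex_of_real a) * spec_norm (y - x)"
      using xc by (intro spec_norm_smult_le) auto
    also have "\<dots> \<le> cmod (\<zeta> / complex_of_real a) * (a * r)"
      using xy by (intro mult_left_mono) auto
    also have "\<dots> \<le> r" using \<zeta> a r by (simp add: norm_divide)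
    finally show "\<phi> \<zeta> \<in> D" unfolding \<phi>_def using x xc by (auto simp: inner_part_def)
    then show "\<phi> \<zeta> \<in> carrier_mat l l" by (rule D_carrier)
  next
    fix i j assume ij: "i < l" "j < l"
    have eq: "\<phi> \<zeta> $$ (i, j) = x $$ (i, j) + \<zeta> / complex_of_real a * (y - x) $$ (i, j)" for \<zeta>
      unfolding \<phi>_def using xc y ij by simp
    show "(\<lambda>\<zeta>. \<phi> \<zeta> $$ (i, j)) holomorphic_on ball 0 1"
      unfolding eq using a by (intro holomorphic_intros) auto
  qed
  moreover have "\<phi> 0 = x" "\<phi> (complex_of_real a) = y"
    using xc y a by (auto simp: \<phi>_def intro!: eq_matI)
  ultimately show ?case by auto
next
  case (Suc k)
  then obtain \<phi> where \<phi>: "matrix_disc l D \<phi>" "\<phi> 0 = (h ^^ k) x" "\<phi> (complex_of_real (a / (1 + t) ^ k)) = (h ^^ k) y"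
    by auto
  have "1 \<le> (1 + t) ^ k" using t_pos by (intro one_le_power) auto
  then have "0 < a / (1 + t) ^ k" "a / (1 + t) ^ k \<le> 1/4"
    using a by (auto simp: divide_le_eq intro: order_trans)
  from disc_step[OF \<phi>(1) this, unfolded \<phi>(2,3)] show ?case
    by (simp only: funpow.simps o_apply power_Suc divide_divide_eq_left mult.commute[of "1 + t"])
qed

text \<open>Converts the shrinking parameter of the disc into a norm estimate, through the Lipschitz
  bound on the quarter disc.\<close>

lemma funpow_contract:
  assumes x: "x \<in> inner_part r" and r: "0 < r" and y: "y \<in> carrier_mat l l"
    and a: "0 < a" "a \<le> 1/4" and xy: "spec_norm (y - x) \<le> a * r"
  shows "spec_norm ((h ^^ k) y - (h ^^ k) x) \<le> 2 * m * a * (1 / (1 + t)) ^ k"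
proof -
  obtain \<phi> where \<phi>: "matrix_disc l D \<phi>" "\<phi> 0 = (h ^^ k) x" "\<phi> (complex_of_real (a / (1 + t) ^ k)) = (h ^^ k) y"
    using disc_iterate[OF assms] by blast
  have "1 \<le> (1 + t) ^ k" using t_pos by (intro one_le_power) auto
  then have "0 < a / (1 + t) ^ k" "a / (1 + t) ^ k \<le> 1/4"
    using a by (auto simp: divide_le_eq intro: order_trans)
  then have "complex_of_real (a / (1 + t) ^ k) \<in> cball 0 (1/4)"
    by (simp only: mem_cball dist_0_norm norm_of_real)
  from matrix_disc_lipschitz[OF \<phi>(1) D_bound this, of 0]
  have "spec_norm ((h ^^ k) y - (h ^^ k) x) \<le> 2 * m * cmod (complex_of_real (a / (1 + t) ^ k))"
    by (simp only: \<phi>(2,3)) simp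
  moreover have "cmod (complex_of_real (a / (1 + t) ^ k)) = a / (1 + t) ^ k"
    using \<open>0 < a / (1 + t) ^ k\<close> by (simp only: norm_of_real abs_of_pos)
  ultimately have "spec_norm ((h ^^ k) y - (h ^^ k) x) \<le> 2 * m * (a / (1 + t) ^ k)" by (simp only:)
  then show ?thesis by (simp add: power_divide)
qed

lemma q_less_1: "1 / (1 + t) < 1" "0 \<le> 1 / (1 + t)"
  using t_pos by auto

text \<open>The contraction estimate is local, so x and the fixed point are joined by a segment in
  \<open>inner_part r\<close> cut into short pieces, each of which contracts. The number of pieces
  affects the speed of convergence, but only the limit is used.\<close>

lemma funpow_fixed_point:
  assumes x: "x \<in> inner_part r" and y: "y \<in> inner_part r" and r: "0 < r" and fix_y: "h y = y"
  shows "(\<lambda>k. spec_norm ((h ^^ k) x - y)) \<longlonglongrightarrow> 0"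
proof -
  have xc: "x \<in> carrier_mat l l" and yc: "y \<in> carrier_mat l l" using x y by (auto simp: inner_part_def)
  \<comment> \<open>Enough pieces for neighbours to lie within r / 4 of each other, the range of
    \<open>funpow_contract\<close> with a = 1/4.\<close>
  obtain p :: nat where p: "real p > 4 * spec_norm (y - x) / r" using reals_Archimedean2 by blast
  have p0: "p > 0" using p r
    by (metis divide_nonneg_pos gr0I less_le_not_le mult_nonneg_nonneg of_nat_0 spec_norm_nonneg zero_le_numeral)
  define w where "w i = complex_of_real (1 - real i / real p) \<cdot>\<^sub>m x + complex_of_real (real i / real p) \<cdot>\<^sub>m y" for i
  have w: "w i \<in> inner_part r" if "i \<le> p" for i
    unfolding w_def using that p0 by (intro inner_convex x y) auto
  have step: "spec_norm (w (Suc i) - w i) \<le> 1/4 * r" for i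
  proof -
    have "w (Suc i) - w i = complex_of_real (1 / real p) \<cdot>\<^sub>m (y - x)"
      using xc yc p0 by (intro eq_matI) (auto simp: w_def field_simps)
    then have "spec_norm (w (Suc i) - w i) \<le> (1 / real p) * spec_norm (y - x)"
      using spec_norm_smult_le[of "y - x" l l "complex_of_real (1 / real p)"] xc by (simp add: norm_divide)
    also have "\<dots> \<le> 1/4 * r" using p p0 r by (simp add: field_simps)
    finally show ?thesis .
  qed
  have wD: "w i \<in> D" if "i \<le> p" for i using inner_subset[OF _ w[OF that]] r by simp
  have cc: "(h ^^ k) (w i) \<in> carrier_mat l l" if "i \<le> p" for i k
    by (rule D_carrier[OF funpow_in[OF wD[OF that]]])
  have bound: "spec_norm ((h ^^ k) (w i) - (h ^^ k) (w 0)) \<le> real i * (2 * m * (1/4) * (1 / (1 + t)) ^ k)"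
    if "i \<le> p" for i k
    using that
  proof (induction i)
    case 0
    have "(h ^^ k) (w 0) - (h ^^ k) (w 0) = 0\<^sub>m l l" using cc[of 0 k] by auto
    then show ?case by simp
  next
    case (Suc i)
    have "spec_norm ((h ^^ k) (w (Suc i)) - (h ^^ k) (w 0))
        \<le> spec_norm ((h ^^ k) (w (Suc i)) - (h ^^ k) (w i)) + spec_norm ((h ^^ k) (w i) - (h ^^ k) (w 0))"
      using Suc cc by (intro spec_norm_triangle_diff[of _ l l]) auto
    also have "spec_norm ((h ^^ k) (w (Suc i)) - (h ^^ k) (w i)) \<le> 2 * m * (1/4) * (1 / (1 + t)) ^ k"
      using Suc.prems w[of i] cc[of "Suc i" 0] step[of i] by (intro funpow_contract[OF _ r]) auto
    finally show ?case using Suc by (simp add: algebra_simps)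
  qed
  have w0: "w 0 = x" and wp: "w p = y" using xc yc p0 by (auto simp: w_def intro!: eq_matI)
  have hy: "(h ^^ k) y = y" for k by (induction k) (auto simp: fix_y)
  have le: "spec_norm ((h ^^ k) x - y) \<le> real p * (2 * m * (1/4)) * (1 / (1 + t)) ^ k" for k
    using bound[of p k] spec_norm_minus_commute[OF cc[of 0 k] yc]
    by (simp add: w0 wp hy algebra_simps)
  have "(\<lambda>k. real p * (2 * m * (1/4)) * (1 / (1 + t)) ^ k) \<longlonglongrightarrow> real p * (2 * m * (1/4)) * 0"
    using q_less_1 by (intro tendsto_intros LIMSEQ_power_zero) auto
  then have "(\<lambda>k. real p * (2 * m * (1/4)) * (1 / (1 + t)) ^ k) \<longlonglongrightarrow> 0" by (simp only: mult_zero_right)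
  then show ?thesis
    by (rule Lim_null_comparison[rotated]) (intro always_eventually allI, simp only: real_norm_def abs_of_nonneg spec_norm_nonneg le)
qed

text \<open>Telescope along the orbit of x. The steps decay like powers of 1 / (1 + t), whose
  geometric series sums to (1 + t) / t, and the orbit ends at y. The distance of x to y thus enters
  only qualitatively, and the bound is linear in a.\<close>

theorem approximate_fixed_point:
  assumes x: "x \<in> inner_part r" and y: "y \<in> inner_part r" and r: "0 < r" and fix_y: "h y = y"
    and a: "0 < a" "a \<le> 1/4" and near: "spec_norm (h x - x) \<le> a * r"
  shows "spec_norm (x - y) \<le> 2 * m * a * ((1 + t) / t)"
proof -
  let ?q = "1 / (1 + t)"
  have xD: "x \<in> D" by (rule inner_subset[OF _ x]) (use r in simp)
  have yc: "y \<in> carrier_mat l l" and xc: "x \<in> carrier_mat l l" using x y by (auto simp: inner_part_def)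
  have cc: "(h ^^ k) x \<in> carrier_mat l l" for k by (rule D_carrier[OF funpow_in[OF xD]])
  have step: "spec_norm ((h ^^ k) x - (h ^^ Suc k) x) \<le> 2 * m * a * ?q ^ k" for k
    using funpow_contract[OF x r h_carrier[OF xD] a near, of k]
    unfolding spec_norm_minus_commute[OF cc[of k] cc[of "Suc k"]] by (simp only: funpow_Suc_right o_apply)
  have partial: "spec_norm (x - (h ^^ k) x) \<le> 2 * m * a * (\<Sum>i<k. ?q ^ i)" for k
  proof (induction k)
    case 0
    have "x - x = 0\<^sub>m l l" using xc by auto
    then show ?case by simp
  next
    case (Suc k)
    have "spec_norm (x - (h ^^ Suc k) x) \<le> spec_norm (x - (h ^^ k) x) + spec_norm ((h ^^ k) x - (h ^^ Suc k) x)"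
      using xc cc by (intro spec_norm_triangle_diff)
    then show ?case using Suc step[of k] by (simp add: algebra_simps)
  qed
  have geom: "(\<Sum>i<k. ?q ^ i) \<le> (1 + t) / t" for k
  proof -
    have "1 / (1 - ?q) = (1 + t) / t" using t_pos by (simp add: field_simps)
    then show ?thesis using partial_geometric_le[OF q_less_1(2,1), of k] by (simp only:)
  qed
  have "spec_norm (x - y) \<le> 2 * m * a * ((1 + t) / t) + spec_norm ((h ^^ k) x - y)" for k
  proof -
    have "spec_norm (x - y) \<le> spec_norm (x - (h ^^ k) x) + spec_norm ((h ^^ k) x - y)"
      using xc yc cc by (intro spec_norm_triangle_diff)
    moreover have "2 * m * a * (\<Sum>i<k. ?q ^ i) \<le> 2 * m * a * ((1 + t) / t)"
      using geom m_pos a by (intro mult_left_mono) auto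
    ultimately show ?thesis using partial[of k] by linarith
  qed
  then have bound: "\<exists>N. \<forall>k\<ge>N. spec_norm (x - y) \<le> 2 * m * a * ((1 + t) / t) + spec_norm ((h ^^ k) x - y)"
    by blast
  have "(\<lambda>k. 2 * m * a * ((1 + t) / t) + spec_norm ((h ^^ k) x - y)) \<longlonglongrightarrow> 2 * m * a * ((1 + t) / t) + 0"
    by (rule tendsto_add[OF tendsto_const funpow_fixed_point[OF x y r fix_y]])
  from LIMSEQ_le_const[OF this bound] show ?thesis by (simp only: add_0_right)
qed

end

section \<open>Gaussian concentration\<close>

text \<open>The midpoint set contains two half-size copies that hardly meet: (K + min H) / 2 lies to
  the left of (max K + H) / 2, with at most the point (min H + max K) / 2 in common. These are
  \<open>T1\<close> and \<open>T2\<close>; removing one point costs no measure.\<close>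

lemma brunn_minkowski_midpoint_compact:
  fixes K H :: "real set"
  assumes K: "compact K" "K \<noteq> {}" and H: "compact H" "H \<noteq> {}" and C: "C \<in> sets borel"
    and mid: "\<And>a b. a \<in> K \<Longrightarrow> b \<in> H \<Longrightarrow> (a + b) / 2 \<in> C"
  shows "emeasure lborel K + emeasure lborel H \<le> 2 * emeasure lborel C"
proof -
  have [measurable]: "K \<in> sets borel" "H \<in> sets borel" "C \<in> sets borel"
    using K H C by (auto intro: borel_compact)
  obtain k where k: "k \<in> K" "\<And>x. x \<in> K \<Longrightarrow> x \<le> k" using compact_attains_sup[OF K] by auto
  obtain h where h: "h \<in> H" "\<And>x. x \<in> H \<Longrightarrow> h \<le> x" using compact_attains_inf[OF H] by auto
  define T1 where "T1 = {x. - h + 2 * x \<in> K}"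
  define T2 where "T2 = {x. - k + 2 * x \<in> H}"
  have [measurable]: "T1 \<in> sets borel" "T2 \<in> sets borel"
    unfolding T1_def T2_def by measurable
  have half: "emeasure lborel S = 2 * emeasure lborel {x. - c + 2 * x \<in> S}" if [measurable]: "S \<in> sets borel" for S and c :: real
  proof -
    have "emeasure lborel S = (\<integral>\<^sup>+x. indicator S x \<partial>lborel)" by simp
    also have "\<dots> = 2 * (\<integral>\<^sup>+x. indicator S (- c + 2 * x) \<partial>lborel)"
      by (subst nn_integral_real_affine[where t = "- c" and c = 2]) auto
    also have "(\<integral>\<^sup>+x. indicator S (- c + 2 * x) \<partial>lborel) = (\<integral>\<^sup>+x. indicator {x. - c + 2 * x \<in> S} x \<partial>lborel)"
      by (intro nn_integral_cong) (simp add: indicator_def)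
    also have "\<dots> = emeasure lborel {x. - c + 2 * x \<in> S}" by (intro nn_integral_indicator) simp
    finally show ?thesis .
  qed
  have "T1 \<inter> T2 \<subseteq> {(h + k) / 2}"
    using k(2) h(2) by (force simp: T1_def T2_def)
  then have disj: "T1 \<inter> (T2 - {(h + k) / 2}) = {}" by auto
  have sub: "T1 \<union> (T2 - {(h + k) / 2}) \<subseteq> C"
  proof
    fix x assume "x \<in> T1 \<union> (T2 - {(h + k) / 2})"
    then have "- h + 2 * x \<in> K \<or> - k + 2 * x \<in> H" by (auto simp: T1_def T2_def)
    then show "x \<in> C" using mid[of "- h + 2 * x" h] mid[of k "- k + 2 * x"] k(1) h(1) by auto
  qed
  have "emeasure lborel T1 + emeasure lborel T2 = emeasure lborel T1 + emeasure lborel (T2 - {(h + k) / 2})"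
    by (subst emeasure_Diff_null_set) auto
  also have "\<dots> = emeasure lborel (T1 \<union> (T2 - {(h + k) / 2}))"
    by (intro plus_emeasure disj) auto
  also have "\<dots> \<le> emeasure lborel C"
    by (intro emeasure_mono sub) auto
  finally have "2 * (emeasure lborel T1 + emeasure lborel T2) \<le> 2 * emeasure lborel C"
    by (intro mult_left_mono) auto
  then show ?thesis using half[of K h] half[of H k] by (simp add: T1_def T2_def distrib_left)
qed

lemma bounded_borel_inner_compact:
  fixes A :: "real set"
  assumes A: "A \<in> sets borel" "bounded A" "A \<noteq> {}" and e: "0 < (e::real)"
  obtains K where "compact K" "K \<noteq> {}" "K \<subseteq> A" "emeasure lborel A \<le> emeasure lborel K + ennreal e"
proof -
  have "A \<in> sets lebesgue" using A by (simp add: sets_completionI_sets)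
  from sets_lebesgue_inner_closed[OF this e] obtain T where
    T: "closed T" "T \<subseteq> A" "A - T \<in> lmeasurable" "emeasure lebesgue (A - T) < ennreal e" .
  obtain a where a: "a \<in> A" using A by auto
  \<comment> \<open>The closed set T may be empty; one extra point of A keeps the set compact and
    makes it nonempty.\<close>
  define K where "K = insert a T"
  have "compact K" unfolding K_def compact_eq_bounded_closed
    using T A bounded_subset[OF A(2) T(2)] by (auto intro: closed_insert)
  then have Kb: "K \<in> sets borel" by (rule borel_compact)
  have "emeasure lborel A \<le> emeasure lborel K + emeasure lborel (A - K)"
    using A Kb by (intro order_trans[OF emeasure_mono emeasure_subadditive]) auto
  also have "emeasure lborel (A - K) = emeasure lebesgue (A - K)"
    using A Kb by (simp add: emeasure_completion)
  also have "\<dots> \<le> emeasure lebesgue (A - T)"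
    using T by (intro emeasure_mono) (auto simp: K_def)
  also have "\<dots> \<le> ennreal e" using T by simp
  finally have "emeasure lborel A \<le> emeasure lborel K + ennreal e" by (simp add: add_left_mono)
  then show thesis using that[of K] \<open>compact K\<close> T a by (auto simp: K_def)
qed

lemma brunn_minkowski_midpoint:
  fixes A B C :: "real set"
  assumes A: "A \<in> sets borel" "A \<noteq> {}" and B: "B \<in> sets borel" "B \<noteq> {}" and C: "C \<in> sets borel"
    and mid: "\<And>a b. a \<in> A \<Longrightarrow> b \<in> B \<Longrightarrow> (a + b) / 2 \<in> C"
  shows "emeasure lborel A + emeasure lborel B \<le> 2 * emeasure lborel C"
proof -
  have bdd: "emeasure lborel A' + emeasure lborel B' \<le> 2 * emeasure lborel C"
    if AB: "A' \<in> sets borel" "A' \<noteq> {}" "bounded A'" "A' \<subseteq> A" "B' \<in> sets borel" "B' \<noteq> {}" "bounded B'" "B' \<subseteq> B"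
    for A' B' :: "real set"
  proof (rule ennreal_le_epsilon)
    fix e :: real assume "0 < e"
    then have e: "0 < e / 2" by simp
    obtain K where K: "compact K" "K \<noteq> {}" "K \<subseteq> A'" "emeasure lborel A' \<le> emeasure lborel K + ennreal (e / 2)"
      using bounded_borel_inner_compact[OF AB(1,3,2) e] .
    obtain H where H: "compact H" "H \<noteq> {}" "H \<subseteq> B'" "emeasure lborel B' \<le> emeasure lborel H + ennreal (e / 2)"
      using bounded_borel_inner_compact[OF AB(5,7,6) e] .
    have "emeasure lborel A' + emeasure lborel B'
        \<le> (emeasure lborel K + ennreal (e / 2)) + (emeasure lborel H + ennreal (e / 2))"
      using K H by (intro add_mono)
    also have "\<dots> = (emeasure lborel K + emeasure lborel H) + (ennreal (e / 2) + ennreal (e / 2))"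
      by (simp add: ac_simps)
    also have "ennreal (e / 2) + ennreal (e / 2) = ennreal e"
      using \<open>0 < e\<close> by (subst ennreal_plus[symmetric]) auto
    also have "emeasure lborel K + emeasure lborel H \<le> 2 * emeasure lborel C"
      using K H AB mid by (intro brunn_minkowski_midpoint_compact C) blast+
    finally show "emeasure lborel A' + emeasure lborel B' \<le> 2 * emeasure lborel C + ennreal e"
      by (simp add: add_right_mono)
  qed
  obtain a b where ab: "a \<in> A" "b \<in> B" using A B by auto
  \<comment> \<open>From N on both truncations contain the chosen points a and b, hence are nonempty
    as the bounded case demands.\<close>
  define N where "N = nat \<lceil>max \<bar>a\<bar> \<bar>b\<bar>\<rceil>"
  have N: "\<bar>a\<bar> \<le> real n" "\<bar>b\<bar> \<le> real n" if "n \<ge> N" for n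
    using that by (auto simp: N_def)
  have lim: "(\<lambda>n. emeasure lborel (S \<inter> {- real n..real n})) \<longlonglongrightarrow> emeasure lborel S"
    if [measurable]: "S \<in> sets borel" for S
  proof -
    have "(\<Union>n. S \<inter> {- real n..real n}) = S"
    proof safe
      fix x assume "x \<in> S"
      moreover obtain n :: nat where "\<bar>x\<bar> \<le> real n" using real_arch_simple by blast
      ultimately show "x \<in> (\<Union>n. S \<inter> {- real n..real n})" by (auto intro!: exI[of _ n])
    qed
    moreover have "incseq (\<lambda>n. S \<inter> {- real n..real n})" by (auto simp: incseq_def)
    moreover have "range (\<lambda>n. S \<inter> {- real n..real n}) \<subseteq> sets lborel" by auto
    ultimately show ?thesis using Lim_emeasure_incseq[of "\<lambda>n. S \<inter> {- real n..real n}" lborel] by simp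
  qed
  show ?thesis
  proof (rule LIMSEQ_le_const2)
    show "(\<lambda>n. emeasure lborel (A \<inter> {- real n..real n}) + emeasure lborel (B \<inter> {- real n..real n}))
        \<longlonglongrightarrow> emeasure lborel A + emeasure lborel B"
      using A B by (intro tendsto_add lim)
    have "emeasure lborel (A \<inter> {- real n..real n}) + emeasure lborel (B \<inter> {- real n..real n}) \<le> 2 * emeasure lborel C"
      if n: "n \<ge> N" for n
    proof (rule bdd)
      show "A \<inter> {- real n..real n} \<noteq> {}" using ab(1) N(1)[OF n] by (auto simp: abs_le_iff)
      show "B \<inter> {- real n..real n} \<noteq> {}" using ab(2) N(2)[OF n] by (auto simp: abs_le_iff)
    qed (use A B in \<open>auto intro: bounded_Int\<close>)
    then show "\<exists>N. \<forall>n\<ge>N. emeasure lborel (A \<inter> {- real n..real n}) + emeasure lborel (B \<inter> {- real n..real n}) \<le> 2 * emeasure lborel C"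
      by blast
  qed
qed

text \<open>The layer-cake formula with levels measured in units of \<open>\<alpha>\<close>, so that
  two functions with different suprema can be compared at the same parameter t in (0, 1).\<close>

lemma nn_integral_levels:
  fixes f :: "real \<Rightarrow> ennreal" and \<alpha> :: real
  assumes [measurable]: "f \<in> borel_measurable borel" and \<alpha>: "0 < \<alpha>" and bound: "\<And>x. f x \<le> ennreal \<alpha>"
  shows "(\<integral>\<^sup>+x. f x \<partial>lborel)
    = ennreal \<alpha> * (\<integral>\<^sup>+t. indicator {0<..<1} t * emeasure lborel {x. ennreal (t * \<alpha>) < f x} \<partial>lborel)"
proof -
  have pt: "f x = ennreal \<alpha> * (\<integral>\<^sup>+t. indicator {0<..<1} t * indicator {x. ennreal (t * \<alpha>) < f x} x \<partial>lborel)" for x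
  proof -
    obtain y where y: "f x = ennreal y" "0 \<le> y" using bound[of x] by (cases "f x") (auto simp: top_unique)
    then have y1: "y / \<alpha> \<le> 1" using bound[of x] \<alpha> by (simp add: ennreal_le_iff)
    have "(\<integral>\<^sup>+t. indicator {0<..<1} t * indicator {x. ennreal (t * \<alpha>) < f x} x \<partial>lborel)
        = (\<integral>\<^sup>+t. indicator {0<..<y / \<alpha>} t \<partial>lborel)"
    proof (intro nn_integral_cong)
      fix t :: real
      have "t < 1" if "t * \<alpha> < y"
      proof -
        have "y \<le> \<alpha>" using y1 \<alpha> by (simp add: divide_le_eq)
        with that have "t * \<alpha> < 1 * \<alpha>" unfolding mult_1 by (rule less_le_trans)
        then show ?thesis using mult_less_cancel_right_pos[OF \<alpha>] by blast
      qed
      then have "0 < t \<and> t < 1 \<and> t * \<alpha> < y \<longleftrightarrow> 0 < t \<and> t < y / \<alpha>"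
        using \<alpha> by (auto simp: pos_less_divide_eq)
      then show "(indicator {0<..<1} t * indicator {x. ennreal (t * \<alpha>) < f x} x :: ennreal) = indicator {0<..<y / \<alpha>} t"
        using \<alpha> y by (auto simp: indicator_def ennreal_less_iff)
    qed
    also have "\<dots> = ennreal (y / \<alpha>)" using y \<alpha> by simp
    finally show ?thesis using y \<alpha> by (simp add: ennreal_mult[symmetric])
  qed
  have [measurable]: "Measurable.pred (borel \<Otimes>\<^sub>M borel) (\<lambda>p :: real \<times> real. ennreal (snd p * \<alpha>) < f (fst p))"
    by measurable
  have "(\<integral>\<^sup>+x. f x \<partial>lborel)
      = ennreal \<alpha> * (\<integral>\<^sup>+x. \<integral>\<^sup>+t. indicator {0<..<1} t * indicator {x. ennreal (t * \<alpha>) < f x} x \<partial>lborel \<partial>lborel)"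
    by (subst pt, rule nn_integral_cmult) (simp add: indicator_def, measurable)
  also have "(\<integral>\<^sup>+x. \<integral>\<^sup>+t. indicator {0<..<1} t * indicator {x. ennreal (t * \<alpha>) < f x} x \<partial>lborel \<partial>lborel)
      = (\<integral>\<^sup>+t. \<integral>\<^sup>+x. indicator {0<..<1} t * indicator {x. ennreal (t * \<alpha>) < f x} x \<partial>lborel \<partial>lborel)"
    by (rule lborel_pair.Fubini'[symmetric]) (simp add: indicator_def case_prod_beta', measurable)
  also have "\<dots> = (\<integral>\<^sup>+t. indicator {0<..<1} t * emeasure lborel {x. ennreal (t * \<alpha>) < f x} \<partial>lborel)"
    by (intro nn_integral_cong) (subst nn_integral_cmult, auto)
  finally show ?thesis .
qed


text \<open>The pointwise supremum rather than the essential one: Brunn-Minkowski asks that the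
  level sets of both functions be nonempty for every t < 1.\<close>

lemma sup_levels:
  fixes f :: "'a \<Rightarrow> ennreal"
  assumes pos: "0 < f x0" and bound: "\<And>x. f x \<le> ennreal b"
  shows "\<exists>\<alpha>>0. (\<forall>x. f x \<le> ennreal \<alpha>) \<and> (\<forall>t. 0 < t \<and> t < 1 \<longrightarrow> (\<exists>x. ennreal (t * \<alpha>) < f x))"
proof -
  have "(SUP x. f x) \<le> ennreal b" by (intro SUP_least bound)
  then obtain \<alpha> where \<alpha>: "(SUP x. f x) = ennreal \<alpha>" "0 \<le> \<alpha>"
    by (cases "SUP x. f x") (auto simp: top_unique)
  have le: "f x \<le> ennreal \<alpha>" for x unfolding \<alpha>(1)[symmetric] by (rule SUP_upper) simp
  have "0 < \<alpha>" using less_le_trans[OF pos le] by simp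
  moreover have "\<exists>x. ennreal (t * \<alpha>) < f x" if "0 < t" "t < 1" for t
  proof -
    have "ennreal (t * \<alpha>) < (SUP x. f x)"
      unfolding \<alpha>(1) using that \<open>0 < \<alpha>\<close> by (intro ennreal_lessI) auto
    then show ?thesis by (simp add: less_SUP_iff)
  qed
  ultimately show ?thesis using le by blast
qed

text \<open>Excludes the value infinity: if f x * g y is at most 1 throughout, one positive value of
  either function bounds all values of the other.\<close>

lemma ennreal_bound_of_mult_le:
  fixes a c :: ennreal
  assumes "0 < c" "0 < a0" and le: "\<And>a. a \<in> S \<Longrightarrow> a * c \<le> 1" "a0 \<in> S"
  shows "\<exists>b. \<forall>a \<in> S. a \<le> ennreal b"
proof (cases c)
  case (real r)
  have r: "r > 0" using \<open>0 < c\<close> real by simp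
  have "a \<le> ennreal (1 / r)" if "a \<in> S" for a
  proof (cases a)
    case a: (real q)
    then have "q * r \<le> 1" using le(1)[OF that] real r by (simp add: ennreal_mult[symmetric])
    then show ?thesis using r a by (simp add: ennreal_le_iff field_simps)
  next
    case top
    then show ?thesis using le(1)[OF that] \<open>0 < c\<close> by (auto simp: ennreal_top_mult top_unique split: if_splits)
  qed
  then show ?thesis by blast
next
  case top
  then show ?thesis using le(1)[OF le(2)] \<open>0 < a0\<close> by (auto simp: ennreal_mult_top top_unique split: if_splits)
qed

text \<open>One-dimensional Prekopa--Leindler inequality for the standard Gaussian, in the form of
  Maurey's property \<open>(\<tau>)\<close>.\<close>

lemma gaussian_tau_1d:
  fixes u v :: "real \<Rightarrow> ennreal"
  defines "\<gamma> \<equiv> density lborel (\<lambda>x. ennreal (std_normal_density x))"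
  assumes [measurable]: "u \<in> borel_measurable borel" "v \<in> borel_measurable borel"
    and uv: "\<And>x y. u x * v y \<le> ennreal (exp ((x - y)\<^sup>2 / 4))"
  shows "(\<integral>\<^sup>+x. u x \<partial>\<gamma>) * (\<integral>\<^sup>+x. v x \<partial>\<gamma>) \<le> 1"
proof -
  let ?\<phi> = std_normal_density
  define f where "f x = ennreal (?\<phi> x) * u x" for x
  define g where "g x = ennreal (?\<phi> x) * v x" for x
  have [measurable]: "f \<in> borel_measurable borel" "g \<in> borel_measurable borel"
    unfolding f_def g_def by measurable
  have F: "(\<integral>\<^sup>+x. u x \<partial>\<gamma>) = (\<integral>\<^sup>+x. f x \<partial>lborel)" and G: "(\<integral>\<^sup>+x. v x \<partial>\<gamma>) = (\<integral>\<^sup>+x. g x \<partial>lborel)"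
    by (simp_all add: \<gamma>_def f_def g_def nn_integral_density)
  have \<phi>0: "0 < ?\<phi> x" for x by (simp add: normal_density_pos)
  have \<phi>1: "?\<phi> x \<le> 1" for x
  proof -
    have "1 \<le> sqrt (2 * pi)" using pi_ge_two by simp
    then have "1 / sqrt (2 * pi) \<le> 1" by simp
    then show ?thesis unfolding std_normal_density_def by (intro mult_le_one) auto
  qed
  \<comment> \<open>The parallelogram identity: (x - y)^2 / 4 is exactly what is missing for the
    product of two Gaussian densities to be the square of the density at the midpoint. This is the
    origin of the 4 in the cost.\<close>
  have \<phi>\<phi>: "?\<phi> x * ?\<phi> y * exp ((x - y)\<^sup>2 / 4) = (?\<phi> ((x + y) / 2))\<^sup>2" for x y
  proof -
    have "- x\<^sup>2 / 2 + - y\<^sup>2 / 2 + (x - y)\<^sup>2 / 4 = 2 * (- ((x + y) / 2)\<^sup>2 / 2)"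
      by (simp add: power2_eq_square field_simps)
    then have "exp (- x\<^sup>2 / 2) * exp (- y\<^sup>2 / 2) * exp ((x - y)\<^sup>2 / 4) = (exp (- ((x + y) / 2)\<^sup>2 / 2))\<^sup>2"
      by (simp only: exp_add[symmetric] exp_double[symmetric])
    then show ?thesis unfolding std_normal_density_def
      by (simp only: power_mult_distrib power2_eq_square[of "1 / sqrt (2 * pi)"]) (simp only: mult_ac)
  qed
  have fg: "f x * g y \<le> ennreal ((?\<phi> ((x + y) / 2))\<^sup>2)" for x y
  proof -
    have "f x * g y = ennreal (?\<phi> x * ?\<phi> y) * (u x * v y)"
      using \<phi>0[of x] \<phi>0[of y] by (simp add: f_def g_def ennreal_mult less_imp_le mult_ac)
    also have "\<dots> \<le> ennreal (?\<phi> x * ?\<phi> y) * ennreal (exp ((x - y)\<^sup>2 / 4))"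
      by (intro mult_left_mono uv) auto
    also have "\<dots> = ennreal ((?\<phi> ((x + y) / 2))\<^sup>2)"
      using \<phi>0[of x] \<phi>0[of y] by (simp add: \<phi>\<phi>[symmetric] ennreal_mult less_imp_le)
    finally show ?thesis .
  qed
  have fg1: "f x * g y \<le> 1" for x y
    using fg[of x y] \<phi>1 \<phi>0 by (elim order_trans) (simp add: power_le_one less_imp_le)
  show ?thesis
  proof (cases "(\<exists>x. f x > 0) \<and> (\<exists>y. g y > 0)")
    case False
    then have "f = (\<lambda>_. 0) \<or> g = (\<lambda>_. 0)" by (auto simp: not_gr_zero)
    then show ?thesis unfolding F G by auto
  next
    case True
    then obtain x0 y0 where x0: "f x0 > 0" and y0: "g y0 > 0" by auto
    obtain b where b: "\<And>x. f x \<le> ennreal b"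
      using ennreal_bound_of_mult_le[of "g y0" "f x0" "range f"] x0 y0 fg1 by auto
    obtain b' where b': "\<And>x. g x \<le> ennreal b'"
    proof -
      have "a * f x0 \<le> 1" if "a \<in> range g" for a using that fg1[of x0] by (auto simp: mult.commute[of _ "f x0"])
      then show ?thesis using ennreal_bound_of_mult_le[of "f x0" "g y0" "range g"] x0 y0 that by auto
    qed
    obtain \<alpha> where \<alpha>: "\<alpha> > 0" "\<And>x. f x \<le> ennreal \<alpha>" "\<And>t. 0 < t \<Longrightarrow> t < 1 \<Longrightarrow> \<exists>x. ennreal (t * \<alpha>) < f x"
      using sup_levels[of f x0 b, OF x0 b] by blast
    obtain \<beta> where \<beta>: "\<beta> > 0" "\<And>x. g x \<le> ennreal \<beta>" "\<And>t. 0 < t \<Longrightarrow> t < 1 \<Longrightarrow> \<exists>x. ennreal (t * \<beta>) < g x"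
      using sup_levels[of g y0 b', OF y0 b'] by blast
    \<comment> \<open>A level t \<open>\<alpha>\<close> of f at x and a level t
      \<open>\<beta>\<close> of g at y force the density at the midpoint to be at least t times the
      geometric mean s, since its square dominates the product.\<close>
    define s where "s = sqrt (\<alpha> * \<beta>)"
    have s: "s > 0" "s\<^sup>2 = \<alpha> * \<beta>" using \<alpha> \<beta> by (auto simp: s_def)
    define IA where "IA = (\<integral>\<^sup>+t. indicator {0<..<1} t * emeasure lborel {x. ennreal (t * \<alpha>) < f x} \<partial>lborel)"
    define IB where "IB = (\<integral>\<^sup>+t. indicator {0<..<1} t * emeasure lborel {x. ennreal (t * \<beta>) < g x} \<partial>lborel)"
    have level: "emeasure lborel {x. ennreal (t * \<alpha>) < f x} + emeasure lborel {x. ennreal (t * \<beta>) < g x}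
        \<le> 2 * emeasure lborel {z. t * s \<le> ?\<phi> z}" if t: "0 < t" "t < 1" for t
    proof (rule brunn_minkowski_midpoint)
      show "{x. ennreal (t * \<alpha>) < f x} \<noteq> {}" "{x. ennreal (t * \<beta>) < g x} \<noteq> {}" using \<alpha>(3) \<beta>(3) t by auto
      fix x y assume "x \<in> {x. ennreal (t * \<alpha>) < f x}" "y \<in> {x. ennreal (t * \<beta>) < g x}"
      then have "ennreal (t * \<alpha>) * ennreal (t * \<beta>) \<le> f x * g y" by (intro mult_mono) auto
      also have "\<dots> \<le> ennreal ((?\<phi> ((x + y) / 2))\<^sup>2)" by (rule fg)
      finally have "(t * \<alpha>) * (t * \<beta>) \<le> (?\<phi> ((x + y) / 2))\<^sup>2"
        using t \<alpha> \<beta> by (simp add: ennreal_mult[symmetric])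
      then have "(t * s)\<^sup>2 \<le> (?\<phi> ((x + y) / 2))\<^sup>2" by (simp add: power_mult_distrib s power2_eq_square[of t] mult_ac)
      then show "(x + y) / 2 \<in> {z. t * s \<le> ?\<phi> z}"
        using power2_le_imp_le \<phi>0[of "(x + y) / 2"] less_imp_le by blast
    qed measurable
    have [measurable]: "Measurable.pred (borel \<Otimes>\<^sub>M borel) (\<lambda>p :: real \<times> real. ennreal (snd p * \<alpha>) < f (fst p))"
      "Measurable.pred (borel \<Otimes>\<^sub>M borel) (\<lambda>p :: real \<times> real. ennreal (snd p * \<beta>) < g (fst p))"
      by measurable
    have meas: "(\<lambda>t. emeasure lborel {x. ennreal (t * a) < k x}) \<in> borel_measurable borel"
      if [measurable]: "k \<in> borel_measurable borel" for k :: "real \<Rightarrow> ennreal" and a :: real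
    proof -
      have "{p \<in> space (lborel \<Otimes>\<^sub>M lborel). ennreal (snd p * a) < k (fst p)} \<in> sets (lborel \<Otimes>\<^sub>M lborel)"
        by measurable
      from lborel_pair.measurable_emeasure_Pair2[OF this] show ?thesis by (simp add: vimage_def space_pair_measure)
    qed
    have [measurable]: "(\<lambda>t. emeasure lborel {x. ennreal (t * \<alpha>) < f x}) \<in> borel_measurable borel"
      "(\<lambda>t. emeasure lborel {x. ennreal (t * \<beta>) < g x}) \<in> borel_measurable borel"
      by (rule meas, measurable)+
    have "IA + IB = (\<integral>\<^sup>+t. indicator {0<..<1} t * (emeasure lborel {x. ennreal (t * \<alpha>) < f x} +
        emeasure lborel {x. ennreal (t * \<beta>) < g x}) \<partial>lborel)"
      unfolding IA_def IB_def by (subst nn_integral_add[symmetric]) (auto simp: distrib_left)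
    also have "\<dots> \<le> (\<integral>\<^sup>+t. indicator {0<..<1} t * (2 * emeasure lborel {z. t * s \<le> ?\<phi> z}) \<partial>lborel)"
      using level by (intro nn_integral_mono) (auto simp: indicator_def)
    also have "\<dots> = (\<integral>\<^sup>+t. \<integral>\<^sup>+z. 2 * (indicator {0<..<1} t * indicator {z. t * s \<le> ?\<phi> z} z) \<partial>lborel \<partial>lborel)"
      by (intro nn_integral_cong) (simp add: nn_integral_cmult mult_ac)
    also have "\<dots> = (\<integral>\<^sup>+z. \<integral>\<^sup>+t. 2 * (indicator {0<..<1} t * indicator {z. t * s \<le> ?\<phi> z} z) \<partial>lborel \<partial>lborel)"
      by (rule lborel_pair.Fubini') (simp add: indicator_def case_prod_beta', measurable)
    also have "\<dots> \<le> (\<integral>\<^sup>+z. 2 * ennreal (?\<phi> z / s) \<partial>lborel)"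
    proof (rule nn_integral_mono)
      fix z
      have "(\<integral>\<^sup>+t. 2 * (indicator {0<..<1} t * indicator {z. t * s \<le> ?\<phi> z} z) \<partial>lborel)
          \<le> (\<integral>\<^sup>+t. 2 * indicator {0..?\<phi> z / s} t \<partial>lborel)"
        using s by (intro nn_integral_mono) (auto simp: indicator_def field_simps)
      also have "\<dots> = 2 * ennreal (?\<phi> z / s)"
        using s \<phi>0[of z] by (subst nn_integral_cmult) auto
      finally show "(\<integral>\<^sup>+t. 2 * (indicator {0<..<1} t * indicator {z. t * s \<le> ?\<phi> z} z) \<partial>lborel) \<le> 2 * ennreal (?\<phi> z / s)" .
    qed
    also have "\<dots> = (\<integral>\<^sup>+z. ennreal (2 / s) * ennreal (?\<phi> z) \<partial>lborel)"
      using s \<phi>0 by (intro nn_integral_cong) (simp add: ennreal_mult[symmetric] less_imp_le flip: ennreal_numeral)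
    also have "\<dots> = ennreal (2 / s) * (\<integral>\<^sup>+z. ennreal (?\<phi> z) \<partial>lborel)"
      by (rule nn_integral_cmult) simp
    also have "(\<integral>\<^sup>+z. ennreal (?\<phi> z) \<partial>lborel) = 1"
      by (subst nn_integral_eq_integral) (auto simp: integrable_normal_density integral_normal_density)
    finally have I: "IA + IB \<le> ennreal (2 / s)" by simp
    have "IA \<le> ennreal (2 / s)" "IB \<le> ennreal (2 / s)"
      using order_trans[OF add_increasing2[of IB IA IA] I] order_trans[OF add_increasing[of IA IB IB] I] by auto
    then obtain p q where pq: "IA = ennreal p" "0 \<le> p" "IB = ennreal q" "0 \<le> q"
      by (cases IA; cases IB) (auto simp: top_unique)
    \<comment> \<open>Brunn-Minkowski bounds the sum of the two integrals; the arithmetic-geometric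
      mean inequality turns this into a bound on their product, where s^2 =
      \<open>\<alpha> * \<beta>\<close> cancels the normalizations of both functions.\<close>
    have "p + q \<le> 2 / s" using I pq s by (simp add: ennreal_plus[symmetric] del: ennreal_plus)
    then have "(p + q)\<^sup>2 \<le> (2 / s)\<^sup>2" using pq by (intro power_mono) auto
    moreover have "4 * (p * q) \<le> (p + q)\<^sup>2"
      using zero_le_power2[of "p - q"] by (simp add: power2_eq_square algebra_simps)
    ultimately have "4 * (p * q) \<le> 4 / (\<alpha> * \<beta>)" by (simp add: power_divide s)
    then have "\<alpha> * p * (\<beta> * q) \<le> 1" using \<alpha>(1) \<beta>(1) by (simp add: field_simps)
    moreover have "(\<integral>\<^sup>+x. u x \<partial>\<gamma>) = ennreal (\<alpha> * p)" "(\<integral>\<^sup>+x. v x \<partial>\<gamma>) = ennreal (\<beta> * q)"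
      unfolding F G using nn_integral_levels[OF _ \<alpha>(1,2)] nn_integral_levels[OF _ \<beta>(1,2)] pq \<alpha>(1) \<beta>(1)
      by (simp_all add: IA_def IB_def ennreal_mult)
    ultimately show ?thesis
      using pq \<alpha>(1) \<beta>(1) by (simp add: ennreal_mult[symmetric] ennreal_le_1)
  qed
qed

abbreviation gauss1 :: "real measure" where
  "gauss1 \<equiv> density lborel (\<lambda>x. ennreal (std_normal_density x))"

lemma gauss_product: "product_sigma_finite (\<lambda>_ :: nat. gauss1)"
proof -
  interpret prob_space gauss1 by (rule prob_space_normal_density) simp
  show ?thesis by unfold_locales
qed

text \<open>After freezing all but one coordinate, the one-dimensional statement
  applies with a rescaled second function.\<close>

lemma gaussian_tau:
  fixes u v :: "(nat \<Rightarrow> real) \<Rightarrow> ennreal"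
  assumes "finite I"
    and "u \<in> borel_measurable (PiM I (\<lambda>_. gauss1))" "v \<in> borel_measurable (PiM I (\<lambda>_. gauss1))"
    and "\<And>x y. x \<in> space (PiM I (\<lambda>_. gauss1)) \<Longrightarrow> y \<in> space (PiM I (\<lambda>_. gauss1)) \<Longrightarrow>
      u x * v y \<le> ennreal (exp ((\<Sum>i\<in>I. (x i - y i)\<^sup>2) / 4))"
  shows "(\<integral>\<^sup>+x. u x \<partial>PiM I (\<lambda>_. gauss1)) * (\<integral>\<^sup>+x. v x \<partial>PiM I (\<lambda>_. gauss1)) \<le> 1"
  using assms
proof (induction I arbitrary: u v rule: finite_induct)
  case empty
  interpret product_sigma_finite "\<lambda>_ :: nat. gauss1" by (rule gauss_product)
  show ?case using empty(3)[of "\<lambda>_. undefined" "\<lambda>_. undefined"]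
    by (simp add: nn_integral_empty space_PiM)
next
  case (insert i I)
  interpret product_sigma_finite "\<lambda>_ :: nat. gauss1" by (rule gauss_product)
  note [measurable] = insert.prems(1,2)
  let ?P = "PiM I (\<lambda>_. gauss1)"
  define U where "U x = (\<integral>\<^sup>+y. u (x(i := y)) \<partial>gauss1)" for x
  define V where "V x = (\<integral>\<^sup>+y. v (x(i := y)) \<partial>gauss1)" for x
  interpret G: sigma_finite_measure gauss1 by (rule sigma_finite_measures)
  have [measurable]: "U \<in> borel_measurable ?P" "V \<in> borel_measurable ?P"
    unfolding U_def V_def by measurable
  have UV: "U x * V x' \<le> ennreal (exp ((\<Sum>i\<in>I. (x i - x' i)\<^sup>2) / 4))"
    if x: "x \<in> space ?P" and x': "x' \<in> space ?P" for x x'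
  proof -
    define E where "E = exp ((\<Sum>i\<in>I. (x i - x' i)\<^sup>2) / 4)"
    have E: "E > 0" by (simp add: E_def)
    have upd: "(\<lambda>y. w(i := y)) \<in> gauss1 \<rightarrow>\<^sub>M PiM (insert i I) (\<lambda>_. gauss1)" if "w \<in> space ?P" for w
      using that insert.hyps(2) by (rule measurable_component_update)
    have mu: "(\<lambda>y. u (x(i := y))) \<in> borel_measurable borel" "(\<lambda>y. v (x'(i := y))) \<in> borel_measurable borel"
    proof -
      have eq: "measurable borel N = measurable gauss1 N" for N :: "ennreal measure"
        by (rule measurable_cong_sets) auto
      show "(\<lambda>y. u (x(i := y))) \<in> borel_measurable borel" "(\<lambda>y. v (x'(i := y))) \<in> borel_measurable borel"
        unfolding eq by (rule measurable_compose[OF upd[OF x] insert.prems(1)], rule measurable_compose[OF upd[OF x'] insert.prems(2)])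
    qed
    have "(\<integral>\<^sup>+y. u (x(i := y)) \<partial>gauss1) * (\<integral>\<^sup>+y. ennreal (1 / E) * v (x'(i := y)) \<partial>gauss1) \<le> 1"
    proof (rule gaussian_tau_1d)
      fix y y'
      have sp: "w(i := z) \<in> space (PiM (insert i I) (\<lambda>_. gauss1))" if "w \<in> space ?P" for w z
        using that by (auto simp: space_PiM PiE_def extensional_def)
      have "u (x(i := y)) * v (x'(i := y')) \<le> ennreal (exp ((\<Sum>j\<in>insert i I. ((x(i := y)) j - (x'(i := y')) j)\<^sup>2) / 4))"
        by (rule insert.prems(3)[OF sp[OF x] sp[OF x']])
      also have "(\<Sum>j\<in>insert i I. ((x(i := y)) j - (x'(i := y')) j)\<^sup>2) = (y - y')\<^sup>2 + (\<Sum>j\<in>I. (x j - x' j)\<^sup>2)"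
        using insert.hyps by (simp add: sum.insert) (rule sum.cong, auto)
      also have "exp (\<dots> / 4) = E * exp ((y - y')\<^sup>2 / 4)"
        by (simp add: E_def exp_add[symmetric] add_divide_distrib add.commute)
      finally have "ennreal (1 / E) * (u (x(i := y)) * v (x'(i := y'))) \<le> ennreal (1 / E) * ennreal (E * exp ((y - y')\<^sup>2 / 4))"
        by (rule mult_left_mono) simp
      also have "\<dots> = ennreal (exp ((y - y')\<^sup>2 / 4))"
        using E by (subst ennreal_mult[symmetric]) auto
      finally show "u (x(i := y)) * (ennreal (1 / E) * v (x'(i := y'))) \<le> ennreal (exp ((y - y')\<^sup>2 / 4))"
        by (simp add: mult_ac)
    qed (use mu in measurable)
    also have "(\<integral>\<^sup>+y. ennreal (1 / E) * v (x'(i := y)) \<partial>gauss1) = ennreal (1 / E) * V x'"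
      unfolding V_def using mu by (intro nn_integral_cmult) simp
    finally have "ennreal E * (U x * (ennreal (1 / E) * V x')) \<le> ennreal E * 1"
      unfolding U_def by (rule mult_left_mono) simp
    moreover have "ennreal E * (U x * (ennreal (1 / E) * V x')) = (ennreal E * ennreal (1 / E)) * (U x * V x')"
      by (simp only: mult_ac)
    moreover have "ennreal E * ennreal (1 / E) = 1" using E by (subst ennreal_mult[symmetric]) auto
    ultimately show ?thesis by (simp add: E_def)
  qed
  have "(\<integral>\<^sup>+x. u x \<partial>PiM (insert i I) (\<lambda>_. gauss1)) = (\<integral>\<^sup>+x. U x \<partial>?P)"
    "(\<integral>\<^sup>+x. v x \<partial>PiM (insert i I) (\<lambda>_. gauss1)) = (\<integral>\<^sup>+x. V x \<partial>?P)"
    unfolding U_def V_def using insert.hyps insert.prems by (simp_all add: product_nn_integral_insert)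
  then show ?case using insert.IH[of U V] UV by simp
qed

section \<open>Exponential moments and tails of Lipschitz functions of a Gaussian vector\<close>

lemma std_gauss_eq: "std_gauss m = PiM {..<m} (\<lambda>_. gauss1)"
  by (simp add: std_gauss_def)

lemma sets_std_gauss [measurable_cong]: "sets (std_gauss m) = sets (euc_borel m)"
  unfolding std_gauss_def euc_borel_def by (intro sets_PiM_cong) auto

lemma space_euc_borel: "space (euc_borel m) = euc m"
  by (simp add: euc_borel_def euc_def space_PiM)

context prob_space
begin

definition gaussian_vector :: "nat \<Rightarrow> ('a \<Rightarrow> nat \<Rightarrow> real) \<Rightarrow> bool" where
  "gaussian_vector m g \<longleftrightarrow> g \<in> M \<rightarrow>\<^sub>M euc_borel m \<and> distr M (euc_borel m) g = std_gauss m"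

lemma gaussian_nn_integral:
  assumes g: "gaussian_vector m g" and u: "u \<in> borel_measurable (euc_borel m)"
  shows "(\<integral>\<^sup>+\<omega>. u (g \<omega>) \<partial>M) = (\<integral>\<^sup>+x. u x \<partial>std_gauss m)"
  using assms nn_integral_distr[of g M "euc_borel m" u] by (simp add: gaussian_vector_def)

text \<open>The set \<open>D\<close> lets the Lipschitz
  condition fail on a null set.\<close>

lemma gaussian_lipschitz_product:
  assumes g: "gaussian_vector m g" and f [measurable]: "f \<in> borel_measurable (euc_borel m)"
    and D [measurable]: "D \<in> sets (euc_borel m)" "AE \<omega> in M. g \<omega> \<in> D" and K: "0 \<le> K"
    and lip: "\<And>x y. x \<in> D \<Longrightarrow> y \<in> D \<Longrightarrow> \<bar>f x - f y\<bar> \<le> K * L2_set (\<lambda>i. x i - y i) {..<m}"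
  shows "(\<integral>\<^sup>+\<omega>. ennreal (exp (f (g \<omega>))) \<partial>M) * (\<integral>\<^sup>+\<omega>. ennreal (exp (- f (g \<omega>))) \<partial>M) \<le> ennreal (exp (K\<^sup>2))"
proof -
  define u where "u x = ennreal (exp (f x)) * indicator D x" for x
  define v where "v x = ennreal (exp (- f x - K\<^sup>2)) * indicator D x" for x
  have [measurable]: "u \<in> borel_measurable (euc_borel m)" "v \<in> borel_measurable (euc_borel m)"
    unfolding u_def v_def by measurable
  have "(\<integral>\<^sup>+x. u x \<partial>std_gauss m) * (\<integral>\<^sup>+x. v x \<partial>std_gauss m) \<le> 1"
    unfolding std_gauss_eq
  proof (rule gaussian_tau)
    fix x y :: "nat \<Rightarrow> real"
    let ?d = "L2_set (\<lambda>i. x i - y i) {..<m}"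
    have d2: "?d\<^sup>2 = (\<Sum>i<m. (x i - y i)\<^sup>2)" by (simp add: L2_set_def sum_nonneg)
    show "u x * v y \<le> ennreal (exp ((\<Sum>i<m. (x i - y i)\<^sup>2) / 4))"
    proof (cases "x \<in> D \<and> y \<in> D")
      case True
      have "f x - f y - K\<^sup>2 \<le> K * ?d - K\<^sup>2" using lip[of x y] True by auto
      also have "\<dots> \<le> ?d\<^sup>2 / 4"
        using zero_le_power2[of "?d / 2 - K"] by (simp add: power2_eq_square algebra_simps)
      finally have "f x + (- f y - K\<^sup>2) \<le> (\<Sum>i<m. (x i - y i)\<^sup>2) / 4" by (simp add: d2)
      then show ?thesis using True by (simp add: u_def v_def ennreal_mult[symmetric] exp_add[symmetric])
    qed (auto simp: u_def v_def)
  qed (simp_all flip: std_gauss_eq, measurable)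
  moreover have "(\<integral>\<^sup>+x. u x \<partial>std_gauss m) = (\<integral>\<^sup>+\<omega>. ennreal (exp (f (g \<omega>))) \<partial>M)"
    unfolding gaussian_nn_integral[OF g \<open>u \<in> _\<close>, symmetric]
    using D(2) by (intro nn_integral_cong_AE) (auto simp: u_def)
  moreover have "(\<integral>\<^sup>+x. v x \<partial>std_gauss m) = (\<integral>\<^sup>+\<omega>. ennreal (exp (- f (g \<omega>) - K\<^sup>2)) \<partial>M)"
    unfolding gaussian_nn_integral[OF g \<open>v \<in> _\<close>, symmetric]
    using D(2) by (intro nn_integral_cong_AE) (auto simp: v_def)
  moreover have "(\<integral>\<^sup>+\<omega>. ennreal (exp (- f (g \<omega>) - K\<^sup>2)) \<partial>M) = ennreal (exp (- (K\<^sup>2))) * (\<integral>\<^sup>+\<omega>. ennreal (exp (- f (g \<omega>))) \<partial>M)"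
  proof -
    have [measurable]: "g \<in> M \<rightarrow>\<^sub>M euc_borel m" using g by (simp add: gaussian_vector_def)
    show ?thesis
      by (subst nn_integral_cmult[symmetric]) (auto simp: ennreal_mult[symmetric] exp_add[symmetric] algebra_simps)
  qed
  ultimately have le: "ennreal (exp (- (K\<^sup>2))) * ((\<integral>\<^sup>+\<omega>. ennreal (exp (f (g \<omega>))) \<partial>M) * (\<integral>\<^sup>+\<omega>. ennreal (exp (- f (g \<omega>))) \<partial>M)) \<le> 1"
    by (simp add: mult_ac)
  have "ennreal (exp (K\<^sup>2)) * (ennreal (exp (- (K\<^sup>2))) * ((\<integral>\<^sup>+\<omega>. ennreal (exp (f (g \<omega>))) \<partial>M) * (\<integral>\<^sup>+\<omega>. ennreal (exp (- f (g \<omega>))) \<partial>M)))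
      \<le> ennreal (exp (K\<^sup>2)) * 1"
    using le by (rule mult_left_mono) simp
  moreover have "ennreal (exp (K\<^sup>2)) * ennreal (exp (- (K\<^sup>2))) = 1"
    by (simp add: ennreal_mult[symmetric] exp_add[symmetric])
  ultimately show ?thesis by (simp add: mult.assoc[symmetric])
qed

text \<open>Integrability is a consequence: neither exponential integral is zero and their product
  is finite, so both are finite, and they dominate |f|. Bounding one factor of the product from
  below by Jensen's inequality leaves the centred exponential moment.\<close>

lemma gaussian_lipschitz_exp:
  assumes g: "gaussian_vector m g" and f [measurable]: "f \<in> borel_measurable (euc_borel m)"
    and D: "D \<in> sets (euc_borel m)" "AE \<omega> in M. g \<omega> \<in> D" and K: "0 \<le> K"
    and lip: "\<And>x y. x \<in> D \<Longrightarrow> y \<in> D \<Longrightarrow> \<bar>f x - f y\<bar> \<le> K * L2_set (\<lambda>i. x i - y i) {..<m}"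
  shows "integrable M (\<lambda>\<omega>. f (g \<omega>))" "integrable M (\<lambda>\<omega>. exp (f (g \<omega>)))"
    "expectation (\<lambda>\<omega>. exp (f (g \<omega>) - expectation (\<lambda>\<omega>. f (g \<omega>)))) \<le> exp (K\<^sup>2)"
proof -
  have [measurable]: "g \<in> M \<rightarrow>\<^sub>M euc_borel m" using g by (simp add: gaussian_vector_def)
  let ?a = "\<integral>\<^sup>+\<omega>. ennreal (exp (f (g \<omega>))) \<partial>M" and ?b = "\<integral>\<^sup>+\<omega>. ennreal (exp (- f (g \<omega>))) \<partial>M"
  have ab: "?a * ?b \<le> ennreal (exp (K\<^sup>2))" by (rule gaussian_lipschitz_product[OF assms])
  have nz: "?a \<noteq> 0" "?b \<noteq> 0" by (auto simp: nn_integral_0_iff_AE)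
  have fin: "?a < \<infinity>" "?b < \<infinity>"
    using ab nz by (auto simp: less_top[symmetric] top_unique ennreal_mult_top ennreal_top_mult)
  show int: "integrable M (\<lambda>\<omega>. exp (f (g \<omega>)))"
    using fin by (intro integrableI_nonneg) auto
  have int': "integrable M (\<lambda>\<omega>. exp (- f (g \<omega>)))"
    using fin by (intro integrableI_nonneg) auto
  show intf: "integrable M (\<lambda>\<omega>. f (g \<omega>))"
  proof (rule Bochner_Integration.integrable_bound)
    show "integrable M (\<lambda>\<omega>. exp (f (g \<omega>)) + exp (- f (g \<omega>)))" using int int' by simp
    show "AE \<omega> in M. norm (f (g \<omega>)) \<le> norm (exp (f (g \<omega>)) + exp (- f (g \<omega>)))"
    proof (rule AE_I2)
      fix \<omega>
      have "\<bar>r\<bar> \<le> exp r + exp (- r)" for r :: real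
        using exp_ge_add_one_self[of r] exp_ge_add_one_self[of "- r"] exp_gt_zero[of r] exp_gt_zero[of "- r"] by linarith
      then show "norm (f (g \<omega>)) \<le> norm (exp (f (g \<omega>)) + exp (- f (g \<omega>)))" by (simp add: add_nonneg_nonneg)
    qed
  qed measurable
  let ?e = "expectation (\<lambda>\<omega>. f (g \<omega>))"
  \<comment> \<open>Jensen's inequality for the exponential, from its tangent line at the negative
    of the mean.\<close>
  have "exp (- ?e) \<le> expectation (\<lambda>\<omega>. exp (- f (g \<omega>)))"
  proof -
    have "exp (- ?e) = expectation (\<lambda>\<omega>. exp (- ?e) * (1 + (?e - f (g \<omega>))))"
      using intf by (simp add: prob_space)
    also have "\<dots> \<le> expectation (\<lambda>\<omega>. exp (- f (g \<omega>)))"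
    proof (rule integral_mono)
      fix \<omega>
      have "exp (- ?e) * (1 + (?e - f (g \<omega>))) \<le> exp (- ?e) * exp (?e - f (g \<omega>))"
        by (intro mult_left_mono exp_ge_add_one_self) auto
      then show "exp (- ?e) * (1 + (?e - f (g \<omega>))) \<le> exp (- f (g \<omega>))" by (simp add: exp_add[symmetric])
    qed (use intf int' in auto)
    finally show ?thesis .
  qed
  moreover have "expectation (\<lambda>\<omega>. exp (f (g \<omega>))) * expectation (\<lambda>\<omega>. exp (- f (g \<omega>))) \<le> exp (K\<^sup>2)"
    using ab int int' by (simp add: nn_integral_eq_integral ennreal_mult[symmetric] integral_nonneg_AE)
  moreover have "0 \<le> expectation (\<lambda>\<omega>. exp (f (g \<omega>)))" by (rule Bochner_Integration.integral_nonneg) simp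
  ultimately have "expectation (\<lambda>\<omega>. exp (f (g \<omega>))) * exp (- ?e) \<le> exp (K\<^sup>2)"
    using mult_left_mono order_trans by meson
  moreover have "exp (f (g \<omega>) - ?e) = exp (f (g \<omega>)) * exp (- ?e)" for \<omega>
    unfolding exp_add[symmetric] by simp
  ultimately show "expectation (\<lambda>\<omega>. exp (f (g \<omega>) - ?e)) \<le> exp (K\<^sup>2)" by simp
qed

lemma gaussian_lipschitz_mgf:
  assumes g: "gaussian_vector m g" and f [measurable]: "f \<in> borel_measurable (euc_borel m)"
    and D: "D \<in> sets (euc_borel m)" "AE \<omega> in M. g \<omega> \<in> D" and K: "0 \<le> K"
    and lip: "\<And>x y. x \<in> D \<Longrightarrow> y \<in> D \<Longrightarrow> \<bar>f x - f y\<bar> \<le> K * L2_set (\<lambda>i. x i - y i) {..<m}"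
  shows "integrable M (\<lambda>\<omega>. exp (s * f (g \<omega>)))"
    "expectation (\<lambda>\<omega>. exp (s * (f (g \<omega>) - expectation (\<lambda>\<omega>. f (g \<omega>))))) \<le> exp ((s * K)\<^sup>2)"
proof -
  have *: "\<bar>s * f x - s * f y\<bar> \<le> (\<bar>s\<bar> * K) * L2_set (\<lambda>i. x i - y i) {..<m}" if "x \<in> D" "y \<in> D" for x y
    using mult_left_mono[OF lip[OF that], of "\<bar>s\<bar>"] by (simp add: abs_mult[symmetric] right_diff_distrib mult.assoc)
  have sf: "(\<lambda>x. s * f x) \<in> borel_measurable (euc_borel m)" by measurable
  have K': "0 \<le> \<bar>s\<bar> * K" using K by simp
  note main = gaussian_lipschitz_exp[of m g "\<lambda>x. s * f x" D "\<bar>s\<bar> * K", OF g sf D K' *]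
  show "integrable M (\<lambda>\<omega>. exp (s * f (g \<omega>)))" by (rule main(2))
  show "expectation (\<lambda>\<omega>. exp (s * (f (g \<omega>) - expectation (\<lambda>\<omega>. f (g \<omega>))))) \<le> exp ((s * K)\<^sup>2)"
  proof -
    have 1: "expectation (\<lambda>\<omega>. s * f (g \<omega>)) = s * expectation (\<lambda>\<omega>. f (g \<omega>))" by (rule integral_mult_right_zero)
    have 2: "(\<bar>s\<bar> * K)\<^sup>2 = (s * K)\<^sup>2" by (simp add: power_mult_distrib)
    have 3: "expectation (\<lambda>\<omega>. exp (s * f (g \<omega>) - expectation (\<lambda>\<omega>. s * f (g \<omega>)))) \<le> exp ((\<bar>s\<bar> * K)\<^sup>2)"
      by (rule main(3))
    have 4: "s * (f (g \<omega>) - expectation (\<lambda>\<omega>. f (g \<omega>))) = s * f (g \<omega>) - s * expectation (\<lambda>\<omega>. f (g \<omega>))" for \<omega>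
      by (rule right_diff_distrib)
    show ?thesis using 3 unfolding 1 2 4 .
  qed
qed

lemma gaussian_lipschitz_tail:
  assumes g: "gaussian_vector m g" and f [measurable]: "f \<in> borel_measurable (euc_borel m)"
    and D: "D \<in> sets (euc_borel m)" "AE \<omega> in M. g \<omega> \<in> D" and K: "0 < K"
    and lip: "\<And>x y. x \<in> D \<Longrightarrow> y \<in> D \<Longrightarrow> \<bar>f x - f y\<bar> \<le> K * L2_set (\<lambda>i. x i - y i) {..<m}"
    and e: "0 < e"
  shows "prob {\<omega> \<in> space M. e \<le> \<bar>f (g \<omega>) - expectation (\<lambda>\<omega>. f (g \<omega>))\<bar>} \<le> 2 * exp (- (e\<^sup>2 / (4 * K\<^sup>2)))"
proof -
  have [measurable]: "g \<in> M \<rightarrow>\<^sub>M euc_borel m" using g by (simp add: gaussian_vector_def)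
  let ?e = "expectation (\<lambda>\<omega>. f (g \<omega>))"
  \<comment> \<open>The Chernoff bound: this s minimizes (s K)^2 - s e, with minimum -e^2 / (4 K^2).
    The two signs of \<open>\<sigma>\<close> give the two tails.\<close>
  define s where "s = e / (2 * K\<^sup>2)"
  have s: "0 < s" using e K by (simp add: s_def)
  have one: "prob {\<omega> \<in> space M. e \<le> \<sigma> * (f (g \<omega>) - ?e)} \<le> exp (- (e\<^sup>2 / (4 * K\<^sup>2)))" if "\<bar>\<sigma>\<bar> = 1" for \<sigma>
  proof -
    note mgf = gaussian_lipschitz_mgf[of m g f D K "s * \<sigma>", OF g f D less_imp_le[OF K] lip]
    have "integrable M (\<lambda>\<omega>. exp (s * \<sigma> * f (g \<omega>)) * exp (- (s * \<sigma> * ?e)))"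
      using mgf(1) by (rule integrable_mult_left)
    moreover have "exp (s * \<sigma> * f (g \<omega>)) * exp (- (s * \<sigma> * ?e)) = exp (s * \<sigma> * (f (g \<omega>) - ?e))" for \<omega>
      unfolding exp_add[symmetric] by (simp add: right_diff_distrib)
    ultimately have int: "integrable M (\<lambda>\<omega>. exp (s * \<sigma> * (f (g \<omega>) - ?e)))" by (simp only:)
    have "exp (s * e) * prob {\<omega> \<in> space M. e \<le> \<sigma> * (f (g \<omega>) - ?e)}
        = expectation (\<lambda>\<omega>. exp (s * e) * indicator {\<omega> \<in> space M. e \<le> \<sigma> * (f (g \<omega>) - ?e)} \<omega>)"
      by (subst integral_mult_right_zero) (simp add: Int_absorb1 subset_eq)
    also have "\<dots> \<le> expectation (\<lambda>\<omega>. exp (s * \<sigma> * (f (g \<omega>) - ?e)))"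
    proof (rule integral_mono)
      show "integrable M (\<lambda>\<omega>. exp (s * e) * indicator {\<omega> \<in> space M. e \<le> \<sigma> * (f (g \<omega>) - ?e)} \<omega>)"
        by (intro integrable_mult_right integrable_real_indicator) (auto simp: emeasure_eq_measure)
      fix \<omega>
      show "exp (s * e) * indicator {\<omega> \<in> space M. e \<le> \<sigma> * (f (g \<omega>) - ?e)} \<omega> \<le> exp (s * \<sigma> * (f (g \<omega>) - ?e))"
        using s mult_left_mono[of e "\<sigma> * (f (g \<omega>) - ?e)" s] by (auto simp: indicator_def mult.assoc)
    qed (rule int)
    also have "\<dots> \<le> exp ((s * \<sigma> * K)\<^sup>2)" by (rule mgf(2))
    also have "(s * \<sigma> * K)\<^sup>2 = s * e - e\<^sup>2 / (4 * K\<^sup>2)"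
    proof -
      have "\<sigma>\<^sup>2 = 1" using that by (simp add: abs_square_eq_1)
      then show ?thesis using K by (simp add: power_mult_distrib s_def power2_eq_square field_simps)
    qed
    also have "exp \<dots> = exp (s * e) * exp (- (e\<^sup>2 / (4 * K\<^sup>2)))" by (simp add: exp_add[symmetric])
    finally show ?thesis by simp
  qed
  have "{\<omega> \<in> space M. e \<le> \<bar>f (g \<omega>) - ?e\<bar>}
      = {\<omega> \<in> space M. e \<le> 1 * (f (g \<omega>) - ?e)} \<union> {\<omega> \<in> space M. e \<le> (-1) * (f (g \<omega>) - ?e)}"
    using e by (auto simp: abs_if)
  then have "prob {\<omega> \<in> space M. e \<le> \<bar>f (g \<omega>) - ?e\<bar>}
      \<le> prob {\<omega> \<in> space M. e \<le> 1 * (f (g \<omega>) - ?e)} + prob {\<omega> \<in> space M. e \<le> (-1) * (f (g \<omega>) - ?e)}"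
    by (simp only:) (rule measure_Un_le, measurable)
  then show ?thesis using one[of 1] one[of "-1"] by linarith
qed

end

section \<open>Stability of the regularized Dyson equation\<close>

lemma psd_smult_one:
  assumes "0 \<le> c"
  shows "psd n (complex_of_real c \<cdot>\<^sub>m 1\<^sub>m n)"
proof -
  have "mat_adjoint (complex_of_real c \<cdot>\<^sub>m 1\<^sub>m n) = complex_of_real c \<cdot>\<^sub>m 1\<^sub>m n"
    by (rule eq_matI) auto
  moreover have "Re ((complex_of_real c \<cdot>\<^sub>m 1\<^sub>m n *\<^sub>v v) \<bullet>c v) = c * (vnorm v)\<^sup>2" if v: "v \<in> carrier_vec n" for v
  proof -
    have "(complex_of_real c \<cdot>\<^sub>m 1\<^sub>m n *\<^sub>v v) \<bullet>c v = complex_of_real c * complex_of_real ((vnorm v)\<^sup>2)"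
      using v by (simp add: smult_mat_mult_vec[of _ n n] cscalar_distrib(3)[of _ n] cscalar_prod_self del: of_real_power)
    then show ?thesis by (simp del: of_real_power)
  qed
  ultimately show ?thesis using assms by (auto simp: psd_def)
qed

lemma adjoint_add:
  fixes A B :: "complex mat"
  assumes "A \<in> carrier_mat n m" "B \<in> carrier_mat n m"
  shows "mat_adjoint (A + B) = mat_adjoint A + mat_adjoint B"
    "mat_adjoint (A - B) = mat_adjoint A - mat_adjoint B"
  using assms by (auto intro!: eq_matI)

text \<open>Every Hermitian matrix is a difference of two positive
  ones.\<close>

lemma pos_linear_hermitian:
  assumes S: "pos_linear l m S" and H: "H \<in> carrier_mat l l" "mat_adjoint H = H"
  shows "mat_adjoint (S H) = S H"
proof -
  define c where "c = spec_norm H"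
  let ?c1 = "complex_of_real c \<cdot>\<^sub>m 1\<^sub>m l"
  have c1: "psd l ?c1" by (rule psd_smult_one) (simp add: c_def)
  then have c1c: "?c1 \<in> carrier_mat l l" by (simp add: psd_def)
  have "psd l (H + ?c1)"
    unfolding psd_def
  proof (intro conjI ballI)
    show "mat_adjoint (H + ?c1) = H + ?c1"
      using c1 H adjoint_add(1)[OF H(1) c1c] by (simp add: psd_def)
    fix v :: "complex Matrix.vec" assume v: "v \<in> carrier_vec l"
    have "(H + ?c1) *\<^sub>v v = H *\<^sub>v v + complex_of_real c \<cdot>\<^sub>v v"
      using H v by (simp add: add_mult_distrib_mat_vec[of _ l l] smult_mat_mult_vec[of _ l l])
    then have "((H + ?c1) *\<^sub>v v) \<bullet>c v = (H *\<^sub>v v) \<bullet>c v + complex_of_real (c * (vnorm v)\<^sup>2)"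
      using H v by (simp add: cscalar_distrib(1)[of "H *\<^sub>v v" l] cscalar_distrib(3)[of _ l] cscalar_prod_self)
    moreover have "\<bar>Re ((H *\<^sub>v v) \<bullet>c v)\<bar> \<le> c * (vnorm v)\<^sup>2"
      using order_trans[OF abs_Re_le_cmod spec_form[OF H(1) v v]] by (simp add: c_def power2_eq_square mult.assoc)
    ultimately show "0 \<le> Re (((H + ?c1) *\<^sub>v v) \<bullet>c v)" by simp
  qed (use H c1c in simp)
  then have "psd m (S (H + ?c1))" "psd m (S ?c1)" using S c1 by (auto simp: pos_linear_def)
  then have 1: "S (H + ?c1) \<in> carrier_mat m m" "mat_adjoint (S (H + ?c1)) = S (H + ?c1)"
    "S ?c1 \<in> carrier_mat m m" "mat_adjoint (S ?c1) = S ?c1" by (simp_all add: psd_def)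
  have 2: "S (H + ?c1) = S H + S ?c1" "S H \<in> carrier_mat m m"
    using S H c1c by (simp_all add: pos_linear_def)
  have 3: "S H = S (H + ?c1) - S ?c1"
    unfolding 2(1) using 2(2) 1(3) by (intro eq_matI) simp_all
  show ?thesis
    by (subst (1 2) 3) (simp only: adjoint_add(2)[OF 1(1,3)] 1(2,4))
qed

text \<open>Split W into a Hermitian part and i times \<open>im_part W\<close>. The first is mapped
  to a Hermitian matrix and adds nothing to the imaginary part; the second is handled by
  positivity.\<close>

lemma pos_linear_im:
  assumes S: "pos_linear l m S" and W: "W \<in> carrier_mat l l" "psd l (im_part W)" and v: "v \<in> carrier_vec m"
  shows "0 \<le> Im ((S W *\<^sub>v v) \<bullet>c v)"
proof -
  define H where "H = (1/2) \<cdot>\<^sub>m (W + mat_adjoint W)"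
  have H: "H \<in> carrier_mat l l" using W by (simp add: H_def)
  have Hh: "mat_adjoint H = H"
    unfolding H_def using W by (intro eq_matI) (auto simp: add.commute)
  have I: "im_part W \<in> carrier_mat l l" using W by simp
  have "W = H + \<i> \<cdot>\<^sub>m im_part W"
    unfolding H_def im_part_def using W by (intro eq_matI) (auto simp: field_simps)
  moreover have "S (H + \<i> \<cdot>\<^sub>m im_part W) = S H + S (\<i> \<cdot>\<^sub>m im_part W)" "S (\<i> \<cdot>\<^sub>m im_part W) = \<i> \<cdot>\<^sub>m S (im_part W)"
    using S H I by (auto simp: pos_linear_def)
  ultimately have "S W = S H + \<i> \<cdot>\<^sub>m S (im_part W)" by simp
  moreover have SH: "S H \<in> carrier_mat m m" and SI: "S (im_part W) \<in> carrier_mat m m"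
    using S H I by (auto simp: pos_linear_def)
  ultimately have "(S W *\<^sub>v v) \<bullet>c v = (S H *\<^sub>v v) \<bullet>c v + \<i> * ((S (im_part W) *\<^sub>v v) \<bullet>c v)"
    using v by (simp add: add_mult_distrib_mat_vec[of _ m m] smult_mat_mult_vec[of _ m m]
        cscalar_distrib(1)[of "S H *\<^sub>v v" m] cscalar_distrib(3)[of _ m])
  moreover have "Im ((S H *\<^sub>v v) \<bullet>c v) = 0"
    by (rule hermitian_form[OF SH pos_linear_hermitian[OF S H Hh] v])
  moreover have "0 \<le> Re ((S (im_part W) *\<^sub>v v) \<bullet>c v)"
    using S W v by (auto simp: pos_linear_def psd_def)
  ultimately show ?thesis by simp
qed

text \<open>The matrix of S in the basis of matrix units. Expansion into finitely many entries is
  what transports measurability, holomorphy and expectations through the abstract map S.\<close>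

definition lin_coeff :: "nat \<Rightarrow> (complex mat \<Rightarrow> complex mat) \<Rightarrow> nat \<Rightarrow> nat \<Rightarrow> nat \<times> nat \<Rightarrow> complex" where
  "lin_coeff l S i j p = S (Matrix.mat l l (\<lambda>q. if q = p then 1 else 0)) $$ (i, j)"

lemma linear_map_entries:
  assumes carr: "\<And>W. W \<in> carrier_mat l l \<Longrightarrow> S W \<in> carrier_mat m m"
    and add: "\<And>V W. V \<in> carrier_mat l l \<Longrightarrow> W \<in> carrier_mat l l \<Longrightarrow> S (V + W) = S V + S W"
    and smult: "\<And>a W. W \<in> carrier_mat l l \<Longrightarrow> S (a \<cdot>\<^sub>m W) = a \<cdot>\<^sub>m S W"
    and W: "W \<in> carrier_mat l l" and ij: "i < m" "j < m"
  shows "S W $$ (i, j) = (\<Sum>p\<in>{..<l} \<times> {..<l}. lin_coeff l S i j p * W $$ p)"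
proof -
  define part where "part T = Matrix.mat l l (\<lambda>q. if q \<in> T then W $$ q else 0)" for T
  have pc: "part T \<in> carrier_mat l l" for T by (simp add: part_def)
  have "S (part T) $$ (i, j) = (\<Sum>p\<in>T. lin_coeff l S i j p * W $$ p)"
    if "finite T" "T \<subseteq> {..<l} \<times> {..<l}" for T
    using that
  proof (induction T rule: finite_induct)
    case empty
    have "part {} = 0 \<cdot>\<^sub>m part {}" by (rule eq_matI) (auto simp: part_def)
    then have "S (part {}) = 0 \<cdot>\<^sub>m S (part {})" using smult[OF pc, of 0 "{}"] by simp
    then have "S (part {}) $$ (i, j) = (0 \<cdot>\<^sub>m S (part {})) $$ (i, j)" by simp
    also have "\<dots> = 0" using carr[OF pc[of "{}"]] ij by simp
    finally show ?case by simp
  next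
    case (insert p T)
    let ?E = "Matrix.mat l l (\<lambda>q. if q = p then 1 else 0 :: complex)"
    have E: "?E \<in> carrier_mat l l" by simp
    have "part (insert p T) = part T + W $$ p \<cdot>\<^sub>m ?E"
      using insert.hyps by (intro eq_matI) (auto simp: part_def)
    then have "S (part (insert p T)) = S (part T) + W $$ p \<cdot>\<^sub>m S ?E"
      using add[OF pc[of T], of "W $$ p \<cdot>\<^sub>m ?E"] smult[OF E] by simp
    then have "S (part (insert p T)) $$ (i, j) = S (part T) $$ (i, j) + W $$ p * S ?E $$ (i, j)"
      using carr[OF pc[of T]] carr[OF E] ij by simp
    then show ?case using insert by (simp add: lin_coeff_def mult.commute)
  qed
  from this[of "{..<l} \<times> {..<l}"] have "S (part ({..<l} \<times> {..<l})) $$ (i, j)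
      = (\<Sum>p\<in>{..<l} \<times> {..<l}. lin_coeff l S i j p * W $$ p)" by simp
  moreover have "part ({..<l} \<times> {..<l}) = W" using W by (intro eq_matI) (auto simp: part_def)
  ultimately show ?thesis by simp
qed

lemma pos_linear_entries:
  assumes "pos_linear l m S" "W \<in> carrier_mat l l" "i < m" "j < m"
  shows "S W $$ (i, j) = (\<Sum>p\<in>{..<l} \<times> {..<l}. lin_coeff l S i j p * W $$ p)"
  using assms by (intro linear_map_entries) (auto simp: pos_linear_def)

lemma pos_linear_diff:
  assumes S: "pos_linear l m S" and V: "V \<in> carrier_mat l l" and W: "W \<in> carrier_mat l l"
  shows "S (V - W) = S V - S W"
proof -
  have "V - W = V + (-1) \<cdot>\<^sub>m W" using V W by auto
  moreover have "S (V + (-1) \<cdot>\<^sub>m W) = S V + S ((-1) \<cdot>\<^sub>m W)" "S ((-1) \<cdot>\<^sub>m W) = (-1) \<cdot>\<^sub>m S W"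
    using S V W by (auto simp: pos_linear_def)
  moreover have "S V \<in> carrier_mat m m" "S W \<in> carrier_mat m m" using S V W by (auto simp: pos_linear_def)
  ultimately show ?thesis by auto
qed

text \<open>The point is closure under determinants and adjugates, hence measurability and holomorphy of
  the matrix inverse.\<close>

locale function_algebra =
  fixes Q :: "('x \<Rightarrow> complex) \<Rightarrow> bool"
  assumes const: "Q (\<lambda>_. c)"
    and add: "Q f \<Longrightarrow> Q g \<Longrightarrow> Q (\<lambda>x. f x + g x)"
    and mult: "Q f \<Longrightarrow> Q g \<Longrightarrow> Q (\<lambda>x. f x * g x)"
begin

lemma sum: "(\<And>i. i \<in> I \<Longrightarrow> Q (f i)) \<Longrightarrow> Q (\<lambda>x. \<Sum>i\<in>I. f i x)"
proof (induction I rule: infinite_finite_induct)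
  case (insert i I)
  then show ?case using add[of "f i" "\<lambda>x. \<Sum>i\<in>I. f i x"] by simp
qed (simp_all add: const)

lemma prod: "(\<And>i. i \<in> I \<Longrightarrow> Q (f i)) \<Longrightarrow> Q (\<lambda>x. \<Prod>i\<in>I. f i x)"
proof (induction I rule: infinite_finite_induct)
  case (insert i I)
  then show ?case using mult[of "f i" "\<lambda>x. \<Prod>i\<in>I. f i x"] by simp
qed (simp_all add: const)

lemma det:
  assumes "\<And>x. X x \<in> carrier_mat n n" "\<And>i j. i < n \<Longrightarrow> j < n \<Longrightarrow> Q (\<lambda>x. X x $$ (i, j))"
  shows "Q (\<lambda>x. det (X x))"
proof -
  have "det (X x) = (\<Sum>p | p permutes {0..<n}. signof p * (\<Prod>i = 0..<n. X x $$ (i, p i)))" for x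
    using det_def'[OF assms(1)] by simp
  moreover have "Q (\<lambda>x. \<Sum>p | p permutes {0..<n}. signof p * (\<Prod>i = 0..<n. X x $$ (i, p i)))"
  proof (intro sum mult prod const assms(2))
    fix p i assume "p \<in> {p. p permutes {0..<n}}" "i \<in> {0..<n}"
    then show "p i < n" "i < n" using permutes_in_image[of p "{0..<n}" i] by auto
  qed
  ultimately show ?thesis by simp
qed

lemma adj_mat:
  assumes X: "\<And>x. X x \<in> carrier_mat n n" "\<And>i j. i < n \<Longrightarrow> j < n \<Longrightarrow> Q (\<lambda>x. X x $$ (i, j))"
    and ij: "i < n" "j < n"
  shows "Q (\<lambda>x. adj_mat (X x) $$ (i, j))"
proof -
  have "adj_mat (X x) $$ (i, j) = (-1) ^ (j + i) * det (mat_delete (X x) j i)" for x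
    using X(1)[of x] ij by (simp add: adj_mat_def cofactor_def)
  moreover have "Q (\<lambda>x. (-1) ^ (j + i) * det (mat_delete (X x) j i))"
  proof (intro mult const det[of _ "n - 1"])
    show "mat_delete (X x) j i \<in> carrier_mat (n - 1) (n - 1)" for x
      using X(1)[of x] by (simp add: mat_delete_def)
    fix a b assume ab: "a < n - 1" "b < n - 1"
    define a' b' where "a' = (if a < j then a else Suc a)" and "b' = (if b < i then b else Suc b)"
    have "a' < n" "b' < n" using ab by (auto simp: a'_def b'_def)
    moreover have "mat_delete (X x) j i $$ (a, b) = X x $$ (a', b')" for x
      using X(1)[of x] ab by (simp add: mat_delete_def a'_def b'_def)
    ultimately show "Q (\<lambda>x. mat_delete (X x) j i $$ (a, b))" using X(2) by simp
  qed
  ultimately show ?thesis by simp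
qed

end

interpretation hol_alg: function_algebra "\<lambda>f. f holomorphic_on ball (0 :: complex) 1"
  by unfold_locales (auto intro: holomorphic_intros)

lemma measurable_function_algebra: "function_algebra (\<lambda>f. f \<in> borel_measurable N)"
  by unfold_locales auto

lemma minv_measurable:
  assumes X: "\<And>x. x \<in> space N \<Longrightarrow> X x \<in> carrier_mat n n"
      "\<And>i j. i < n \<Longrightarrow> j < n \<Longrightarrow> (\<lambda>x. X x $$ (i, j)) \<in> borel_measurable N"
    and ij: "i < n" "j < n"
  shows "(\<lambda>x. minv (X x) $$ (i, j)) \<in> borel_measurable N" "(\<lambda>x. det (X x)) \<in> borel_measurable N"
proof -
  interpret function_algebra "\<lambda>f. f \<in> borel_measurable N" by (rule measurable_function_algebra)
  \<comment> \<open>The closure lemmas for determinants ask for the right dimensions at every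
    argument, whereas X is controlled only on the space; the zero matrix fills in elsewhere.\<close>
  define Y where "Y x = (if x \<in> space N then X x else 0\<^sub>m n n)" for x
  have Yc: "Y x \<in> carrier_mat n n" for x using X(1) by (simp add: Y_def)
  have Ym: "(\<lambda>x. Y x $$ (i, j)) \<in> borel_measurable N" if "i < n" "j < n" for i j
    using X(2)[OF that] by (rule measurable_cong[THEN iffD1, rotated]) (simp add: Y_def)
  have "(\<lambda>x. Determinant.det (Y x)) \<in> borel_measurable N" by (rule det[OF Yc Ym])
  then show "(\<lambda>x. Determinant.det (X x)) \<in> borel_measurable N"
    by (rule measurable_cong[THEN iffD1, rotated]) (simp add: Y_def)
  have "(\<lambda>x. inverse (Determinant.det (Y x)) * Determinant.adj_mat (Y x) $$ (i, j)) \<in> borel_measurable N"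
    by (intro borel_measurable_times borel_measurable_inverse det[OF Yc Ym] adj_mat[OF Yc Ym ij])
  then show "(\<lambda>x. minv (X x) $$ (i, j)) \<in> borel_measurable N"
  proof (rule measurable_cong[THEN iffD1, rotated])
    fix x assume x: "x \<in> space N"
    show "inverse (Determinant.det (Y x)) * Determinant.adj_mat (Y x) $$ (i, j) = minv (X x) $$ (i, j)"
      using x ij Determinant.adj_mat(1)[OF X(1)[OF x]] by (simp add: Y_def minv_eq[OF X(1)[OF x]])
  qed
qed

lemma minv_holomorphic:
  assumes X: "\<And>x. x \<in> ball 0 1 \<Longrightarrow> X x \<in> carrier_mat n n"
      "\<And>i j. i < n \<Longrightarrow> j < n \<Longrightarrow> (\<lambda>x. X x $$ (i, j)) holomorphic_on ball 0 1"
    and d: "\<And>x. x \<in> ball 0 1 \<Longrightarrow> det (X x) \<noteq> 0" and ij: "i < n" "j < n"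
  shows "(\<lambda>x. minv (X x) $$ (i, j)) holomorphic_on ball 0 1"
proof -
  define Y where "Y x = (if x \<in> ball 0 1 then X x else 0\<^sub>m n n)" for x
  have Yc: "Y x \<in> carrier_mat n n" for x using X(1) by (simp add: Y_def)
  have Yh: "(\<lambda>x. Y x $$ (i, j)) holomorphic_on ball 0 1" if "i < n" "j < n" for i j
    by (rule holomorphic_transform[OF X(2)[OF that]]) (simp add: Y_def)
  have Yd: "Determinant.det (Y x) \<noteq> 0" if "x \<in> ball 0 1" for x using d[OF that] that by (simp add: Y_def)
  have "(\<lambda>x. inverse (Determinant.det (Y x)) * Determinant.adj_mat (Y x) $$ (i, j)) holomorphic_on ball 0 1"
    by (intro holomorphic_on_mult holomorphic_on_inverse hol_alg.det[OF Yc Yh] hol_alg.adj_mat[OF Yc Yh ij] Yd)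
  then show ?thesis
  proof (rule holomorphic_transform)
    fix x :: complex assume x: "x \<in> ball 0 1"
    show "inverse (Determinant.det (Y x)) * Determinant.adj_mat (Y x) $$ (i, j) = minv (X x) $$ (i, j)"
      using x ij Determinant.adj_mat(1)[OF X(1)[OF x]] by (simp add: Y_def minv_eq[OF X(1)[OF x]])
  qed
qed

text \<open>The fixed-point map \<open>W \<mapsto> (EL - S W - z \<Lambda> - \<i>\<tau>)\<^sup>-\<^sup>1\<close> of the regularized equation maps the
  bounded part of the half-space \<open>\<Im> W \<ge> 0\<close> strictly inside itself, with constants that do not
  depend on the dimension.\<close>

locale regularized_dyson =
  fixes n d l :: nat and EL :: "real mat" and S :: "complex mat \<Rightarrow> complex mat"
    and \<tau> s0 e0 :: real and z :: complex
  assumes dim: "n + d = l"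
    and EL: "EL \<in> carrier_mat l l" "transpose_mat EL = EL" "spec_norm (cmat EL) \<le> e0"
    and S: "pos_linear l l S" "\<And>W. W \<in> carrier_mat l l \<Longrightarrow> spec_norm (S W) \<le> s0 * spec_norm W"
    and pos: "0 < s0" "0 \<le> e0" "0 < \<tau>" and z: "z \<in> uhp"
begin

definition X :: "complex mat \<Rightarrow> complex mat" where
  "X W = pencil n d (cmat EL - S W) \<tau> z"

text \<open>The three constants are matched. Inverses have norm at most \<open>1 / \<tau>\<close>,
  and the extra 1 in m leaves room for a perturbation of size \<open>\<epsilon>\<close>; K bounds
  the norm of \<open>X W\<close> on the domain; \<open>\<tau>\<close> / K^2 is then the guaranteed
  imaginary part of the inverse, which a perturbation of size \<open>\<epsilon>\<close> cannot
  exhaust.\<close>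

definition m :: real where "m = 1 / \<tau> + 1"

definition K :: real where "K = e0 + s0 * m + cmod z + \<tau>"

definition \<epsilon> :: real where "\<epsilon> = min 1 (\<tau> / K\<^sup>2)"

definition dom :: "complex mat set" where
  "dom = {W \<in> carrier_mat l l. (\<forall>v \<in> carrier_vec l. 0 \<le> Im ((W *\<^sub>v v) \<bullet>c v)) \<and> spec_norm W \<le> m}"

lemma m_pos: "0 < m" and K_pos: "0 < K" and eps_pos: "0 < \<epsilon>"
proof -
  show m: "0 < m" using pos by (simp add: m_def add_pos_pos)
  show K: "0 < K" unfolding K_def using pos m by (intro add_nonneg_pos add_nonneg_nonneg) auto
  then show "0 < \<epsilon>" using pos by (simp add: \<epsilon>_def)
qed

lemma S_carrier: "W \<in> carrier_mat l l \<Longrightarrow> S W \<in> carrier_mat l l"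
  using S(1) by (simp add: pos_linear_def)

lemma X_carrier: "W \<in> carrier_mat l l \<Longrightarrow> X W \<in> carrier_mat l l"
  using pencil_carrier[of "cmat EL - S W" n d \<tau> z] S_carrier by (simp add: X_def dim)

lemma X_dissipative:
  assumes W: "W \<in> carrier_mat l l" "\<And>v. v \<in> carrier_vec l \<Longrightarrow> 0 \<le> Im ((W *\<^sub>v v) \<bullet>c v)"
  shows "dissipative l \<tau> (X W)"
proof -
  have SW: "S W \<in> carrier_mat l l" by (rule S_carrier[OF W(1)])
  have E: "cmat EL \<in> carrier_mat l l" using EL by simp
  have "dissipative (n + d) \<tau> (pencil n d (cmat EL - S W) \<tau> z)"
  proof (rule pencil_dissipative[OF _ z])
    show "cmat EL - S W \<in> carrier_mat (n + d) (n + d)" using SW by (simp add: dim)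
    fix v :: "complex Matrix.vec" assume "v \<in> carrier_vec (n + d)"
    then have v: "v \<in> carrier_vec l" by (simp add: dim)
    have "((cmat EL - S W) *\<^sub>v v) \<bullet>c v = (cmat EL *\<^sub>v v) \<bullet>c v - (S W *\<^sub>v v) \<bullet>c v"
      using E SW v by (simp add: minus_mult_distrib_mat_vec[of _ l l] cscalar_distrib(2)[of "cmat EL *\<^sub>v v" l "S W *\<^sub>v v"])
    moreover have "Im ((cmat EL *\<^sub>v v) \<bullet>c v) = 0"
      by (rule hermitian_form[OF E adjoint_cmat[OF EL(1,2)] v])
    moreover have "0 \<le> Im ((S W *\<^sub>v v) \<bullet>c v)"
      using W psd_im_part_iff[OF W(1)] by (intro pos_linear_im[OF S(1)] v) auto
    ultimately show "Im (((cmat EL - S W) *\<^sub>v v) \<bullet>c v) \<le> 0" by simp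
  qed
  then show ?thesis by (simp add: X_def dim)
qed

lemma X_norm:
  assumes "W \<in> carrier_mat l l" "spec_norm W \<le> m"
  shows "spec_norm (X W) \<le> K"
proof -
  have E: "cmat EL \<in> carrier_mat l l" using EL by simp
  have SW: "S W \<in> carrier_mat l l" by (rule S_carrier[OF assms(1)])
  have "spec_norm (X W) \<le> spec_norm (cmat EL - S W) + cmod z + \<tau>"
    unfolding X_def using SW pos by (intro spec_norm_pencil) (auto simp: dim)
  also have "spec_norm (cmat EL - S W) \<le> spec_norm (cmat EL) + spec_norm (S W)"
    by (rule spec_norm_minus[OF E SW])
  also have "spec_norm (S W) \<le> s0 * m"
    using S(2)[OF assms(1)] assms(2) pos by (auto intro: order_trans mult_left_mono)
  finally show ?thesis using EL(3) by (simp add: K_def)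
qed

lemma dissipative_dom: "W \<in> dom \<Longrightarrow> dissipative l \<tau> (X W)"
  by (rule X_dissipative) (auto simp: dom_def)

text \<open>Both constraints of \<open>dom\<close> hold with a margin after one step: the norm has
  the margin 1, and the imaginary part the margin \<open>\<tau>\<close> / K^2, because v has length
  at most K times that of \<open>minv (X W) *\<^sub>v v\<close>.\<close>

lemma dom_step:
  assumes W: "W \<in> dom" and V: "V \<in> carrier_mat l l" "spec_norm V \<le> \<epsilon>"
  shows "minv (X W) + V \<in> dom"
proof -
  have Wc: "W \<in> carrier_mat l l" "\<And>v. v \<in> carrier_vec l \<Longrightarrow> 0 \<le> Im ((W *\<^sub>v v) \<bullet>c v)" "spec_norm W \<le> m"
    using W by (auto simp: dom_def)
  note R = dissipative_minv[OF dissipative_dom[OF W] pos(3)]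
  have Mc: "minv (X W) \<in> carrier_mat l l" using X_carrier[OF Wc(1)] by simp
  have "spec_norm (minv (X W) + V) \<le> 1 / \<tau> + \<epsilon>"
    using spec_norm_triangle[OF Mc V(1)] R(1) V(2) by linarith
  also have "\<dots> \<le> m" by (simp add: m_def \<epsilon>_def)
  finally have "spec_norm (minv (X W) + V) \<le> m" .
  moreover have "0 \<le> Im (((minv (X W) + V) *\<^sub>v v) \<bullet>c v)" if v: "v \<in> carrier_vec l" for v
  proof -
    have "((minv (X W) + V) *\<^sub>v v) \<bullet>c v = (minv (X W) *\<^sub>v v) \<bullet>c v + (V *\<^sub>v v) \<bullet>c v"
      using Mc V v by (simp add: add_mult_distrib_mat_vec[of _ l l] cscalar_distrib(1)[of "minv (X W) *\<^sub>v v" l "V *\<^sub>v v"])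
    moreover have "- (\<epsilon> * (vnorm v)\<^sup>2) \<le> Im ((V *\<^sub>v v) \<bullet>c v)"
    proof -
      have "\<bar>Im ((V *\<^sub>v v) \<bullet>c v)\<bar> \<le> spec_norm V * vnorm v * vnorm v"
        by (rule order_trans[OF abs_Im_le_cmod spec_form[OF V(1) v v]])
      also have "\<dots> \<le> \<epsilon> * (vnorm v)\<^sup>2"
        using mult_right_mono[OF V(2), of "(vnorm v)\<^sup>2"] by (simp add: power2_eq_square mult.assoc)
      finally show ?thesis by linarith
    qed
    moreover have "\<epsilon> * (vnorm v)\<^sup>2 \<le> \<tau> * (vnorm (minv (X W) *\<^sub>v v))\<^sup>2"
    proof -
      have "vnorm v \<le> K * vnorm (minv (X W) *\<^sub>v v)"
        using R(3)[OF v] X_norm[OF Wc(1,3)] mult_right_mono[OF X_norm[OF Wc(1,3)], of "vnorm (minv (X W) *\<^sub>v v)"] by simp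
      then have "(vnorm v)\<^sup>2 \<le> K\<^sup>2 * (vnorm (minv (X W) *\<^sub>v v))\<^sup>2"
        using power_mono[of "vnorm v" "K * vnorm (minv (X W) *\<^sub>v v)" 2] by (simp add: power_mult_distrib)
      then have "\<tau> / K\<^sup>2 * (vnorm v)\<^sup>2 \<le> \<tau> * (vnorm (minv (X W) *\<^sub>v v))\<^sup>2"
        using pos K_pos by (simp add: field_simps)
      moreover have "\<epsilon> * (vnorm v)\<^sup>2 \<le> \<tau> / K\<^sup>2 * (vnorm v)\<^sup>2"
        by (intro mult_right_mono) (auto simp: \<epsilon>_def)
      ultimately show ?thesis by linarith
    qed
    ultimately show ?thesis using R(2)[OF v] by simp
  qed
  ultimately show ?thesis using Mc V by (simp add: dom_def)
qed

sublocale strict_self_map l dom "\<lambda>W. minv (X W)" m \<epsilon>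
proof
  fix V W s assume *: "V \<in> dom" "W \<in> dom" "0 \<le> s" "s \<le> (1 :: real)"
  then have c: "V \<in> carrier_mat l l" "W \<in> carrier_mat l l" by (auto simp: dom_def)
  let ?Y = "complex_of_real (1 - s) \<cdot>\<^sub>m V + complex_of_real s \<cdot>\<^sub>m W"
  have "spec_norm ?Y \<le> spec_norm (complex_of_real (1 - s) \<cdot>\<^sub>m V) + spec_norm (complex_of_real s \<cdot>\<^sub>m W)"
    using c by (intro spec_norm_triangle[of _ l l]) auto
  also have "\<dots> \<le> (1 - s) * spec_norm V + s * spec_norm W"
    using spec_norm_smult_le[OF c(1), of "complex_of_real (1 - s)"] spec_norm_smult_le[OF c(2), of "complex_of_real s"] *
    by (simp only: norm_of_real abs_of_nonneg diff_ge_0_iff_ge)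
  also have "\<dots> \<le> (1 - s) * m + s * m"
    using * by (intro add_mono mult_left_mono) (auto simp: dom_def)
  also have "\<dots> = m" by (simp add: algebra_simps)
  finally have "spec_norm ?Y \<le> m" .
  moreover have "0 \<le> Im ((?Y *\<^sub>v v) \<bullet>c v)" if v: "v \<in> carrier_vec l" for v
  proof -
    have "?Y *\<^sub>v v = complex_of_real (1 - s) \<cdot>\<^sub>v (V *\<^sub>v v) + complex_of_real s \<cdot>\<^sub>v (W *\<^sub>v v)"
      using c v by (simp add: add_mult_distrib_mat_vec[of _ l l] smult_mat_mult_vec[of _ l l])
    moreover have "V *\<^sub>v v \<in> carrier_vec l" "W *\<^sub>v v \<in> carrier_vec l" using c v by auto
    ultimately have "(?Y *\<^sub>v v) \<bullet>c v = complex_of_real (1 - s) * ((V *\<^sub>v v) \<bullet>c v) + complex_of_real s * ((W *\<^sub>v v) \<bullet>c v)"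
      using v by (simp add: cscalar_distrib[of _ l _ v])
    then have "Im ((?Y *\<^sub>v v) \<bullet>c v) = (1 - s) * Im ((V *\<^sub>v v) \<bullet>c v) + s * Im ((W *\<^sub>v v) \<bullet>c v)"
      by (simp add: of_real_diff[symmetric] del: of_real_diff)
    then show ?thesis using * v by (auto simp: dom_def)
  qed
  ultimately show "?Y \<in> dom" using c by (simp add: dom_def)
next
  \<comment> \<open>The entries of X are affine in those of the disc, Cramer's rule passes to the
    inverse, and dissipativity keeps the determinant away from zero on the whole disc.\<close>
  fix \<phi> i j assume \<phi>: "matrix_disc l dom \<phi>" and ij: "i < l" "j < l"
  have \<phi>d: "\<phi> \<zeta> \<in> carrier_mat l l" "\<phi> \<zeta> \<in> dom" if "\<zeta> \<in> ball 0 1" for \<zeta>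
    using \<phi> that by (auto simp: matrix_disc_def dom_def)
  show "(\<lambda>\<zeta>. minv (X (\<phi> \<zeta>)) $$ (i, j)) holomorphic_on ball 0 1"
  proof (rule minv_holomorphic[OF _ _ _ ij])
    fix \<zeta> :: complex assume \<zeta>: "\<zeta> \<in> ball 0 1"
    show "X (\<phi> \<zeta>) \<in> carrier_mat l l" by (rule X_carrier[OF \<phi>d(1)[OF \<zeta>]])
    show "Determinant.det (X (\<phi> \<zeta>)) \<noteq> 0" by (rule dissipative_det[OF dissipative_dom[OF \<phi>d(2)[OF \<zeta>]] pos(3)])
  next
    fix a b assume ab: "a < l" "b < l"
    let ?c = "cmat EL $$ (a, b) - z * Lam n d $$ (a, b) - \<i> * complex_of_real \<tau> * 1\<^sub>m l $$ (a, b)"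
    have "(\<lambda>\<zeta>. ?c - (\<Sum>p\<in>{..<l} \<times> {..<l}. lin_coeff l S a b p * \<phi> \<zeta> $$ p)) holomorphic_on ball 0 1"
      using \<phi> by (intro holomorphic_intros) (auto simp: matrix_disc_def)
    then show "(\<lambda>\<zeta>. X (\<phi> \<zeta>) $$ (a, b)) holomorphic_on ball 0 1"
    proof (rule holomorphic_transform)
      fix \<zeta> :: complex assume \<zeta>: "\<zeta> \<in> ball 0 1"
      have "S (\<phi> \<zeta>) $$ (a, b) = (\<Sum>p\<in>{..<l} \<times> {..<l}. lin_coeff l S a b p * \<phi> \<zeta> $$ p)"
        by (rule pos_linear_entries[OF S(1) \<phi>d(1)[OF \<zeta>] ab])
      then show "?c - (\<Sum>p\<in>{..<l} \<times> {..<l}. lin_coeff l S a b p * \<phi> \<zeta> $$ p) = X (\<phi> \<zeta>) $$ (a, b)"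
        using ab S_carrier[OF \<phi>d(1)[OF \<zeta>]] EL(1) carrier_matD[OF Lam_carrier[of n d]]
        by (simp add: X_def pencil_def dim)
    qed
  qed
next
  fix W V assume "W \<in> dom" "V \<in> carrier_mat l l" "spec_norm V \<le> \<epsilon>"
  then show "minv (X W) + V \<in> dom" by (rule dom_step)
qed (auto simp: dom_def X_carrier m_pos eps_pos)

text \<open>The threshold below which the defect of a perturbed solution corresponds to a parameter
  a of at most 1/4, the range of the disc argument. Like \<open>stability_const\<close> it involves
  only \<open>\<tau>\<close>, \<open>s0\<close>, \<open>e0\<close> and \<open>z\<close>, so it may
  be chosen before the dimension.\<close>

definition gap :: real where "gap = \<tau> ^ 3 * \<epsilon> / (4 * s0)"

definition stability_const :: real where
  "stability_const = 1 / \<tau> + 2 * m * (s0 / (\<tau> ^ 3 * \<epsilon>)) * ((1 + t) / t)"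

lemma gap_pos: "0 < gap"
  using pos eps_pos by (simp add: gap_def)

text \<open>F may lie on the boundary of \<open>dom\<close>, so it is first replaced by its image x
  = \<open>minv (X F)\<close>, which lies \<open>\<epsilon>\<close> deep. The defect E gives F - x =
  x E, of norm at most \<open>\<delta> / \<tau>\<close>. The resolvent identity then bounds the
  distance from x to its own image by two more factors \<open>1 / \<tau>\<close> and one factor
  \<open>s0\<close>; hence the cube in \<open>a\<close>. The summands of
  \<open>stability_const\<close> are the costs of these two passages.\<close>

theorem stability:
  assumes F: "F \<in> carrier_mat l l" "\<And>v. v \<in> carrier_vec l \<Longrightarrow> 0 \<le> Im ((F *\<^sub>v v) \<bullet>c v)" "spec_norm F \<le> 1 / \<tau>"
    and approx: "E \<in> carrier_mat l l" "X F * F = 1\<^sub>m l + E" "spec_norm E \<le> \<delta>"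
    and W: "W \<in> carrier_mat l l" "\<And>v. v \<in> carrier_vec l \<Longrightarrow> 0 \<le> Im ((W *\<^sub>v v) \<bullet>c v)" "X W * W = 1\<^sub>m l"
    and \<delta>: "0 < \<delta>" "\<delta> \<le> gap"
  shows "spec_norm (F - W) \<le> stability_const * \<delta>"
proof -
  define a where "a = s0 * \<delta> / (\<tau> ^ 3 * \<epsilon>)"
  have a: "0 < a" "a \<le> 1/4" using \<delta> pos eps_pos by (auto simp: a_def gap_def field_simps)
  have DW: "dissipative l \<tau> (X W)" by (rule X_dissipative[OF W(1)]) (rule W(2))
  have dW: "det (X W) \<noteq> 0" by (rule dissipative_det[OF DW pos(3)])
  have W_eq: "W = minv (X W)" by (rule minv_unique[OF X_carrier[OF W(1)] W(1) dW W(3)])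
  have "spec_norm W \<le> 1 / \<tau>"
    using dissipative_minv(1)[OF DW pos(3)] W_eq by simp
  then have Wd: "W \<in> dom" using W by (simp add: dom_def m_def)
  have Fd: "F \<in> dom" using F by (simp add: dom_def m_def)
  define x where "x = minv (X F)"
  have dF: "det (X F) \<noteq> 0" by (rule dissipative_det[OF dissipative_dom[OF Fd] pos(3)])
  have x\<tau>: "spec_norm x \<le> 1 / \<tau>"
    unfolding x_def by (rule dissipative_minv(1)[OF dissipative_dom[OF Fd] pos(3)])
  have xc: "x \<in> carrier_mat l l" using X_carrier[OF F(1)] by (simp add: x_def)
  have xd: "x \<in> dom" unfolding x_def by (rule h_in[OF Fd])
  have xi: "x \<in> inner_part \<epsilon>" unfolding x_def by (rule h_inner[OF Fd])
  have Wi: "W \<in> inner_part \<epsilon>" using h_inner[OF Wd] W_eq by simp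
  have xE: "F - x = x * E"
  proof -
    have "F = (x * X F) * F"
      using minv_inverse(2)[OF X_carrier[OF F(1)] dF] F(1) by (simp add: x_def left_mult_one_mat[of _ l l])
    also have "\<dots> = x * (X F * F)" using xc F(1) X_carrier by (intro assoc_mult_mat) auto
    also have "\<dots> = x * 1\<^sub>m l + x * E"
      unfolding approx(2) using xc approx(1) by (intro mult_add_distrib_mat) auto
    also have "x * 1\<^sub>m l = x" using xc by simp
    finally have F_eq: "F = x + x * E" .
    have "x * E \<in> carrier_mat l l" using xc approx(1) by simp
    then have "x + x * E - x = x * E" using xc by (intro eq_matI) auto
    then show ?thesis using F_eq by simp
  qed
  have Fx: "spec_norm (F - x) \<le> \<delta> / \<tau>"
  proof -
    have "spec_norm (F - x) \<le> spec_norm x * spec_norm E" unfolding xE by (rule spec_norm_mult[OF xc approx(1)])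
    also have "\<dots> \<le> 1 / \<tau> * \<delta>" using x\<tau> approx(3) pos by (intro mult_mono) auto
    finally show ?thesis by simp
  qed
  have near: "spec_norm (minv (X x) - x) \<le> a * \<epsilon>"
  proof -
    have dx: "det (X x) \<noteq> 0" by (rule dissipative_det[OF dissipative_dom[OF xd] pos(3)])
    have "minv (X x) - x = minv (X x) * (X F - X x) * x"
      by (rule minv_diff[OF X_carrier[OF xc] dx X_carrier[OF F(1)] dF, folded x_def])
    also have "X F - X x = S x - S F"
      using S_carrier[OF xc] S_carrier[OF F(1)] EL(1) carrier_matD[OF Lam_carrier[of n d]]
      by (intro eq_matI) (auto simp: X_def pencil_def dim)
    also have "\<dots> = S (x - F)" by (rule pos_linear_diff[OF S(1) xc F(1), symmetric])
    finally have eq: "minv (X x) - x = minv (X x) * S (x - F) * x" .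
    have c1: "minv (X x) \<in> carrier_mat l l" "S (x - F) \<in> carrier_mat l l"
      using X_carrier[OF xc] S_carrier[of "x - F"] F(1) by auto
    have "spec_norm (minv (X x) - x) \<le> spec_norm (minv (X x)) * spec_norm (S (x - F)) * spec_norm x"
      unfolding eq using c1 xc by (intro order_trans[OF spec_norm_mult[of _ l l _ l]] mult_right_mono spec_norm_mult) auto
    also have "\<dots> \<le> (1 / \<tau>) * (s0 * (\<delta> / \<tau>)) * (1 / \<tau>)"
    proof (intro mult_mono)
      show "spec_norm (minv (X x)) \<le> 1 / \<tau>" by (rule dissipative_minv(1)[OF dissipative_dom[OF xd] pos(3)])
      have "spec_norm (S (x - F)) \<le> s0 * spec_norm (x - F)" using F(1) by (intro S(2)) simp
      also have "\<dots> \<le> s0 * (\<delta> / \<tau>)"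
        using Fx pos spec_norm_minus_commute[OF xc F(1)] by (intro mult_left_mono) auto
      finally show "spec_norm (S (x - F)) \<le> s0 * (\<delta> / \<tau>)" .
    qed (use x\<tau> pos \<delta> in auto)
    also have "\<dots> = a * \<epsilon>" using eps_pos by (simp add: a_def power3_eq_cube)
    finally show ?thesis .
  qed
  have "spec_norm (x - W) \<le> 2 * m * a * ((1 + t) / t)"
    by (rule approximate_fixed_point[OF xi Wi eps_pos W_eq[symmetric] a near])
  moreover have "spec_norm (F - W) \<le> spec_norm (F - x) + spec_norm (x - W)"
    by (rule spec_norm_triangle_diff[OF F(1) xc W(1)])
  ultimately have "spec_norm (F - W) \<le> \<delta> / \<tau> + 2 * m * a * ((1 + t) / t)" using Fx by linarith
  also have "\<dots> = stability_const * \<delta>"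
    by (simp add: stability_const_def a_def algebra_simps add_divide_distrib)
  finally show ?thesis .
qed

end

section \<open>Concentration of Gaussian random matrices\<close>

lemma sum_half_powers: "(\<Sum>j\<in>{- int c..int c}. (1/2 :: real) ^ nat \<bar>j\<bar>) = 3 - 2 * (1/2) ^ c"
proof (induction c)
  case (Suc c)
  have "{- int (Suc c)..int (Suc c)} = insert (int (Suc c)) (insert (- int (Suc c)) {- int c..int c})"
    by auto
  then have "(\<Sum>j\<in>{- int (Suc c)..int (Suc c)}. (1/2 :: real) ^ nat \<bar>j\<bar>)
      = (1/2) ^ Suc c + ((1/2) ^ Suc c + (\<Sum>j\<in>{- int c..int c}. (1/2) ^ nat \<bar>j\<bar>))"
    by simp (simp only: nat_add_distrib nat_int zero_le_one of_nat_0_le_iff nat_one_as_int[symmetric] Suc_eq_plus1[symmetric], simp)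
  then show ?case by (simp add: Suc)
qed simp

text \<open>Integer points of an l1-ball. The l1-norm is used because its generating function is a
  product over coordinates; Cauchy-Schwarz places the rescaled Euclidean ball inside.\<close>

definition lattice_points :: "nat \<Rightarrow> nat \<Rightarrow> (nat \<Rightarrow> int) set" where
  "lattice_points N c = {k \<in> {..<N} \<rightarrow>\<^sub>E UNIV. (\<Sum>i<N. \<bar>k i\<bar>) \<le> int c}"

text \<open>Counting by the generating function \<open>\<Sum> 2\<^bsup>-|k|\<^esup> \<le> 3\<^sup>N\<close>.\<close>

lemma lattice_points_card:
  "finite (lattice_points N c)" "real (card (lattice_points N c)) \<le> 3 ^ N * 2 ^ c"
proof -
  let ?T = "lattice_points N c" and ?B = "{..<N} \<rightarrow>\<^sub>E {- int c..int c}"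
  have sub: "?T \<subseteq> ?B"
  proof
    fix k assume k: "k \<in> ?T"
    have "\<bar>k i\<bar> \<le> int c" if "i < N" for i
      using member_le_sum[of i "{..<N}" "\<lambda>i. \<bar>k i\<bar>"] that k by (auto simp: lattice_points_def)
    then have "\<forall>i \<in> {..<N}. k i \<in> {- int c..int c}" by (auto simp: abs_le_iff minus_le_iff)
    moreover have "k \<in> extensional {..<N}" using k by (simp add: lattice_points_def PiE_iff)
    ultimately show "k \<in> ?B" unfolding PiE_iff by (rule conjI)
  qed
  have finB: "finite ?B" by (intro finite_PiE) auto
  then show "finite ?T" by (rule finite_subset[OF sub])
  have w: "1 \<le> 2 ^ c * (\<Prod>i<N. (1/2 :: real) ^ nat \<bar>k i\<bar>)" if "k \<in> ?T" for k
  proof -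
    have "int (\<Sum>i<N. nat \<bar>k i\<bar>) \<le> int c" using that by (simp add: lattice_points_def)
    then have le: "(\<Sum>i<N. nat \<bar>k i\<bar>) \<le> c" by (simp only: of_nat_le_iff)
    have "(1/2 :: real) ^ c \<le> (1/2) ^ (\<Sum>i<N. nat \<bar>k i\<bar>)" by (rule power_decreasing[OF le]) auto
    also have "\<dots> = (\<Prod>i<N. (1/2 :: real) ^ nat \<bar>k i\<bar>)" by (rule power_sum)
    finally show ?thesis by (simp add: field_simps)
  qed
  have "real (card ?T) = (\<Sum>k\<in>?T. 1)" by simp
  also have "\<dots> \<le> (\<Sum>k\<in>?T. 2 ^ c * (\<Prod>i<N. (1/2 :: real) ^ nat \<bar>k i\<bar>))" by (intro sum_mono w)
  also have "\<dots> \<le> (\<Sum>k\<in>?B. 2 ^ c * (\<Prod>i<N. (1/2 :: real) ^ nat \<bar>k i\<bar>))"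
    by (rule sum_mono2[OF finB sub]) (intro mult_nonneg_nonneg prod_nonneg ballI, simp_all)
  also have "\<dots> = 2 ^ c * (\<Prod>i<N. \<Sum>j\<in>{- int c..int c}. (1/2 :: real) ^ nat \<bar>j\<bar>)"
  proof -
    have "(\<Prod>i<N. \<Sum>j\<in>{- int c..int c}. (1/2 :: real) ^ nat \<bar>j\<bar>) = (\<Sum>k\<in>?B. \<Prod>i<N. (1/2) ^ nat \<bar>k i\<bar>)"
      by (rule prod_sum_PiE) simp_all
    then show ?thesis by (simp only: sum_distrib_left)
  qed
  also have "\<dots> \<le> 2 ^ c * (\<Prod>i<N. 3)"
  proof (intro mult_left_mono prod_mono ballI conjI)
    show "(\<Sum>j\<in>{- int c..int c}. (1/2 :: real) ^ nat \<bar>j\<bar>) \<le> 3" unfolding sum_half_powers by simp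
    show "0 \<le> (\<Sum>j\<in>{- int c..int c}. (1/2 :: real) ^ nat \<bar>j\<bar>)" by (rule sum_nonneg) simp
  qed simp
  finally show "real (card ?T) \<le> 3 ^ N * 2 ^ c" by (simp add: mult.commute)
qed

text \<open>Rounds towards zero, so that no coordinate grows in modulus and the rounded vector stays
  in the unit ball.\<close>

definition int_trunc :: "real \<Rightarrow> int" where
  "int_trunc r = (if r \<ge> 0 then \<lfloor>r\<rfloor> else \<lceil>r\<rceil>)"

lemma int_trunc: "\<bar>real_of_int (int_trunc r)\<bar> \<le> \<bar>r\<bar>" "\<bar>r - real_of_int (int_trunc r)\<bar> \<le> 1"
proof -
  show "\<bar>real_of_int (int_trunc r)\<bar> \<le> \<bar>r\<bar>"
  proof (cases "0 \<le> r")
    case True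
    then have "0 \<le> \<lfloor>r\<rfloor>" by simp
    then show ?thesis using True by (simp add: int_trunc_def)
  next
    case False
    then have "\<lceil>r\<rceil> \<le> 0" by (simp add: ceiling_le_zero)
    then have "\<bar>real_of_int \<lceil>r\<rceil>\<bar> = - real_of_int \<lceil>r\<rceil>" by simp
    then show ?thesis using False le_of_int_ceiling[of r] by (simp add: int_trunc_def)
  qed
  have "\<bar>r - real_of_int \<lfloor>r\<rfloor>\<bar> \<le> 1" "\<bar>r - real_of_int \<lceil>r\<rceil>\<bar> \<le> 1" by linarith+
  then show "\<bar>r - real_of_int (int_trunc r)\<bar> \<le> 1" by (simp add: int_trunc_def)
qed

text \<open>There are 2 l real coordinates, each rounded with error at most the mesh, so the total
  Euclidean error is sqrt (2 l) times the mesh, that is 1/4. A unit vector has l1-norm at most sqrt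
  (2 l), which is 8 l times the mesh: hence the radius in \<open>vec_net\<close>.\<close>

definition mesh :: "nat \<Rightarrow> real" where
  "mesh l = 1 / (4 * sqrt (2 * real l))"

definition lattice_vec :: "nat \<Rightarrow> (nat \<Rightarrow> int) \<Rightarrow> complex Matrix.vec" where
  "lattice_vec l k = Matrix.vec l (\<lambda>i. Complex (mesh l * k i) (mesh l * k (l + i)))"

definition vec_net :: "nat \<Rightarrow> complex Matrix.vec set" where
  "vec_net l = {u \<in> lattice_vec l ` lattice_points (2 * l) (8 * l). vnorm u \<le> 1}"

lemma vec_net_carrier: "u \<in> vec_net l \<Longrightarrow> u \<in> carrier_vec l" "u \<in> vec_net l \<Longrightarrow> vnorm u \<le> 1"
  by (auto simp: vec_net_def lattice_vec_def)

lemma vec_net_finite: "finite (vec_net l)"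
  unfolding vec_net_def using lattice_points_card(1) by simp

text \<open>3^(2 l) times 2^(8 l) is 2304^l, and 2304 is below 2^12, hence below e^12.\<close>

lemma vec_net_card: "real (card (vec_net l)) \<le> exp (12 * real l)"
proof -
  have "card (vec_net l) \<le> card (lattice_points (2 * l) (8 * l))"
    unfolding vec_net_def
    by (rule order_trans[OF card_mono card_image_le]) (auto intro: lattice_points_card(1))
  then have "real (card (vec_net l)) \<le> 3 ^ (2 * l) * 2 ^ (8 * l)"
    using lattice_points_card(2)[of "2 * l" "8 * l"] by linarith
  also have "\<dots> = 2304 ^ l" by (simp add: power_mult power_mult_distrib[symmetric])
  also have "\<dots> \<le> (exp 12) ^ l"
  proof (rule power_mono)
    have "(2304 :: real) \<le> 2 ^ 12" by simp
    also have "\<dots> \<le> (exp 1) ^ 12" using exp_ge_add_one_self[of 1] by (intro power_mono) auto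
    also have "\<dots> = exp (12 :: real)" by (simp add: exp_of_nat_mult[symmetric])
    finally show "(2304 :: real) \<le> exp 12" .
  qed simp
  also have "\<dots> = exp (12 * real l)" by (simp add: exp_of_nat_mult[symmetric] mult.commute)
  finally show ?thesis .
qed

lemma vec_net_approx:
  assumes u: "u \<in> carrier_vec l" "vnorm u \<le> 1" and l: "0 < l"
  shows "\<exists>u' \<in> vec_net l. vnorm (u - u') \<le> 1/4"
proof -
  let ?h = "mesh l"
  have h: "0 < ?h" using l by (simp add: mesh_def)
  define c where "c i = (if i < l then Re (u $ i) else Im (u $ (i - l)))" for i
  define k where "k = (\<lambda>i\<in>{..<2 * l}. int_trunc (c i / ?h))"
  have tr: "\<bar>?h * k i\<bar> \<le> \<bar>c i\<bar>" "\<bar>c i - ?h * k i\<bar> \<le> ?h" if "i < 2 * l" for i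
  proof -
    have k: "\<bar>real_of_int (k i)\<bar> \<le> \<bar>c i / ?h\<bar>" "\<bar>c i / ?h - real_of_int (k i)\<bar> \<le> 1"
      using that int_trunc[of "c i / ?h"] by (auto simp: k_def)
    have "\<bar>?h * k i\<bar> = ?h * \<bar>real_of_int (k i)\<bar>" "\<bar>?h * (c i / ?h)\<bar> = ?h * \<bar>c i / ?h\<bar>"
      "\<bar>?h * (c i / ?h - k i)\<bar> = ?h * \<bar>c i / ?h - k i\<bar>"
      using h by (simp_all only: abs_mult abs_of_pos)
    then have "\<bar>?h * k i\<bar> \<le> \<bar>?h * (c i / ?h)\<bar>" "\<bar>?h * (c i / ?h - k i)\<bar> \<le> ?h"
      using mult_left_mono[OF k(1) less_imp_le[OF h]] mult_left_mono[OF k(2) less_imp_le[OF h]] by (simp_all only: mult_1_right)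
    moreover have "?h * (c i / ?h) = c i" "?h * (c i / ?h - k i) = c i - ?h * k i"
      using h by (simp_all add: right_diff_distrib)
    ultimately show "\<bar>?h * k i\<bar> \<le> \<bar>c i\<bar>" "\<bar>c i - ?h * k i\<bar> \<le> ?h" by simp_all
  qed
  have split: "(\<Sum>i<2 * l. F i) = (\<Sum>i<l. F i + F (l + i))" for F :: "nat \<Rightarrow> real"
  proof -
    have "(\<Sum>i<2 * l. F i) = sum F {0..<l} + sum F {l..<l + l}"
      by (subst sum.atLeastLessThan_concat) (auto simp: atLeast0LessThan mult_2)
    also have "sum F {l..<l + l} = (\<Sum>i<l. F (l + i))"
      using sum.shift_bounds_nat_ivl[of F 0 l l] by (simp add: atLeast0LessThan add.commute)
    finally show ?thesis by (simp add: sum.distrib atLeast0LessThan)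
  qed
  have c2: "(\<Sum>i<2 * l. (c i)\<^sup>2) = (vnorm u)\<^sup>2"
    unfolding split using u by (simp add: vnorm_def sum_nonneg c_def cmod_power2)
  \<comment> \<open>Inserting the factor 1 prepares Cauchy-Schwarz, which bounds the l1-norm by sqrt
    (2 l) times the Euclidean norm.\<close>
  have "(\<Sum>i<2 * l. \<bar>c i\<bar>) = (\<Sum>i<2 * l. \<bar>c i\<bar> * \<bar>1\<bar>)" by simp
  also have "\<dots> \<le> L2_set c {..<2 * l} * L2_set (\<lambda>_. 1) {..<2 * l}" by (rule L2_set_mult_ineq)
  also have "\<dots> \<le> 1 * sqrt (2 * real l)"
    using u(2) c2 by (intro mult_mono) (auto simp: L2_set_def)
  finally have c1: "(\<Sum>i<2 * l. \<bar>c i\<bar>) \<le> sqrt (2 * real l)" by simp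
  have "?h * (\<Sum>i<2 * l. \<bar>real_of_int (k i)\<bar>) = (\<Sum>i<2 * l. \<bar>?h * k i\<bar>)"
    using h by (simp add: sum_distrib_left abs_mult)
  also have "\<dots> \<le> (\<Sum>i<2 * l. \<bar>c i\<bar>)" by (intro sum_mono tr) auto
  also have "\<dots> \<le> ?h * (8 * real l)"
  proof -
    have "?h * (8 * real l) = (2 * real l) / sqrt (2 * real l)" by (simp add: mesh_def)
    also have "\<dots> = sqrt (2 * real l)" by (rule real_div_sqrt) simp
    finally show ?thesis using c1 by (simp only:)
  qed
  finally have "(\<Sum>i<2 * l. \<bar>real_of_int (k i)\<bar>) \<le> 8 * real l" using h by simp
  then have "real_of_int (\<Sum>i<2 * l. \<bar>k i\<bar>) \<le> real_of_int (int (8 * l))" by simp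
  then have "(\<Sum>i<2 * l. \<bar>k i\<bar>) \<le> int (8 * l)" by (simp only: of_int_le_iff)
  then have kT: "k \<in> lattice_points (2 * l) (8 * l)" by (simp add: lattice_points_def k_def)
  define u' where "u' = lattice_vec l k"
  have entry: "cmod (u' $ i) \<le> cmod (u $ i)" "(cmod (u $ i - u' $ i))\<^sup>2 \<le> 2 * ?h\<^sup>2" if i: "i < l" for i
  proof -
    have "(cmod (u' $ i))\<^sup>2 = \<bar>?h * k i\<bar>\<^sup>2 + \<bar>?h * k (l + i)\<bar>\<^sup>2"
      using i by (simp add: u'_def lattice_vec_def cmod_power2)
    also have "\<dots> \<le> \<bar>c i\<bar>\<^sup>2 + \<bar>c (l + i)\<bar>\<^sup>2" using i by (intro add_mono power_mono tr) auto
    also have "\<dots> = (cmod (u $ i))\<^sup>2" using i by (simp add: c_def cmod_power2)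
    finally show "cmod (u' $ i) \<le> cmod (u $ i)" by (rule power2_le_imp_le) simp
    have "(cmod (u $ i - u' $ i))\<^sup>2 = \<bar>c i - ?h * k i\<bar>\<^sup>2 + \<bar>c (l + i) - ?h * k (l + i)\<bar>\<^sup>2"
      using i by (simp add: u'_def lattice_vec_def cmod_power2 c_def)
    also have "\<dots> \<le> ?h\<^sup>2 + ?h\<^sup>2" using i by (intro add_mono power_mono tr) auto
    finally show "(cmod (u $ i - u' $ i))\<^sup>2 \<le> 2 * ?h\<^sup>2" by simp
  qed
  have dims: "dim_vec u' = l" "dim_vec u = l" using u by (auto simp: u'_def lattice_vec_def)
  have "vnorm u' \<le> vnorm u"
    unfolding vnorm_L2 dims using entry(1) by (intro L2_set_mono) auto
  then have "u' \<in> vec_net l" using u(2) kT by (auto simp: vec_net_def u'_def)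
  moreover have "vnorm (u - u') \<le> 1/4"
  proof -
    have "(vnorm (u - u'))\<^sup>2 = (\<Sum>i<l. (cmod (u $ i - u' $ i))\<^sup>2)"
      by (simp add: vnorm_def dims sum_nonneg)
    also have "\<dots> \<le> (\<Sum>i<l. 2 * ?h\<^sup>2)" by (intro sum_mono entry) auto
    also have "\<dots> = (1/4)\<^sup>2" using l by (simp add: mesh_def power_divide power_mult_distrib)
    finally show ?thesis by (rule power2_le_imp_le) simp
  qed
  ultimately show ?thesis by blast
qed

text \<open>Moving each of the two vectors to the net costs a quarter of the norm of X, so the norm
  is at most B plus half of itself. Real parts suffice, since pairing X u with its own normalization
  is real.\<close>

lemma spec_norm_le_net:
  assumes X: "X \<in> carrier_mat l l" and l: "0 < l"
    and B: "\<And>u v. u \<in> vec_net l \<Longrightarrow> v \<in> vec_net l \<Longrightarrow> Re ((X *\<^sub>v u) \<bullet>c v) \<le> B"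
  shows "spec_norm X \<le> 2 * B"
proof -
  have main: "Re ((X *\<^sub>v u) \<bullet>c v) \<le> B + spec_norm X / 2"
    if u: "u \<in> carrier_vec l" "vnorm u \<le> 1" and v: "v \<in> carrier_vec l" "vnorm v \<le> 1" for u v
  proof -
    obtain u' where u': "u' \<in> vec_net l" "vnorm (u - u') \<le> 1/4" using vec_net_approx[OF u l] by blast
    obtain v' where v': "v' \<in> vec_net l" "vnorm (v - v') \<le> 1/4" using vec_net_approx[OF v l] by blast
    have c: "u' \<in> carrier_vec l" "v' \<in> carrier_vec l" "vnorm u' \<le> 1" using u' v' vec_net_carrier by auto
    have xc: "X *\<^sub>v u \<in> carrier_vec l" "X *\<^sub>v u' \<in> carrier_vec l" using X u c by auto
    have "(X *\<^sub>v (u - u')) \<bullet>c v = (X *\<^sub>v u) \<bullet>c v - (X *\<^sub>v u') \<bullet>c v"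
      using X u c xc v by (simp add: mult_minus_distrib_mat_vec[of _ l l] cscalar_distrib(2)[of _ l])
    moreover have "(X *\<^sub>v u') \<bullet>c (v - v') = (X *\<^sub>v u') \<bullet>c v - (X *\<^sub>v u') \<bullet>c v'"
      using c xc v by (simp add: cscalar_prod_sum[of _ l] right_diff_distrib sum_subtractf)
    ultimately have eq: "(X *\<^sub>v u) \<bullet>c v = (X *\<^sub>v u') \<bullet>c v' + (X *\<^sub>v (u - u')) \<bullet>c v + (X *\<^sub>v u') \<bullet>c (v - v')"
      by simp
    have "Re ((X *\<^sub>v (u - u')) \<bullet>c v) \<le> spec_norm X * (1/4)"
    proof -
      have "Re ((X *\<^sub>v (u - u')) \<bullet>c v) \<le> spec_norm X * vnorm (u - u') * vnorm v"
        using X u c v by (intro order_trans[OF complex_Re_le_cmod spec_form]) auto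
      also have "\<dots> \<le> spec_norm X * (1/4) * 1" using u' v by (intro mult_mono mult_nonneg_nonneg) auto
      finally show ?thesis by simp
    qed
    moreover have "Re ((X *\<^sub>v u') \<bullet>c (v - v')) \<le> spec_norm X * (1/4)"
    proof -
      have "Re ((X *\<^sub>v u') \<bullet>c (v - v')) \<le> spec_norm X * vnorm u' * vnorm (v - v')"
        using X u c v by (intro order_trans[OF complex_Re_le_cmod spec_form]) auto
      also have "\<dots> \<le> spec_norm X * 1 * (1/4)" using v' c by (intro mult_mono mult_nonneg_nonneg) auto
      finally show ?thesis by simp
    qed
    ultimately show ?thesis using B[OF u'(1) v'(1)] by (simp add: eq)
  qed
  have "vnorm (X *\<^sub>v u) \<le> B + spec_norm X / 2" if u: "u \<in> carrier_vec l" "vnorm u \<le> 1" for u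
  proof (cases "vnorm (X *\<^sub>v u) = 0")
    case True
    have "X *\<^sub>v u \<in> carrier_vec l" using X u by simp
    then have "(X *\<^sub>v u) \<bullet>c 0\<^sub>v l = 0" by simp
    then show ?thesis using main[OF u, of "0\<^sub>v l"] True by simp
  next
    case False
    then have p: "0 < vnorm (X *\<^sub>v u)" using vnorm_nonneg[of "X *\<^sub>v u"] by linarith
    define v where "v = complex_of_real (1 / vnorm (X *\<^sub>v u)) \<cdot>\<^sub>v (X *\<^sub>v u)"
    have xc: "X *\<^sub>v u \<in> carrier_vec l" using X u by simp
    then have v: "v \<in> carrier_vec l" "vnorm v \<le> 1" using p by (auto simp: v_def norm_divide)
    have "(X *\<^sub>v u) \<bullet>c v = cnj (v \<bullet>c (X *\<^sub>v u))" by (rule cscalar_prod_swap_carrier[OF v(1) xc])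
    also have "v \<bullet>c (X *\<^sub>v u) = complex_of_real (1 / vnorm (X *\<^sub>v u)) * complex_of_real ((vnorm (X *\<^sub>v u))\<^sup>2)"
      unfolding v_def cscalar_distrib(3)[OF xc xc xc] cscalar_prod_self ..
    also have "\<dots> = complex_of_real (vnorm (X *\<^sub>v u))" using p by (simp add: power2_eq_square)
    finally show ?thesis using main[OF u v] by simp
  qed
  then have "spec_norm X \<le> B + spec_norm X / 2"
    unfolding spec_norm_def[of X]
    using X vnorm_zero by (intro cSUP_least) (auto simp: spec_norm_def[symmetric] intro!: exI[of _ "0\<^sub>v l"])
  then show ?thesis by simp
qed

section \<open>Expectations of random matrices and Lipschitz matrix fields\<close>

context prob_space
begin

lemma mexp_carrier [simp]: "mexp N r c Y \<in> carrier_mat r c"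
  by (simp add: mexp_def)

definition integrable_mat :: "nat \<Rightarrow> ('a \<Rightarrow> complex mat) \<Rightarrow> bool" where
  "integrable_mat l Y \<longleftrightarrow> (\<forall>\<omega> \<in> space M. Y \<omega> \<in> carrier_mat l l) \<and>
     (\<forall>i<l. \<forall>j<l. integrable M (\<lambda>\<omega>. Y \<omega> $$ (i, j)))"

lemma mexp_form:
  assumes Y: "integrable_mat l Y" and u: "u \<in> carrier_vec l" and v: "v \<in> carrier_vec l"
  shows "integrable M (\<lambda>\<omega>. (Y \<omega> *\<^sub>v u) \<bullet>c v)"
    "(mexp M l l Y *\<^sub>v u) \<bullet>c v = expectation (\<lambda>\<omega>. (Y \<omega> *\<^sub>v u) \<bullet>c v)"
proof -
  have eq: "(Y \<omega> *\<^sub>v u) \<bullet>c v = (\<Sum>i<l. \<Sum>j<l. Y \<omega> $$ (i, j) * u $ j * cnj (v $ i))" if "\<omega> \<in> space M" for \<omega>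
    using Y that u v by (intro cscalar_mat_sum) (auto simp: integrable_mat_def)
  have int: "integrable M (\<lambda>\<omega>. Y \<omega> $$ (i, j))" if "i < l" "j < l" for i j
    using Y that by (simp add: integrable_mat_def)
  have int': "integrable M (\<lambda>\<omega>. Y \<omega> $$ (i, j) * u $ j * cnj (v $ i))" if "i < l" "j < l" for i j
    using int[OF that] by simp
  have int'': "integrable M (\<lambda>\<omega>. \<Sum>j<l. Y \<omega> $$ (i, j) * u $ j * cnj (v $ i))" if "i < l" for i
    using int' that by (intro Bochner_Integration.integrable_sum) auto
  have "integrable M (\<lambda>\<omega>. \<Sum>i<l. \<Sum>j<l. Y \<omega> $$ (i, j) * u $ j * cnj (v $ i))"
    by (rule Bochner_Integration.integrable_sum) (rule int'', simp)
  then show "integrable M (\<lambda>\<omega>. (Y \<omega> *\<^sub>v u) \<bullet>c v)"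
    by (subst Bochner_Integration.integrable_cong[OF refl eq])
  have "expectation (\<lambda>\<omega>. (Y \<omega> *\<^sub>v u) \<bullet>c v) = expectation (\<lambda>\<omega>. \<Sum>i<l. \<Sum>j<l. Y \<omega> $$ (i, j) * u $ j * cnj (v $ i))"
    by (rule Bochner_Integration.integral_cong[OF refl eq])
  also have "\<dots> = (\<Sum>i<l. expectation (\<lambda>\<omega>. \<Sum>j<l. Y \<omega> $$ (i, j) * u $ j * cnj (v $ i)))"
    by (rule Bochner_Integration.integral_sum) (rule int'', simp)
  also have "\<dots> = (\<Sum>i<l. \<Sum>j<l. expectation (\<lambda>\<omega>. Y \<omega> $$ (i, j) * u $ j * cnj (v $ i)))"
    by (rule sum.cong[OF refl], rule Bochner_Integration.integral_sum) (rule int', simp_all)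
  also have "\<dots> = (\<Sum>i<l. \<Sum>j<l. expectation (\<lambda>\<omega>. Y \<omega> $$ (i, j)) * u $ j * cnj (v $ i))"
    using int by (intro sum.cong) auto
  also have "\<dots> = (mexp M l l Y *\<^sub>v u) \<bullet>c v"
    using u v by (subst cscalar_mat_sum[of _ l l]) (auto simp: mexp_def intro!: sum.cong)
  finally show "(mexp M l l Y *\<^sub>v u) \<bullet>c v = expectation (\<lambda>\<omega>. (Y \<omega> *\<^sub>v u) \<bullet>c v)" ..
qed

text \<open>An integrable majorant Z stands in for the spectral norm, so that the measurability of a
  supremum over a continuum of vectors never has to be discussed.\<close>

lemma spec_norm_mexp:
  assumes Y: "integrable_mat l Y"
    and Z: "integrable M Z" "AE \<omega> in M. spec_norm (Y \<omega>) \<le> Z \<omega>" and b: "expectation Z \<le> b" "0 \<le> b"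
  shows "spec_norm (mexp M l l Y) \<le> b"
proof (rule spec_norm_le_form[OF mexp_carrier b(2)])
  fix u v :: "complex Matrix.vec" assume v: "v \<in> carrier_vec l" and u: "u \<in> carrier_vec l"
  have "cmod ((mexp M l l Y *\<^sub>v v) \<bullet>c u) \<le> expectation (\<lambda>\<omega>. cmod ((Y \<omega> *\<^sub>v v) \<bullet>c u))"
    unfolding mexp_form(2)[OF Y v u] by (rule integral_norm_bound)
  also have "\<dots> \<le> expectation (\<lambda>\<omega>. Z \<omega> * (vnorm v * vnorm u))"
  proof (rule integral_mono_AE)
    show "integrable M (\<lambda>\<omega>. cmod ((Y \<omega> *\<^sub>v v) \<bullet>c u))"
      by (rule Bochner_Integration.integrable_norm[OF mexp_form(1)[OF Y v u]])
    show "integrable M (\<lambda>\<omega>. Z \<omega> * (vnorm v * vnorm u))" using Z(1) by (rule integrable_mult_left)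
    show "AE \<omega> in M. cmod ((Y \<omega> *\<^sub>v v) \<bullet>c u) \<le> Z \<omega> * (vnorm v * vnorm u)"
      using Z(2) AE_space
    proof eventually_elim
      case (elim \<omega>)
      have "cmod ((Y \<omega> *\<^sub>v v) \<bullet>c u) \<le> spec_norm (Y \<omega>) * vnorm v * vnorm u"
        using Y elim v u by (intro spec_form) (auto simp: integrable_mat_def)
      also have "\<dots> \<le> Z \<omega> * (vnorm v * vnorm u)"
        using elim by (simp add: mult.assoc mult_right_mono)
      finally show ?case .
    qed
  qed
  also have "\<dots> = expectation Z * (vnorm v * vnorm u)" by (rule integral_mult_left_zero)
  also have "\<dots> \<le> b * (vnorm v * vnorm u)" using b by (intro mult_right_mono) auto
  finally show "cmod ((mexp M l l Y *\<^sub>v v) \<bullet>c u) \<le> b * vnorm v * vnorm u" by (simp only: mult.assoc)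
qed

text \<open>Measurability is demanded everywhere but the Lipschitz bound only on D, to fit a
  resolvent that is meaningful only where the pencil is invertible.\<close>

definition lipschitz_field :: "nat \<Rightarrow> nat \<Rightarrow> (nat \<Rightarrow> real) set \<Rightarrow> real \<Rightarrow> ((nat \<Rightarrow> real) \<Rightarrow> complex mat) \<Rightarrow> bool" where
  "lipschitz_field m l D K \<Phi> \<longleftrightarrow> 0 \<le> K \<and> (\<forall>x \<in> euc m. \<Phi> x \<in> carrier_mat l l) \<and>
     (\<forall>i<l. \<forall>j<l. (\<lambda>x. \<Phi> x $$ (i, j)) \<in> borel_measurable (euc_borel m)) \<and>
     (\<forall>x \<in> D. \<forall>y \<in> D. spec_norm (\<Phi> x - \<Phi> y) \<le> K * L2_set (\<lambda>i. x i - y i) {..<m})"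

definition almost_domain :: "nat \<Rightarrow> ('a \<Rightarrow> nat \<Rightarrow> real) \<Rightarrow> (nat \<Rightarrow> real) set \<Rightarrow> bool" where
  "almost_domain m g D \<longleftrightarrow> gaussian_vector m g \<and> D \<in> sets (euc_borel m) \<and> (AE \<omega> in M. g \<omega> \<in> D)"

lemma almost_domain_euc: "gaussian_vector m g \<Longrightarrow> almost_domain m g (euc m)"
  unfolding almost_domain_def gaussian_vector_def
  using sets.top[of "euc_borel m"] measurable_space[of g M "euc_borel m"]
  by (auto simp: space_euc_borel intro!: AE_I2)

lemma gaussian_lipschitz_form:
  assumes g: "almost_domain m g D" and \<Phi>: "lipschitz_field m l D K \<Phi>"
    and u: "u \<in> carrier_vec l" and v: "v \<in> carrier_vec l"
  shows "(\<lambda>x. Re ((\<Phi> x *\<^sub>v u) \<bullet>c v)) \<in> borel_measurable (euc_borel m)"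
    "\<forall>x \<in> D. \<forall>y \<in> D. \<bar>Re ((\<Phi> x *\<^sub>v u) \<bullet>c v) - Re ((\<Phi> y *\<^sub>v u) \<bullet>c v)\<bar>
      \<le> (K * vnorm u * vnorm v) * L2_set (\<lambda>i. x i - y i) {..<m}"
    "integrable M (\<lambda>\<omega>. Re ((\<Phi> (g \<omega>) *\<^sub>v u) \<bullet>c v))"
proof -
  have D: "gaussian_vector m g" "D \<in> sets (euc_borel m)" "AE \<omega> in M. g \<omega> \<in> D"
    using g by (simp_all add: almost_domain_def)
  have \<Phi>c: "\<Phi> x \<in> carrier_mat l l" if "x \<in> euc m" for x using \<Phi> that by (simp add: lipschitz_field_def)
  have \<Phi>m: "(\<lambda>x. \<Phi> x $$ (i, j)) \<in> borel_measurable (euc_borel m)" if "i < l" "j < l" for i j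
    using \<Phi> that by (simp add: lipschitz_field_def)
  have K: "0 \<le> K" using \<Phi> by (simp add: lipschitz_field_def)
  have [measurable]: "(\<lambda>x. \<Sum>i<l. \<Sum>j<l. \<Phi> x $$ (i, j) * u $ j * cnj (v $ i)) \<in> borel_measurable (euc_borel m)"
    using \<Phi>m by (intro borel_measurable_sum borel_measurable_times borel_measurable_const) auto
  have "(\<lambda>x. Re (\<Sum>i<l. \<Sum>j<l. \<Phi> x $$ (i, j) * u $ j * cnj (v $ i))) \<in> borel_measurable (euc_borel m)"
    by measurable
  then show meas: "(\<lambda>x. Re ((\<Phi> x *\<^sub>v u) \<bullet>c v)) \<in> borel_measurable (euc_borel m)"
    by (rule measurable_cong[THEN iffD1, rotated])
      (simp add: space_euc_borel cscalar_mat_sum[OF \<Phi>c u v])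
  have Dm: "x \<in> D \<Longrightarrow> x \<in> euc m" for x using sets.sets_into_space[OF D(2)] by (auto simp: space_euc_borel)
  have lipf: "\<bar>Re ((\<Phi> x *\<^sub>v u) \<bullet>c v) - Re ((\<Phi> y *\<^sub>v u) \<bullet>c v)\<bar>
      \<le> (K * vnorm u * vnorm v) * L2_set (\<lambda>i. x i - y i) {..<m}" if xy: "x \<in> D" "y \<in> D" for x y
  proof -
    have c: "\<Phi> x \<in> carrier_mat l l" "\<Phi> y \<in> carrier_mat l l" using \<Phi>c Dm xy by auto
    have "((\<Phi> x - \<Phi> y) *\<^sub>v u) \<bullet>c v = (\<Phi> x *\<^sub>v u) \<bullet>c v - (\<Phi> y *\<^sub>v u) \<bullet>c v"
      using c u v by (simp add: minus_mult_distrib_mat_vec[of _ l l] cscalar_distrib(2)[of "\<Phi> x *\<^sub>v u" l "\<Phi> y *\<^sub>v u"])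
    then have "\<bar>Re ((\<Phi> x *\<^sub>v u) \<bullet>c v) - Re ((\<Phi> y *\<^sub>v u) \<bullet>c v)\<bar> \<le> cmod (((\<Phi> x - \<Phi> y) *\<^sub>v u) \<bullet>c v)"
      using abs_Re_le_cmod[of "((\<Phi> x - \<Phi> y) *\<^sub>v u) \<bullet>c v"] by simp
    also have "\<dots> \<le> spec_norm (\<Phi> x - \<Phi> y) * vnorm u * vnorm v"
      using c u v by (intro spec_form[of _ l l]) auto
    also have "\<dots> = spec_norm (\<Phi> x - \<Phi> y) * (vnorm u * vnorm v)" by (rule mult.assoc)
    also have "\<dots> \<le> (K * L2_set (\<lambda>i. x i - y i) {..<m}) * (vnorm u * vnorm v)"
      using \<Phi> xy by (intro mult_right_mono) (auto simp: lipschitz_field_def)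
    also have "\<dots> = (K * vnorm u * vnorm v) * L2_set (\<lambda>i. x i - y i) {..<m}" by (simp only: mult_ac)
    finally show ?thesis .
  qed
  then show "\<forall>x \<in> D. \<forall>y \<in> D. \<bar>Re ((\<Phi> x *\<^sub>v u) \<bullet>c v) - Re ((\<Phi> y *\<^sub>v u) \<bullet>c v)\<bar>
      \<le> (K * vnorm u * vnorm v) * L2_set (\<lambda>i. x i - y i) {..<m}" by blast
  have "0 \<le> K * vnorm u * vnorm v" using K by simp
  from gaussian_lipschitz_exp(1)[of m g "\<lambda>x. Re ((\<Phi> x *\<^sub>v u) \<bullet>c v)" D, OF D(1) meas D(2,3) this lipf]
  show "integrable M (\<lambda>\<omega>. Re ((\<Phi> (g \<omega>) *\<^sub>v u) \<bullet>c v))" by simp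
qed

lemma unit_vec_form:
  fixes W :: "complex mat"
  assumes W: "W \<in> carrier_mat l l" and ij: "i < l" "j < l"
  shows "(W *\<^sub>v (a \<cdot>\<^sub>v unit_vec l j)) \<bullet>c unit_vec l i = a * W $$ (i, j)"
proof -
  have "(W *\<^sub>v (a \<cdot>\<^sub>v unit_vec l j)) \<bullet>c unit_vec l i = (\<Sum>k<l. (W *\<^sub>v (a \<cdot>\<^sub>v unit_vec l j)) $ k * cnj (unit_vec l i $ k))"
    by (rule cscalar_prod_sum) simp
  also have "\<dots> = (\<Sum>k<l. if k = i then (W *\<^sub>v (a \<cdot>\<^sub>v unit_vec l j)) $ k else 0)"
    using ij by (intro sum.cong) (auto simp: unit_vec_def)
  also have "\<dots> = (W *\<^sub>v (a \<cdot>\<^sub>v unit_vec l j)) $ i" using ij by simp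
  also have "\<dots> = a * W $$ (i, j)" using W ij by (simp add: mult_mat_vec[of _ l l])
  finally show ?thesis .
qed

text \<open>Each entry is a form at unit vectors, and Lipschitz functions of a Gaussian vector are
  integrable. Since concentration speaks of real functions, the scalar a in the unit vector selects
  the real or the imaginary part.\<close>

lemma gaussian_lipschitz_integrable:
  assumes g: "almost_domain m g D" and \<Phi>: "lipschitz_field m l D K \<Phi>"
  shows "integrable_mat l (\<lambda>\<omega>. \<Phi> (g \<omega>))"
proof -
  have "g \<in> M \<rightarrow>\<^sub>M euc_borel m" using g by (simp add: almost_domain_def gaussian_vector_def)
  then have sp: "g \<omega> \<in> euc m" if "\<omega> \<in> space M" for \<omega>
    using measurable_space[OF _ that] by (metis space_euc_borel)
  have c: "\<Phi> (g \<omega>) \<in> carrier_mat l l" if "\<omega> \<in> space M" for \<omega> using \<Phi> sp[OF that] by (simp add: lipschitz_field_def)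
  have "integrable M (\<lambda>\<omega>. \<Phi> (g \<omega>) $$ (i, j))" if ij: "i < l" "j < l" for i j
  proof -
    have int: "integrable M (\<lambda>\<omega>. Re (a * \<Phi> (g \<omega>) $$ (i, j)))" for a
    proof -
      have "a \<cdot>\<^sub>v unit_vec l j \<in> carrier_vec l" by simp
      from gaussian_lipschitz_form(3)[OF g \<Phi> this unit_vec_carrier[of l i]]
      show ?thesis
        by (rule Bochner_Integration.integrable_cong[OF refl, THEN iffD1, rotated]) (simp only: unit_vec_form[OF c ij])
    qed
    \<comment> \<open>The scalars 1 and -i yield real and imaginary part from real parts
      alone.\<close>
    have "integrable M (\<lambda>\<omega>. complex_of_real (Re (1 * \<Phi> (g \<omega>) $$ (i, j))) + \<i> * complex_of_real (Re (- \<i> * \<Phi> (g \<omega>) $$ (i, j))))"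
      by (intro Bochner_Integration.integrable_add integrable_mult_right integrable_of_real int)
    moreover have "complex_of_real (Re (1 * w)) + \<i> * complex_of_real (Re (- \<i> * w)) = w" for w
      by (simp add: complex_eq_iff)
    ultimately show ?thesis by (simp only:)
  qed
  then show ?thesis using c by (simp add: integrable_mat_def)
qed

text \<open>Union bound over the net, in the smooth form \<open>a \<le> c + e\<^bsup>a - c\<^esup>\<close>.\<close>

lemma gaussian_matrix_concentration:
  assumes gv: "gaussian_vector m g" and \<Phi>: "lipschitz_field m l (euc m) K \<Phi>" and K: "0 < K" and l: "0 < l"
  shows "\<exists>Z. integrable M Z \<and> (\<forall>\<omega> \<in> space M. spec_norm (\<Phi> (g \<omega>) - mexp M l l (\<lambda>\<omega>. \<Phi> (g \<omega>))) \<le> Z \<omega>) \<and>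
    expectation Z \<le> 52 * K * sqrt (real l)"
proof -
  have g: "almost_domain m g (euc m)" by (rule almost_domain_euc[OF gv])
  then have D: "euc m \<in> sets (euc_borel m)" "AE \<omega> in M. g \<omega> \<in> euc m" by (simp_all add: almost_domain_def)
  note int = gaussian_lipschitz_integrable[OF g \<Phi>]
  have c: "\<Phi> (g \<omega>) \<in> carrier_mat l l" if "\<omega> \<in> space M" for \<omega> using int that by (simp add: integrable_mat_def)
  let ?E = "mexp M l l (\<lambda>\<omega>. \<Phi> (g \<omega>))"
  define f where "f u v x = Re ((\<Phi> x *\<^sub>v u) \<bullet>c v)" for u v x
  define Y where "Y u v \<omega> = f u v (g \<omega>) - expectation (\<lambda>\<omega>. f u v (g \<omega>))" for u v \<omega>
  \<comment> \<open>Makes (s K)^2 = l, so that each exponential moment is at most e^l and competes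
    on equal terms with the size of the net.\<close>
  define s where "s = sqrt (real l) / K"
  have s: "0 < s" using K l by (simp add: s_def)
  have Y_eq: "Re (((\<Phi> (g \<omega>) - ?E) *\<^sub>v u) \<bullet>c v) = Y u v \<omega>"
    if \<omega>: "\<omega> \<in> space M" and u: "u \<in> carrier_vec l" and v: "v \<in> carrier_vec l" for u v \<omega>
  proof -
    have E: "?E \<in> carrier_mat l l" by simp
    have "((\<Phi> (g \<omega>) - ?E) *\<^sub>v u) \<bullet>c v = (\<Phi> (g \<omega>) *\<^sub>v u) \<bullet>c v - (?E *\<^sub>v u) \<bullet>c v"
      unfolding minus_mult_distrib_mat_vec[OF c[OF \<omega>] E u]
      using c[OF \<omega>] E u v by (intro cscalar_distrib(2)[of _ l]) auto
    then show ?thesis using mexp_form[OF int u v] by (simp add: Y_def f_def)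
  qed
  have mgf: "integrable M (\<lambda>\<omega>. exp (s * Y u v \<omega>))" "expectation (\<lambda>\<omega>. exp (s * Y u v \<omega>)) \<le> exp (real l)"
    if "u \<in> vec_net l" "v \<in> vec_net l" for u v
  proof -
    have u: "u \<in> carrier_vec l" "vnorm u \<le> 1" and v: "v \<in> carrier_vec l" "vnorm v \<le> 1"
      using that vec_net_carrier by auto
    note form = gaussian_lipschitz_form[OF g \<Phi> u(1) v(1)]
    have "vnorm u * vnorm v \<le> 1" using u(2) v(2) by (intro mult_le_one) auto
    then have KK: "K * vnorm u * vnorm v \<le> K" using mult_left_mono[of "vnorm u * vnorm v" 1 K] K by (simp add: mult.assoc)
    have lipf: "\<bar>f u v x - f u v y\<bar> \<le> K * L2_set (\<lambda>i. x i - y i) {..<m}" if "x \<in> euc m" "y \<in> euc m" for x y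
    proof -
      have "\<bar>f u v x - f u v y\<bar> \<le> (K * vnorm u * vnorm v) * L2_set (\<lambda>i. x i - y i) {..<m}"
        using form(2) that by (simp add: f_def)
      also have "\<dots> \<le> K * L2_set (\<lambda>i. x i - y i) {..<m}" using KK by (intro mult_right_mono) auto
      finally show ?thesis .
    qed
    have mf: "f u v \<in> borel_measurable (euc_borel m)" using form(1) unfolding f_def[abs_def] .
    note main = gaussian_lipschitz_mgf[of m g "f u v" "euc m" K s, OF gv mf D less_imp_le[OF K] lipf]
    have "integrable M (\<lambda>\<omega>. exp (s * f u v (g \<omega>)) * exp (- (s * expectation (\<lambda>\<omega>. f u v (g \<omega>)))))"
      using main(1) by (intro integrable_mult_left) simp
    moreover have "exp (s * f u v (g \<omega>)) * exp (- (s * expectation (\<lambda>\<omega>. f u v (g \<omega>)))) = exp (s * Y u v \<omega>)" for \<omega>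
      unfolding exp_add[symmetric] Y_def by (simp add: right_diff_distrib)
    ultimately show "integrable M (\<lambda>\<omega>. exp (s * Y u v \<omega>))" by (simp only:)
    have "(s * K)\<^sup>2 = real l" using K by (simp add: s_def)
    then show "expectation (\<lambda>\<omega>. exp (s * Y u v \<omega>)) \<le> exp (real l)" using main(2) unfolding Y_def by simp
  qed
  \<comment> \<open>There are at most e^(24 l) pairs in the net, each with exponential moment at
    most e^l, so the factor e^(-25 l) bounds the mean of the double sum by 1. The leading 2 comes
    from the net; altogether 2 / s times 26 l, which is 52 K sqrt l.\<close>
  define Z where "Z \<omega> = 2 / s * (25 * real l + (\<Sum>u\<in>vec_net l. \<Sum>v\<in>vec_net l. exp (- (25 * real l)) * exp (s * Y u v \<omega>)))" for \<omega>
  have "integrable M Z"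
    unfolding Z_def[abs_def] using mgf(1)
    by (intro integrable_mult_right Bochner_Integration.integrable_add Bochner_Integration.integrable_sum integrable_const)
  moreover have "spec_norm (\<Phi> (g \<omega>) - ?E) \<le> Z \<omega>" if \<omega>: "\<omega> \<in> space M" for \<omega>
  proof -
    have "spec_norm (\<Phi> (g \<omega>) - ?E) \<le> 2 * (Z \<omega> / 2)"
    proof (rule spec_norm_le_net[OF _ l])
      show "\<Phi> (g \<omega>) - ?E \<in> carrier_mat l l" by simp
      fix u v assume uv: "u \<in> vec_net l" "v \<in> vec_net l"
      have "exp (- (25 * real l)) * exp (s * Y u v \<omega>) \<le> (\<Sum>v\<in>vec_net l. exp (- (25 * real l)) * exp (s * Y u v \<omega>))"
        using uv vec_net_finite by (intro member_le_sum) auto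
      also have "\<dots> \<le> (\<Sum>u\<in>vec_net l. \<Sum>v\<in>vec_net l. exp (- (25 * real l)) * exp (s * Y u v \<omega>))"
        using uv vec_net_finite by (intro member_le_sum[of u _ "\<lambda>u. \<Sum>v\<in>vec_net l. exp (- (25 * real l)) * exp (s * Y u v \<omega>)"] sum_nonneg) auto
      finally have 1: "exp (s * Y u v \<omega> - 25 * real l)
          \<le> (\<Sum>u\<in>vec_net l. \<Sum>v\<in>vec_net l. exp (- (25 * real l)) * exp (s * Y u v \<omega>))"
        unfolding exp_add[symmetric] by (simp add: algebra_simps)
      have "s * Y u v \<omega> \<le> 25 * real l + exp (s * Y u v \<omega> - 25 * real l)"
        using exp_ge_add_one_self[of "s * Y u v \<omega> - 25 * real l"] by linarith
      also have "\<dots> \<le> s * (Z \<omega> / 2)" using 1 s by (simp add: Z_def)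
      finally have "Y u v \<omega> \<le> Z \<omega> / 2" using s by simp
      then show "Re (((\<Phi> (g \<omega>) - ?E) *\<^sub>v u) \<bullet>c v) \<le> Z \<omega> / 2"
        using Y_eq[OF \<omega>] vec_net_carrier(1) uv by simp
    qed
    then show ?thesis by simp
  qed
  moreover have "expectation Z \<le> 52 * K * sqrt (real l)"
  proof -
    have "expectation Z = 2 / s * (25 * real l + (\<Sum>u\<in>vec_net l. \<Sum>v\<in>vec_net l.
        exp (- (25 * real l)) * expectation (\<lambda>\<omega>. exp (s * Y u v \<omega>))))"
      unfolding Z_def using mgf(1)
      by (simp add: Bochner_Integration.integral_sum Bochner_Integration.integrable_sum prob_space)
    moreover have "(\<Sum>u\<in>vec_net l. \<Sum>v\<in>vec_net l. exp (- (25 * real l)) * expectation (\<lambda>\<omega>. exp (s * Y u v \<omega>))) \<le> 1"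
    proof -
      have "(\<Sum>u\<in>vec_net l. \<Sum>v\<in>vec_net l. exp (- (25 * real l)) * expectation (\<lambda>\<omega>. exp (s * Y u v \<omega>)))
          \<le> (\<Sum>u\<in>vec_net l. \<Sum>v\<in>vec_net l. exp (- (25 * real l)) * exp (real l))"
        using mgf(2) by (intro sum_mono mult_left_mono) auto
      also have "\<dots> = real (card (vec_net l)) * real (card (vec_net l)) * (exp (- (25 * real l)) * exp (real l))"
        by simp
      also have "\<dots> \<le> exp (12 * real l) * exp (12 * real l) * (exp (- (25 * real l)) * exp (real l))"
        using vec_net_card by (intro mult_right_mono mult_mono) auto
      also have "\<dots> = 1" unfolding exp_add[symmetric] by simp
      finally show ?thesis .
    qed
    moreover have "1 \<le> real l" using l by simp
    ultimately have "expectation Z \<le> 2 / s * (26 * real l)"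
      using s by (simp only:) (intro mult_left_mono; simp)
    also have "\<dots> = 52 * K * (real l / sqrt (real l))" using K by (simp add: s_def)
    also have "real l / sqrt (real l) = sqrt (real l)" by (rule real_div_sqrt) simp
    finally show ?thesis .
  qed
  ultimately show ?thesis by blast
qed

end

section \<open>The expected regularized resolvent\<close>

lemma pencil_index:
  assumes "W \<in> carrier_mat (n + d) (n + d)" "i < n + d" "j < n + d"
  shows "pencil n d W \<tau> z $$ (i, j) = W $$ (i, j) - z * Lam n d $$ (i, j) - \<i> * complex_of_real \<tau> * (if i = j then 1 else 0)"
  using assms carrier_matD[OF Lam_carrier[of n d]] by (simp add: pencil_def)

lemma pencil_shift:
  assumes "W \<in> carrier_mat (n + d) (n + d)"
  shows "pencil n d W \<tau> z = pencil n d W 0 z - (\<i> * complex_of_real \<tau>) \<cdot>\<^sub>m 1\<^sub>m (n + d)"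
  using assms carrier_matD[OF Lam_carrier[of n d]] by (intro eq_matI) (simp_all add: pencil_def)

lemma symmetric_pencil_dissipative:
  assumes X: "X \<in> carrier_mat l l" "transpose_mat X = X" and z: "z \<in> uhp" and dim: "n + d = l"
  shows "dissipative l \<tau> (pencil n d (cmat X) \<tau> z)"
proof -
  have "dissipative (n + d) \<tau> (pencil n d (cmat X) \<tau> z)"
  proof (rule pencil_dissipative[OF _ z])
    fix v :: "complex Matrix.vec" assume "v \<in> carrier_vec (n + d)"
    then have v: "v \<in> carrier_vec l" by (simp add: dim)
    have "cmat X \<in> carrier_mat l l" using X(1) by simp
    from hermitian_form[OF this adjoint_cmat[OF X] v] show "Im ((cmat X *\<^sub>v v) \<bullet>c v) \<le> 0" by simp
  qed (use X dim in auto)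
  then show ?thesis by (simp add: dim)
qed

lemma resolvent_measurable:
  assumes X: "\<And>x. x \<in> space N \<Longrightarrow> X x \<in> carrier_mat (n + d) (n + d)"
      "\<And>i j. i < n + d \<Longrightarrow> j < n + d \<Longrightarrow> (\<lambda>x. X x $$ (i, j)) \<in> borel_measurable N"
    and ij: "i < n + d" "j < n + d"
  shows "(\<lambda>x. resolvent n d (X x) \<tau> z $$ (i, j)) \<in> borel_measurable N"
    "(\<lambda>x. det (pencil n d (cmat (X x)) \<tau> z)) \<in> borel_measurable N"
proof -
  have c: "pencil n d (cmat (X x)) \<tau> z \<in> carrier_mat (n + d) (n + d)" if "x \<in> space N" for x
    using X(1)[OF that] by simp
  have e: "(\<lambda>x. pencil n d (cmat (X x)) \<tau> z $$ (i, j)) \<in> borel_measurable N" if ij: "i < n + d" "j < n + d" for i j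
  proof -
    have "(\<lambda>x. complex_of_real (X x $$ (i, j)) - z * Lam n d $$ (i, j) - \<i> * complex_of_real \<tau> * (if i = j then 1 else 0))
        \<in> borel_measurable N"
      using X(2)[OF ij] by simp
    then show ?thesis
    proof (rule measurable_cong[THEN iffD1, rotated])
      fix x assume x: "x \<in> space N"
      show "complex_of_real (X x $$ (i, j)) - z * Lam n d $$ (i, j) - \<i> * complex_of_real \<tau> * (if i = j then 1 else 0)
          = pencil n d (cmat (X x)) \<tau> z $$ (i, j)"
        using pencil_index[of "cmat (X x)" n d i j \<tau> z] X(1)[OF x] ij by simp
    qed
  qed
  show "(\<lambda>x. resolvent n d (X x) \<tau> z $$ (i, j)) \<in> borel_measurable N"
    unfolding resolvent_def by (rule minv_measurable(1)[OF c e ij])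
  show "(\<lambda>x. Determinant.det (pencil n d (cmat (X x)) \<tau> z)) \<in> borel_measurable N"
    by (rule minv_measurable(2)[OF c e ij])
qed

context prob_space
begin

text \<open>The entries of the regularized resolvent belong to this algebra, so every polynomial in
  them is integrable at once.\<close>

definition bounded_meas :: "('a \<Rightarrow> complex) \<Rightarrow> bool" where
  "bounded_meas f \<longleftrightarrow> f \<in> borel_measurable M \<and> (\<exists>C. \<forall>\<omega> \<in> space M. cmod (f \<omega>) \<le> C)"

lemma bounded_meas_algebra: "function_algebra bounded_meas"
proof
  show "bounded_meas (\<lambda>_. c)" for c by (auto simp: bounded_meas_def)
next
  fix f g assume "bounded_meas f" "bounded_meas g"
  then obtain C D where [measurable]: "f \<in> borel_measurable M" "g \<in> borel_measurable M"
    and C: "\<forall>\<omega> \<in> space M. cmod (f \<omega>) \<le> C" and D: "\<forall>\<omega> \<in> space M. cmod (g \<omega>) \<le> D"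
    by (auto simp: bounded_meas_def)
  have "cmod (f \<omega> + g \<omega>) \<le> C + D" if "\<omega> \<in> space M" for \<omega>
    using C D that by (intro order_trans[OF norm_triangle_ineq add_mono]) auto
  then show "bounded_meas (\<lambda>x. f x + g x)" by (auto simp: bounded_meas_def)
  have "cmod (f \<omega> * g \<omega>) \<le> C * D" if "\<omega> \<in> space M" for \<omega>
    unfolding norm_mult using C D that order_trans[OF norm_ge_zero, of "f \<omega>" C] by (intro mult_mono) auto
  then show "bounded_meas (\<lambda>x. f x * g x)" by (auto simp: bounded_meas_def)
qed

sublocale bm: function_algebra bounded_meas by (rule bounded_meas_algebra)

lemma bounded_meas_mult_integrable:
  assumes f: "bounded_meas f" and g: "integrable M g"
  shows "integrable M (\<lambda>\<omega>. f \<omega> * g \<omega>)"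
proof -
  obtain C where [measurable]: "f \<in> borel_measurable M" and C: "\<forall>\<omega> \<in> space M. cmod (f \<omega>) \<le> C"
    using f by (auto simp: bounded_meas_def)
  have [measurable]: "g \<in> borel_measurable M" using g by simp
  show ?thesis
  proof (rule Bochner_Integration.integrable_bound)
    show "integrable M (\<lambda>\<omega>. complex_of_real C * g \<omega>)" using g by simp
    show "AE \<omega> in M. norm (f \<omega> * g \<omega>) \<le> norm (complex_of_real C * g \<omega>)"
      using C by (intro AE_I2) (auto simp: norm_mult intro!: mult_right_mono order_trans[OF _ abs_ge_self])
  qed measurable
qed

lemma bounded_meas_integrable:
  assumes "bounded_meas f"
  shows "integrable M f"
  using bounded_meas_mult_integrable[OF assms integrable_const[of 1]] by simp

lemma pair_product_integral:
  fixes f h :: "'a \<Rightarrow> complex"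
  assumes f: "integrable M f" and h: "integrable M h"
  shows "integrable (M \<Otimes>\<^sub>M M) (\<lambda>p. f (fst p) * h (snd p))"
    "(LINT p|(M \<Otimes>\<^sub>M M). f (fst p) * h (snd p)) = expectation f * expectation h"
proof -
  interpret pair: pair_sigma_finite M M by unfold_locales
  have [measurable]: "f \<in> borel_measurable M" "h \<in> borel_measurable M" using f h by auto
  show int: "integrable (M \<Otimes>\<^sub>M M) (\<lambda>p. f (fst p) * h (snd p))"
  proof (rule pair.Fubini_integrable)
    show "integrable M (\<lambda>x. LINT y|M. norm (f (fst (x, y)) * h (snd (x, y))))"
      using f h by (simp add: norm_mult)
    show "AE x in M. integrable M (\<lambda>y. f (fst (x, y)) * h (snd (x, y)))" using h by simp
  qed measurable
  have "(LINT p|(M \<Otimes>\<^sub>M M). f (fst p) * h (snd p)) = (LINT x|M. LINT y|M. f x * h y)"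
    using pair.integral_fst'[OF int] by simp
  also have "\<dots> = expectation f * expectation h" by simp
  finally show "(LINT p|(M \<Otimes>\<^sub>M M). f (fst p) * h (snd p)) = expectation f * expectation h" .
qed

end

section \<open>The error of the expected resolvent in the regularized Dyson equation\<close>

locale random_regularized_dyson = prob_space M + regularized_dyson n d l EL S \<tau> s0 e0 z
  for M :: "'a measure" and n d l EL S \<tau> s0 e0 z +
  fixes L :: "'a \<Rightarrow> real mat"
  assumes L: "\<And>\<omega>. \<omega> \<in> space M \<Longrightarrow> L \<omega> \<in> carrier_mat l l" "\<And>\<omega>. \<omega> \<in> space M \<Longrightarrow> transpose_mat (L \<omega>) = L \<omega>"
    and L_meas: "\<And>i j. i < l \<Longrightarrow> j < l \<Longrightarrow> (\<lambda>\<omega>. L \<omega> $$ (i, j)) \<in> borel_measurable M"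
      "\<And>i j. i < l \<Longrightarrow> j < l \<Longrightarrow> integrable M (\<lambda>\<omega>. (L \<omega> $$ (i, j))\<^sup>2)"
    and EL_mexp: "EL = mexp M l l L"
begin

definition R :: "'a \<Rightarrow> complex mat" where
  "R \<omega> = resolvent n d (L \<omega>) \<tau> z"

definition F :: "complex mat" where
  "F = mexp M l l R"

lemma pencil_L:
  assumes "\<omega> \<in> space M"
  shows "pencil n d (cmat (L \<omega>)) \<tau> z \<in> carrier_mat l l" "dissipative l \<tau> (pencil n d (cmat (L \<omega>)) \<tau> z)"
  using symmetric_pencil_dissipative[OF L[OF assms] z dim] by (auto simp: dissipative_def)

lemma R_carrier: "\<omega> \<in> space M \<Longrightarrow> R \<omega> \<in> carrier_mat l l"
  using pencil_L(1) by (simp add: R_def resolvent_def)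

lemma R_norm: "\<omega> \<in> space M \<Longrightarrow> spec_norm (R \<omega>) \<le> 1 / \<tau>"
  unfolding R_def resolvent_def by (rule dissipative_minv(1)[OF pencil_L(2) pos(3)])

lemma R_bm: "i < l \<Longrightarrow> j < l \<Longrightarrow> bounded_meas (\<lambda>\<omega>. R \<omega> $$ (i, j))"
  unfolding bounded_meas_def
proof (intro conjI exI[of _ "1 / \<tau>"] ballI)
  assume ij: "i < l" "j < l"
  show "(\<lambda>\<omega>. R \<omega> $$ (i, j)) \<in> borel_measurable M"
    unfolding R_def using L L_meas ij dim by (intro resolvent_measurable(1)) auto
  show "cmod (R \<omega> $$ (i, j)) \<le> 1 / \<tau>" if "\<omega> \<in> space M" for \<omega>
    using norm_index_le_spec[OF R_carrier[OF that] ij] R_norm[OF that] by linarith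
qed

lemma R_integrable: "integrable_mat l R"
  using R_carrier bounded_meas_integrable[OF R_bm] by (simp add: integrable_mat_def)

lemma F_carrier: "F \<in> carrier_mat l l"
  by (simp add: F_def)

lemma F_norm: "spec_norm F \<le> 1 / \<tau>"
  unfolding F_def using R_norm pos
  by (intro spec_norm_mexp[OF R_integrable, of "\<lambda>_. 1 / \<tau>"]) (auto simp: prob_space intro!: AE_I2)

lemma F_im:
  assumes v: "v \<in> carrier_vec l"
  shows "0 \<le> Im ((F *\<^sub>v v) \<bullet>c v)"
proof -
  note f = mexp_form[OF R_integrable v v]
  have "0 \<le> expectation (\<lambda>\<omega>. Im ((R \<omega> *\<^sub>v v) \<bullet>c v))"
  proof (rule integral_nonneg_AE, rule AE_I2)
    fix \<omega> assume \<omega>: "\<omega> \<in> space M"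
    show "0 \<le> Im ((R \<omega> *\<^sub>v v) \<bullet>c v)"
      using dissipative_minv(2)[OF pencil_L(2)[OF \<omega>] pos(3) v] pos
      unfolding R_def resolvent_def by (elim order_trans[rotated]) simp
  qed
  also have "\<dots> = Im ((F *\<^sub>v v) \<bullet>c v)" using f by (simp add: F_def)
  finally show ?thesis .
qed

definition L0 :: "'a \<Rightarrow> complex mat" where
  "L0 \<omega> = cmat (L \<omega> - EL)"

lemma L0_carrier: "L0 \<omega> \<in> carrier_mat l l"
  using EL by (simp add: L0_def)

lemma L0_index: "i < l \<Longrightarrow> j < l \<Longrightarrow> \<omega> \<in> space M \<Longrightarrow> L0 \<omega> $$ (i, j) = complex_of_real (L \<omega> $$ (i, j) - EL $$ (i, j))"
  using EL L by (simp add: L0_def)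

lemma L0_integrable:
  assumes "i < l" "j < l"
  shows "integrable M (\<lambda>\<omega>. L0 \<omega> $$ (i, j))" "integrable M (\<lambda>\<omega>. (cmod (L0 \<omega> $$ (i, j)))\<^sup>2)"
proof -
  have int: "integrable M (\<lambda>\<omega>. L \<omega> $$ (i, j))"
    by (rule square_integrable_imp_integrable[OF L_meas(1)[OF assms] L_meas(2)[OF assms]])
  then have "integrable M (\<lambda>\<omega>. complex_of_real (L \<omega> $$ (i, j) - EL $$ (i, j)))" by simp
  then show "integrable M (\<lambda>\<omega>. L0 \<omega> $$ (i, j))"
    by (rule Bochner_Integration.integrable_cong[OF refl, THEN iffD1, rotated]) (simp only: L0_index[OF assms])
  have "integrable M (\<lambda>\<omega>. (L \<omega> $$ (i, j))\<^sup>2 - 2 * EL $$ (i, j) * L \<omega> $$ (i, j) + (EL $$ (i, j))\<^sup>2)"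
    using int L_meas(2)[OF assms] by simp
  then show "integrable M (\<lambda>\<omega>. (cmod (L0 \<omega> $$ (i, j)))\<^sup>2)"
    by (rule Bochner_Integration.integrable_cong[OF refl, THEN iffD1, rotated])
      (simp only: L0_index[OF assms] norm_of_real power2_abs, simp add: power2_diff)
qed

lemma L0_prod_integrable:
  assumes "i < l" "j < l" "a < l" "b < l"
  shows "integrable M (\<lambda>\<omega>. L0 \<omega> $$ (i, j) * L0 \<omega> $$ (a, b))"
proof (rule Bochner_Integration.integrable_bound)
  show "integrable M (\<lambda>\<omega>. (cmod (L0 \<omega> $$ (i, j)))\<^sup>2 + (cmod (L0 \<omega> $$ (a, b)))\<^sup>2)"
    using L0_integrable(2) assms by simp
  show "(\<lambda>\<omega>. L0 \<omega> $$ (i, j) * L0 \<omega> $$ (a, b)) \<in> borel_measurable M"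
    using L0_integrable(1) assms by (intro borel_measurable_times) auto
  have "x * y \<le> x\<^sup>2 + y\<^sup>2" for x y :: real
    using zero_le_power2[of "x - y"] zero_le_power2[of x] zero_le_power2[of y] by (simp only: power2_diff)
  then show "AE \<omega> in M. norm (L0 \<omega> $$ (i, j) * L0 \<omega> $$ (a, b)) \<le> norm ((cmod (L0 \<omega> $$ (i, j)))\<^sup>2 + (cmod (L0 \<omega> $$ (a, b)))\<^sup>2)"
    by (intro AE_I2) (simp add: norm_mult)
qed

text \<open>The coordinates of the covariance operator \<open>T\<close>. In
  \<open>T (R \<omega>)\<close> they keep the second moments of L, already averaged, apart from the
  random entries of \<open>R\<close>; the entries of \<open>T (R \<omega>)\<close> are therefore
  bounded although L is not.\<close>

definition cov :: "nat \<Rightarrow> nat \<Rightarrow> nat \<Rightarrow> nat \<Rightarrow> complex" where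
  "cov i a b j = expectation (\<lambda>\<omega>. L0 \<omega> $$ (i, a) * L0 \<omega> $$ (b, j))"

definition T :: "complex mat \<Rightarrow> complex mat" where
  "T W = mexp M l l (\<lambda>\<omega>. L0 \<omega> * W * L0 \<omega>)"

lemma sandwich_index:
  fixes A B W :: "complex mat"
  assumes "A \<in> carrier_mat l l" "W \<in> carrier_mat l l" "B \<in> carrier_mat l l" "i < l" "j < l"
  shows "(A * W * B) $$ (i, j) = (\<Sum>b<l. \<Sum>a<l. W $$ (a, b) * (A $$ (i, a) * B $$ (b, j)))"
proof -
  have AW: "A * W \<in> carrier_mat l l" using assms by simp
  have "(A * W * B) $$ (i, j) = (\<Sum>b<l. (A * W) $$ (i, b) * B $$ (b, j))"
    by (rule mult_mat_index[OF AW assms(3-5)])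
  also have "\<dots> = (\<Sum>b<l. \<Sum>a<l. W $$ (a, b) * (A $$ (i, a) * B $$ (b, j)))"
  proof (rule sum.cong[OF refl])
    fix b assume "b \<in> {..<l}"
    then have b: "b < l" by simp
    show "(A * W) $$ (i, b) * B $$ (b, j) = (\<Sum>a<l. W $$ (a, b) * (A $$ (i, a) * B $$ (b, j)))"
      unfolding mult_mat_index[OF assms(1,2,4) b] sum_distrib_right by (rule sum.cong[OF refl]) (simp only: mult_ac)
  qed
  finally show ?thesis .
qed

lemma T_index:
  assumes W: "W \<in> carrier_mat l l" and ij: "i < l" "j < l"
  shows "T W $$ (i, j) = (\<Sum>b<l. \<Sum>a<l. W $$ (a, b) * cov i a b j)"
proof -
  have "T W $$ (i, j) = expectation (\<lambda>\<omega>. \<Sum>b<l. \<Sum>a<l. W $$ (a, b) * (L0 \<omega> $$ (i, a) * L0 \<omega> $$ (b, j)))"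
    unfolding T_def mexp_def using ij by (simp add: sandwich_index[OF L0_carrier W L0_carrier ij] del: index_mult_mat)
  also have "\<dots> = (\<Sum>b<l. expectation (\<lambda>\<omega>. \<Sum>a<l. W $$ (a, b) * (L0 \<omega> $$ (i, a) * L0 \<omega> $$ (b, j))))"
    by (rule Bochner_Integration.integral_sum, rule Bochner_Integration.integrable_sum, rule integrable_mult_right, rule L0_prod_integrable)
      (use ij in auto)
  also have "\<dots> = (\<Sum>b<l. \<Sum>a<l. expectation (\<lambda>\<omega>. W $$ (a, b) * (L0 \<omega> $$ (i, a) * L0 \<omega> $$ (b, j))))"
    by (rule sum.cong[OF refl], rule Bochner_Integration.integral_sum, rule integrable_mult_right, rule L0_prod_integrable)
      (use ij in auto)
  finally show ?thesis by (simp add: cov_def)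
qed

lemma T_carrier: "T W \<in> carrier_mat l l"
  by (simp add: T_def)

definition St :: "complex mat \<Rightarrow> complex mat" where
  "St = S_tilde M l L S"

lemma St_eq: "St W = T W - S W"
  unfolding St_def S_tilde_def T_def L0_def Let_def EL_mexp[symmetric] ..

lemma St_carrier: "W \<in> carrier_mat l l \<Longrightarrow> St W \<in> carrier_mat l l"
  using S_carrier by (simp add: St_eq)

text \<open>\<open>op_norm\<close> is a real supremum and bounds its members only once the set is
  known to be bounded. A crude sum over all entries of the covariance is enough for that; its size
  is irrelevant.\<close>

lemma St_norm:
  assumes W: "W \<in> carrier_mat l l" "spec_norm W \<le> 1"
  shows "spec_norm (St W) \<le> op_norm l St"
  unfolding op_norm_def
proof (rule cSUP_upper)
  show "W \<in> {W \<in> carrier_mat l l. spec_norm W \<le> 1}" using W by simp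
  show "bdd_above ((\<lambda>W. spec_norm (St W)) ` {W \<in> carrier_mat l l. spec_norm W \<le> 1})"
  proof (rule bdd_aboveI2)
    fix W assume "W \<in> {W \<in> carrier_mat l l. spec_norm W \<le> 1}"
    then have W: "W \<in> carrier_mat l l" "spec_norm W \<le> 1" by auto
    have "spec_norm (St W) \<le> spec_norm (T W) + spec_norm (S W)"
      unfolding St_eq by (rule spec_norm_minus[OF T_carrier S_carrier[OF W(1)]])
    also have "spec_norm (T W) \<le> (\<Sum>i<l. \<Sum>j<l. cmod (T W $$ (i, j)))" by (rule spec_norm_le_entries[OF T_carrier])
    also have "\<dots> \<le> (\<Sum>i<l. \<Sum>j<l. \<Sum>b<l. \<Sum>a<l. cmod (cov i a b j))"
    proof (intro sum_mono)
      fix i j assume "i \<in> {..<l}" "j \<in> {..<l}"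
      then have ij: "i < l" "j < l" by auto
      have e: "cmod (W $$ (a, b)) \<le> 1" if "a < l" "b < l" for a b
        using norm_index_le_spec[OF W(1) that] W(2) by linarith
      have "cmod (T W $$ (i, j)) \<le> (\<Sum>b<l. \<Sum>a<l. cmod (W $$ (a, b) * cov i a b j))"
        unfolding T_index[OF W(1) ij] by (intro order_trans[OF norm_sum] sum_mono norm_sum)
      also have "\<dots> \<le> (\<Sum>b<l. \<Sum>a<l. cmod (cov i a b j))"
        by (intro sum_mono) (simp add: norm_mult e mult_left_le_one_le)
      finally show "cmod (T W $$ (i, j)) \<le> (\<Sum>b<l. \<Sum>a<l. cmod (cov i a b j))" .
    qed
    also have "spec_norm (S W) \<le> s0 * 1" using S(2)[OF W(1)] W(2) pos by (auto intro: order_trans mult_left_mono)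
    finally show "spec_norm (St W) \<le> (\<Sum>i<l. \<Sum>j<l. \<Sum>b<l. \<Sum>a<l. cmod (cov i a b j)) + s0 * 1" by simp
  qed
qed

text \<open>\<open>\<tau>\<close> times the resolvent lies in the unit ball on which
  \<open>op_norm\<close> is defined; homogeneity does the rest.\<close>

lemma St_R_norm:
  assumes \<omega>: "\<omega> \<in> space M"
  shows "spec_norm (St (R \<omega>)) \<le> op_norm l St / \<tau>"
proof -
  let ?W = "complex_of_real \<tau> \<cdot>\<^sub>m R \<omega>"
  have Rc: "R \<omega> \<in> carrier_mat l l" by (rule R_carrier[OF \<omega>])
  then have W: "?W \<in> carrier_mat l l" by simp
  have "spec_norm ?W \<le> \<tau> * spec_norm (R \<omega>)"
    using spec_norm_smult_le[OF Rc, of "complex_of_real \<tau>"] pos by simp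
  also have "\<dots> \<le> 1" using R_norm[OF \<omega>] pos by (simp add: field_simps)
  finally have "spec_norm (St ?W) \<le> op_norm l St" by (rule St_norm[OF W])
  moreover have "St (R \<omega>) = complex_of_real (1 / \<tau>) \<cdot>\<^sub>m St ?W"
  proof (rule eq_matI)
    fix i j assume "i < dim_row (complex_of_real (1 / \<tau>) \<cdot>\<^sub>m St ?W)" "j < dim_col (complex_of_real (1 / \<tau>) \<cdot>\<^sub>m St ?W)"
    then have ij: "i < l" "j < l" using St_carrier[OF W] by auto
    have T: "T ?W $$ (i, j) = complex_of_real \<tau> * T (R \<omega>) $$ (i, j)"
      unfolding T_index[OF W ij] T_index[OF Rc ij] using Rc by (simp add: sum_distrib_left mult.assoc)
    have S': "S ?W $$ (i, j) = complex_of_real \<tau> * S (R \<omega>) $$ (i, j)"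
      unfolding pos_linear_entries[OF S(1) W ij] pos_linear_entries[OF S(1) Rc ij] sum_distrib_left
      using Rc by (intro sum.cong) auto
    have "St V $$ (i, j) = T V $$ (i, j) - S V $$ (i, j)" if "V \<in> carrier_mat l l" for V
      unfolding St_eq using ij S_carrier[OF that] by simp
    note St_at = this
    have "(complex_of_real (1 / \<tau>) \<cdot>\<^sub>m St ?W) $$ (i, j) = complex_of_real (1 / \<tau>) * St ?W $$ (i, j)"
      using ij St_carrier[OF W] by simp
    also have "\<dots> = complex_of_real (1 / \<tau>) * (complex_of_real \<tau> * (T (R \<omega>) $$ (i, j) - S (R \<omega>) $$ (i, j)))"
      unfolding St_at[OF W] T S' by (simp only: right_diff_distrib)
    also have "\<dots> = St (R \<omega>) $$ (i, j)" unfolding St_at[OF Rc] using pos by simp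
    finally show "St (R \<omega>) $$ (i, j) = (complex_of_real (1 / \<tau>) \<cdot>\<^sub>m St ?W) $$ (i, j)" by simp
  qed (use St_carrier[OF W] St_carrier[OF Rc] in auto)
  ultimately show ?thesis
    using spec_norm_smult_le[OF St_carrier[OF W], of "complex_of_real (1 / \<tau>)"] pos
      mult_left_mono[of "spec_norm (St ?W)" "op_norm l St" "1 / \<tau>"] by (simp add: norm_divide)
qed

text \<open>S is a finite linear combination of entries, hence commutes with expectation. So
  \<open>S F\<close> is the mean around which \<open>S (R \<omega>)\<close> concentrates.\<close>

lemma S_F: "S F = mexp M l l (\<lambda>\<omega>. S (R \<omega>))"
proof (rule eq_matI)
  fix i j assume "i < dim_row (mexp M l l (\<lambda>\<omega>. S (R \<omega>)))" "j < dim_col (mexp M l l (\<lambda>\<omega>. S (R \<omega>)))"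
  then have ij: "i < l" "j < l" by (auto simp: mexp_def)
  have "S F $$ (i, j) = (\<Sum>p\<in>{..<l} \<times> {..<l}. lin_coeff l S i j p * expectation (\<lambda>\<omega>. R \<omega> $$ p))"
    unfolding pos_linear_entries[OF S(1) F_carrier ij] by (rule sum.cong[OF refl]) (auto simp: F_def mexp_def)
  also have "\<dots> = expectation (\<lambda>\<omega>. \<Sum>p\<in>{..<l} \<times> {..<l}. lin_coeff l S i j p * R \<omega> $$ p)"
    by (subst Bochner_Integration.integral_sum) (auto intro: bounded_meas_integrable[OF R_bm])
  also have "\<dots> = expectation (\<lambda>\<omega>. S (R \<omega>) $$ (i, j))"
    by (rule Bochner_Integration.integral_cong[OF refl]) (simp only: pos_linear_entries[OF S(1) R_carrier ij])
  finally show "S F $$ (i, j) = mexp M l l (\<lambda>\<omega>. S (R \<omega>)) $$ (i, j)" using ij by (simp add: mexp_def)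
qed (use S_carrier[OF F_carrier] in \<open>auto simp: mexp_def\<close>)

text \<open>This is (T (R) - S (F)) R, the integrand of the error left after \<open>Delta\<close> is
  accounted for, written so that the difference of covariance and superoperator and the fluctuation
  of S (R) can be estimated separately.\<close>

definition Y :: "'a \<Rightarrow> complex mat" where
  "Y \<omega> = (St (R \<omega>) + (S (R \<omega>) - S F)) * R \<omega>"

text \<open>\<open>X F\<close> and the pencil of \<open>L \<omega>\<close> share their multiples of
  \<open>Lam\<close> and of the identity; they differ by the centred matrix
  \<open>L0 \<omega>\<close> and by \<open>S F\<close>, and R inverts the pencil.\<close>

lemma XF_R:
  assumes \<omega>: "\<omega> \<in> space M"
  shows "X F * R \<omega> = 1\<^sub>m l - L0 \<omega> * R \<omega> - S F * R \<omega>"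
proof -
  let ?P = "pencil n d (cmat (L \<omega>)) \<tau> z"
  note P = pencil_L[OF \<omega>]
  have SF: "S F \<in> carrier_mat l l" by (rule S_carrier[OF F_carrier])
  have Rc: "R \<omega> \<in> carrier_mat l l" by (rule R_carrier[OF \<omega>])
  have "X F = ?P - L0 \<omega> - S F"
    using SF L(1)[OF \<omega>] EL(1) dim carrier_matD[OF Lam_carrier[of n d]]
    by (intro eq_matI) (auto simp: X_def pencil_def L0_def)
  then have "X F * R \<omega> = ?P * R \<omega> - L0 \<omega> * R \<omega> - S F * R \<omega>"
    using P(1) SF Rc L0_carrier[of \<omega>] by (simp add: minus_mult_distrib_mat[of _ l l])
  moreover have "?P * R \<omega> = 1\<^sub>m l"
    unfolding R_def resolvent_def by (rule minv_inverse(1)[OF P(1) dissipative_det[OF P(2) pos(3)]])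
  ultimately show ?thesis by simp
qed

lemma TR_bm: "i < l \<Longrightarrow> j < l \<Longrightarrow> bounded_meas (\<lambda>\<omega>. \<Sum>b<l. \<Sum>a<l. R \<omega> $$ (a, b) * cov i a b j)"
  by (intro bm.sum bm.mult bm.const R_bm) auto

lemma TR_R_bm:
  "i < l \<Longrightarrow> j < l \<Longrightarrow> bounded_meas (\<lambda>\<omega>. \<Sum>c<l. (\<Sum>b<l. \<Sum>a<l. R \<omega> $$ (a, b) * cov i a b c) * R \<omega> $$ (c, j))"
  by (intro bm.sum[of "{..<l}"] bm.mult TR_bm R_bm) auto

lemma SF_R_bm: "i < l \<Longrightarrow> j < l \<Longrightarrow> bounded_meas (\<lambda>\<omega>. \<Sum>c<l. S F $$ (i, c) * R \<omega> $$ (c, j))"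
  by (intro bm.sum bm.mult bm.const R_bm) auto

lemma Y_index:
  assumes \<omega>: "\<omega> \<in> space M" and ij: "i < l" "j < l"
  shows "Y \<omega> $$ (i, j) = (\<Sum>c<l. (\<Sum>b<l. \<Sum>a<l. R \<omega> $$ (a, b) * cov i a b c) * R \<omega> $$ (c, j))
    - (\<Sum>c<l. S F $$ (i, c) * R \<omega> $$ (c, j))"
proof -
  have Rc: "R \<omega> \<in> carrier_mat l l" by (rule R_carrier[OF \<omega>])
  have SF: "S F \<in> carrier_mat l l" by (rule S_carrier[OF F_carrier])
  have "St (R \<omega>) + (S (R \<omega>) - S F) = T (R \<omega>) - S F"
    unfolding St_eq using S_carrier[OF Rc] SF T_carrier[of "R \<omega>"] by (intro eq_matI) auto
  then have "Y \<omega> = T (R \<omega>) * R \<omega> - S F * R \<omega>"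
    unfolding Y_def using minus_mult_distrib_mat[OF T_carrier SF Rc] by simp
  then have "Y \<omega> $$ (i, j) = (T (R \<omega>) * R \<omega>) $$ (i, j) - (S F * R \<omega>) $$ (i, j)"
    using SF Rc ij by (simp del: index_mult_mat(1))
  also have "(T (R \<omega>) * R \<omega>) $$ (i, j) = (\<Sum>c<l. T (R \<omega>) $$ (i, c) * R \<omega> $$ (c, j))"
    by (rule mult_mat_index[OF T_carrier Rc ij])
  also have "(S F * R \<omega>) $$ (i, j) = (\<Sum>c<l. S F $$ (i, c) * R \<omega> $$ (c, j))"
    by (rule mult_mat_index[OF SF Rc ij])
  also have "(\<Sum>c<l. T (R \<omega>) $$ (i, c) * R \<omega> $$ (c, j))
      = (\<Sum>c<l. (\<Sum>b<l. \<Sum>a<l. R \<omega> $$ (a, b) * cov i a b c) * R \<omega> $$ (c, j))"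
    using ij by (intro sum.cong) (auto simp: T_index[OF Rc])
  finally show ?thesis .
qed

lemma Y_integrable: "integrable_mat l Y"
  unfolding integrable_mat_def
proof (intro conjI ballI allI impI)
  fix \<omega> assume "\<omega> \<in> space M"
  then show "Y \<omega> \<in> carrier_mat l l"
    using R_carrier S_carrier[OF F_carrier] by (simp add: Y_def)
next
  fix i j assume ij: "i < l" "j < l"
  show "integrable M (\<lambda>\<omega>. Y \<omega> $$ (i, j))"
    using Bochner_Integration.integrable_diff[OF bounded_meas_integrable[OF TR_R_bm[OF ij]] bounded_meas_integrable[OF SF_R_bm[OF ij]]]
    by (rule Bochner_Integration.integrable_cong[OF refl, THEN iffD1, rotated]) (simp only: Y_index[OF _ ij])
qed

text \<open>Integrating over the independent copy first replaces the products of its entries by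
  their covariances, so the second term of \<open>Delta\<close> is the mean of T (R) R. After
  expansion into entries this is Fubini for products of one function of each coordinate.\<close>

lemma Delta_index:
  assumes ij: "i < l" "j < l"
  shows "Delta M n d L \<tau> z $$ (i, j) = expectation (\<lambda>\<omega>. (L0 \<omega> * R \<omega>) $$ (i, j))
    + expectation (\<lambda>\<omega>. \<Sum>c<l. (\<Sum>b<l. \<Sum>a<l. R \<omega> $$ (a, b) * cov i a b c) * R \<omega> $$ (c, j))"
proof -
  have "Delta M n d L \<tau> z = mexp M l l (\<lambda>\<omega>. L0 \<omega> * R \<omega>)
      + mexp (M \<Otimes>\<^sub>M M) l l (\<lambda>(\<omega>, \<omega>'). L0 \<omega>' * R \<omega> * L0 \<omega>' * R \<omega>)"
    unfolding Delta_def Let_def dim EL_mexp[symmetric] L0_def R_def ..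
  then have "Delta M n d L \<tau> z $$ (i, j) = expectation (\<lambda>\<omega>. (L0 \<omega> * R \<omega>) $$ (i, j))
      + (LINT p|(M \<Otimes>\<^sub>M M). (L0 (snd p) * R (fst p) * L0 (snd p) * R (fst p)) $$ (i, j))"
    using ij by (simp add: mexp_def case_prod_beta' del: index_mult_mat)
  moreover have "(LINT p|(M \<Otimes>\<^sub>M M). (L0 (snd p) * R (fst p) * L0 (snd p) * R (fst p)) $$ (i, j))
      = expectation (\<lambda>\<omega>. \<Sum>c<l. (\<Sum>b<l. \<Sum>a<l. R \<omega> $$ (a, b) * cov i a b c) * R \<omega> $$ (c, j))"
  proof -
    define q where "q c b a \<omega> = R \<omega> $$ (a, b) * R \<omega> $$ (c, j)" for c b a \<omega>
    define h where "h c b a \<omega> = L0 \<omega> $$ (i, a) * L0 \<omega> $$ (b, c)" for c b a \<omega>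
    have q_int: "integrable M (q c b a)" if "a < l" "b < l" "c < l" for a b c
      unfolding q_def[abs_def] using that ij by (intro bounded_meas_integrable bm.mult R_bm)
    have h_int: "integrable M (h c b a)" if "a < l" "b < l" "c < l" for a b c
      unfolding h_def[abs_def] using that ij by (intro L0_prod_integrable)
    have ent: "(L0 (snd p) * R (fst p) * L0 (snd p) * R (fst p)) $$ (i, j)
        = (\<Sum>c<l. \<Sum>b<l. \<Sum>a<l. q c b a (fst p) * h c b a (snd p))" if p: "p \<in> space (M \<Otimes>\<^sub>M M)" for p
    proof -
      have Rc: "R (fst p) \<in> carrier_mat l l" using p by (intro R_carrier) (auto simp: space_pair_measure)
      have Bc: "L0 (snd p) * R (fst p) * L0 (snd p) \<in> carrier_mat l l" using Rc L0_carrier by simp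
      have "(L0 (snd p) * R (fst p) * L0 (snd p) * R (fst p)) $$ (i, j)
          = (\<Sum>c<l. (L0 (snd p) * R (fst p) * L0 (snd p)) $$ (i, c) * R (fst p) $$ (c, j))"
        by (rule mult_mat_index[OF Bc Rc ij])
      also have "\<dots> = (\<Sum>c<l. \<Sum>b<l. \<Sum>a<l. q c b a (fst p) * h c b a (snd p))"
      proof (rule sum.cong[OF refl])
        fix c assume "c \<in> {..<l}"
        then have c: "c < l" by simp
        show "(L0 (snd p) * R (fst p) * L0 (snd p)) $$ (i, c) * R (fst p) $$ (c, j)
            = (\<Sum>b<l. \<Sum>a<l. q c b a (fst p) * h c b a (snd p))"
          unfolding sandwich_index[OF L0_carrier Rc L0_carrier ij(1) c] sum_distrib_right q_def h_def
          by (intro sum.cong refl) (simp only: mult_ac)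
      qed
      finally show ?thesis .
    qed
    have "(LINT p|(M \<Otimes>\<^sub>M M). (L0 (snd p) * R (fst p) * L0 (snd p) * R (fst p)) $$ (i, j))
        = (LINT p|(M \<Otimes>\<^sub>M M). (\<Sum>c<l. \<Sum>b<l. \<Sum>a<l. q c b a (fst p) * h c b a (snd p)))"
      by (rule Bochner_Integration.integral_cong[OF refl ent])
    also have "\<dots> = (\<Sum>c<l. (LINT p|(M \<Otimes>\<^sub>M M). (\<Sum>b<l. \<Sum>a<l. q c b a (fst p) * h c b a (snd p))))"
      by (rule Bochner_Integration.integral_sum, (rule Bochner_Integration.integrable_sum)+, rule pair_product_integral(1))
        (auto intro: q_int h_int)
    also have "\<dots> = (\<Sum>c<l. \<Sum>b<l. (LINT p|(M \<Otimes>\<^sub>M M). (\<Sum>a<l. q c b a (fst p) * h c b a (snd p))))"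
      by (rule sum.cong[OF refl], rule Bochner_Integration.integral_sum, rule Bochner_Integration.integrable_sum, rule pair_product_integral(1))
        (auto intro: q_int h_int)
    also have "\<dots> = (\<Sum>c<l. \<Sum>b<l. \<Sum>a<l. (LINT p|(M \<Otimes>\<^sub>M M). q c b a (fst p) * h c b a (snd p)))"
      by (rule sum.cong[OF refl], rule sum.cong[OF refl], rule Bochner_Integration.integral_sum, rule pair_product_integral(1))
        (auto intro: q_int h_int)
    also have "\<dots> = (\<Sum>c<l. \<Sum>b<l. \<Sum>a<l. expectation (q c b a) * cov i a b c)"
      by (rule sum.cong[OF refl], rule sum.cong[OF refl], rule sum.cong[OF refl], subst pair_product_integral(2))
        (use ij in \<open>auto intro: q_int L0_prod_integrable simp: cov_def h_def[abs_def]\<close>)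
    also have "\<dots> = (\<Sum>c<l. \<Sum>b<l. \<Sum>a<l. expectation (\<lambda>\<omega>. q c b a \<omega> * cov i a b c))"
      by (intro sum.cong refl) (rule integral_mult_left_zero[symmetric])
    also have "\<dots> = (\<Sum>c<l. \<Sum>b<l. expectation (\<lambda>\<omega>. \<Sum>a<l. q c b a \<omega> * cov i a b c))"
      by (rule sum.cong[OF refl], rule sum.cong[OF refl], rule Bochner_Integration.integral_sum[symmetric], rule integrable_mult_left)
        (auto intro: q_int)
    also have "\<dots> = (\<Sum>c<l. expectation (\<lambda>\<omega>. \<Sum>b<l. \<Sum>a<l. q c b a \<omega> * cov i a b c))"
      by (rule sum.cong[OF refl], rule Bochner_Integration.integral_sum[symmetric], rule Bochner_Integration.integrable_sum, rule integrable_mult_left)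
        (auto intro: q_int)
    also have "\<dots> = expectation (\<lambda>\<omega>. \<Sum>c<l. \<Sum>b<l. \<Sum>a<l. q c b a \<omega> * cov i a b c)"
      by (rule Bochner_Integration.integral_sum[symmetric], (rule Bochner_Integration.integrable_sum)+, rule integrable_mult_left)
        (auto intro: q_int)
    also have "\<dots> = expectation (\<lambda>\<omega>. \<Sum>c<l. (\<Sum>b<l. \<Sum>a<l. R \<omega> $$ (a, b) * cov i a b c) * R \<omega> $$ (c, j))"
      unfolding sum_distrib_right q_def by (intro Bochner_Integration.integral_cong refl sum.cong) (simp only: mult_ac)
    finally show ?thesis .
  qed
  ultimately show ?thesis by simp
qed

lemma Delta_carrier: "Delta M n d L \<tau> z \<in> carrier_mat l l"
  by (simp add: Delta_def Let_def dim mexp_def)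

text \<open>\<open>X F\<close> is deterministic, so it moves inside the expectation and
  \<open>XF_R\<close> can be averaged. The mean of L0 R is \<open>Delta\<close> minus the mean of T
  (R) R, and the latter joins the term with S (F) to form \<open>Y\<close>.\<close>

theorem dyson_error: "X F * F = 1\<^sub>m l + (mexp M l l Y - Delta M n d L \<tau> z)"
proof (rule eq_matI)
  have XF: "X F \<in> carrier_mat l l" by (rule X_carrier[OF F_carrier])
  have SF: "S F \<in> carrier_mat l l" by (rule S_carrier[OF F_carrier])
  show "dim_row (X F * F) = dim_row (1\<^sub>m l + (mexp M l l Y - Delta M n d L \<tau> z))"
    "dim_col (X F * F) = dim_col (1\<^sub>m l + (mexp M l l Y - Delta M n d L \<tau> z))"
    using XF F_carrier Delta_carrier by auto
  fix i j assume "i < dim_row (1\<^sub>m l + (mexp M l l Y - Delta M n d L \<tau> z))" "j < dim_col (1\<^sub>m l + (mexp M l l Y - Delta M n d L \<tau> z))"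
  then have ij: "i < l" "j < l" using Delta_carrier by auto
  have L0R: "(L0 \<omega> * R \<omega>) $$ (i, j) = (\<Sum>k<l. R \<omega> $$ (k, j) * L0 \<omega> $$ (i, k))" if "\<omega> \<in> space M" for \<omega>
    unfolding mult_mat_index[OF L0_carrier R_carrier[OF that] ij] by (simp only: mult.commute)
  have "integrable M (\<lambda>\<omega>. \<Sum>k<l. R \<omega> $$ (k, j) * L0 \<omega> $$ (i, k))"
    by (rule Bochner_Integration.integrable_sum, rule bounded_meas_mult_integrable[OF R_bm L0_integrable(1)]) (use ij in auto)
  then have L0R_int: "integrable M (\<lambda>\<omega>. (L0 \<omega> * R \<omega>) $$ (i, j))"
    by (subst Bochner_Integration.integrable_cong[OF refl L0R])
  have "(X F * F) $$ (i, j) = (\<Sum>k<l. X F $$ (i, k) * F $$ (k, j))"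
    by (rule mult_mat_index[OF XF F_carrier ij])
  also have "\<dots> = (\<Sum>k<l. expectation (\<lambda>\<omega>. X F $$ (i, k) * R \<omega> $$ (k, j)))"
    using ij by (intro sum.cong) (auto simp: F_def mexp_def)
  also have "\<dots> = expectation (\<lambda>\<omega>. \<Sum>k<l. X F $$ (i, k) * R \<omega> $$ (k, j))"
    by (rule Bochner_Integration.integral_sum[symmetric], rule integrable_mult_right, rule bounded_meas_integrable[OF R_bm])
      (use ij in auto)
  also have "\<dots> = expectation (\<lambda>\<omega>. (if i = j then 1 else 0) - (L0 \<omega> * R \<omega>) $$ (i, j) - (\<Sum>c<l. S F $$ (i, c) * R \<omega> $$ (c, j)))"
  proof (rule Bochner_Integration.integral_cong[OF refl])
    fix \<omega> assume \<omega>: "\<omega> \<in> space M"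
    have Rc: "R \<omega> \<in> carrier_mat l l" by (rule R_carrier[OF \<omega>])
    have c: "L0 \<omega> * R \<omega> \<in> carrier_mat l l" "S F * R \<omega> \<in> carrier_mat l l" using L0_carrier Rc SF by auto
    have "(\<Sum>k<l. X F $$ (i, k) * R \<omega> $$ (k, j)) = (X F * R \<omega>) $$ (i, j)"
      by (rule mult_mat_index[OF XF Rc ij, symmetric])
    also have "\<dots> = (if i = j then 1 else 0) - (L0 \<omega> * R \<omega>) $$ (i, j) - (S F * R \<omega>) $$ (i, j)"
      unfolding XF_R[OF \<omega>] using c ij carrier_matD[OF c(1)] carrier_matD[OF c(2)] by (simp del: index_mult_mat)
    also have "(S F * R \<omega>) $$ (i, j) = (\<Sum>c<l. S F $$ (i, c) * R \<omega> $$ (c, j))" by (rule mult_mat_index[OF SF Rc ij])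
    finally show "(\<Sum>k<l. X F $$ (i, k) * R \<omega> $$ (k, j))
        = (if i = j then 1 else 0) - (L0 \<omega> * R \<omega>) $$ (i, j) - (\<Sum>c<l. S F $$ (i, c) * R \<omega> $$ (c, j))" .
  qed
  also have "\<dots> = (if i = j then 1 else 0) - expectation (\<lambda>\<omega>. (L0 \<omega> * R \<omega>) $$ (i, j))
      - expectation (\<lambda>\<omega>. \<Sum>c<l. S F $$ (i, c) * R \<omega> $$ (c, j))"
    using L0R_int bounded_meas_integrable[OF SF_R_bm[OF ij]]
    by (subst Bochner_Integration.integral_diff, simp, simp, subst Bochner_Integration.integral_diff) (simp_all add: prob_space)
  also have "\<dots> = (if i = j then 1 else 0) + (expectation (\<lambda>\<omega>. Y \<omega> $$ (i, j)) - Delta M n d L \<tau> z $$ (i, j))"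
  proof -
    have "expectation (\<lambda>\<omega>. Y \<omega> $$ (i, j))
        = expectation (\<lambda>\<omega>. (\<Sum>c<l. (\<Sum>b<l. \<Sum>a<l. R \<omega> $$ (a, b) * cov i a b c) * R \<omega> $$ (c, j))
            - (\<Sum>c<l. S F $$ (i, c) * R \<omega> $$ (c, j)))"
      by (rule Bochner_Integration.integral_cong[OF refl]) (rule Y_index[OF _ ij])
    also have "\<dots> = expectation (\<lambda>\<omega>. \<Sum>c<l. (\<Sum>b<l. \<Sum>a<l. R \<omega> $$ (a, b) * cov i a b c) * R \<omega> $$ (c, j))
        - expectation (\<lambda>\<omega>. \<Sum>c<l. S F $$ (i, c) * R \<omega> $$ (c, j))"
      by (rule Bochner_Integration.integral_diff[OF bounded_meas_integrable[OF TR_R_bm[OF ij]] bounded_meas_integrable[OF SF_R_bm[OF ij]]])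
    finally show ?thesis unfolding Delta_index[OF ij] by simp
  qed
  also have "\<dots> = (1\<^sub>m l + (mexp M l l Y - Delta M n d L \<tau> z)) $$ (i, j)"
    using ij carrier_matD[OF Delta_carrier] by (simp add: mexp_def)
  finally show "(X F * F) $$ (i, j) = (1\<^sub>m l + (mexp M l l Y - Delta M n d L \<tau> z)) $$ (i, j)" .
qed

text \<open>Each resolvent costs a factor \<open>1 / \<tau>\<close>: the term with \<open>St\<close>
  contains two of them, the fluctuation only the outer one.\<close>

lemma dyson_error_norm:
  assumes Z: "integrable M Z" "\<And>\<omega>. \<omega> \<in> space M \<Longrightarrow> spec_norm (S (R \<omega>) - S F) \<le> Z \<omega>" and b: "expectation Z \<le> b"
  shows "spec_norm (mexp M l l Y - Delta M n d L \<tau> z) \<le> spec_norm (Delta M n d L \<tau> z) + op_norm l St / \<tau>\<^sup>2 + b / \<tau>"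
proof -
  have SF: "S F \<in> carrier_mat l l" by (rule S_carrier[OF F_carrier])
  have op0: "0 \<le> op_norm l St"
    using order_trans[OF spec_norm_nonneg St_norm[of "0\<^sub>m l l"]] by simp
  have b0: "0 \<le> b"
    using b order_trans[OF spec_norm_nonneg Z(2)] by (intro order_trans[OF integral_nonneg_AE b] AE_I2)
  have "spec_norm (mexp M l l Y) \<le> op_norm l St / \<tau>\<^sup>2 + b / \<tau>"
  proof (rule spec_norm_mexp[OF Y_integrable])
    show "integrable M (\<lambda>\<omega>. op_norm l St / \<tau>\<^sup>2 + Z \<omega> / \<tau>)" using Z(1) by simp
    show "expectation (\<lambda>\<omega>. op_norm l St / \<tau>\<^sup>2 + Z \<omega> / \<tau>) \<le> op_norm l St / \<tau>\<^sup>2 + b / \<tau>"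
      using Z(1) b pos by (simp add: prob_space divide_right_mono)
    show "0 \<le> op_norm l St / \<tau>\<^sup>2 + b / \<tau>" using op0 b0 pos by simp
    show "AE \<omega> in M. spec_norm (Y \<omega>) \<le> op_norm l St / \<tau>\<^sup>2 + Z \<omega> / \<tau>"
    proof (rule AE_I2)
      fix \<omega> assume \<omega>: "\<omega> \<in> space M"
      have Rc: "R \<omega> \<in> carrier_mat l l" by (rule R_carrier[OF \<omega>])
      have c: "St (R \<omega>) \<in> carrier_mat l l" "S (R \<omega>) - S F \<in> carrier_mat l l" using St_carrier[OF Rc] SF by auto
      have Z0: "0 \<le> Z \<omega>" using order_trans[OF spec_norm_nonneg Z(2)[OF \<omega>]] .
      have "spec_norm (Y \<omega>) \<le> spec_norm (St (R \<omega>) + (S (R \<omega>) - S F)) * spec_norm (R \<omega>)"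
        unfolding Y_def using c Rc by (intro spec_norm_mult[of _ l l _ l]) auto
      also have "\<dots> \<le> (op_norm l St / \<tau> + Z \<omega>) * (1 / \<tau>)"
        using spec_norm_triangle[OF c] St_R_norm[OF \<omega>] Z(2)[OF \<omega>] R_norm[OF \<omega>] op0 Z0 pos
        by (intro mult_mono) auto
      also have "\<dots> = op_norm l St / \<tau>\<^sup>2 + Z \<omega> / \<tau>" by (simp add: power2_eq_square algebra_simps)
      finally show "spec_norm (Y \<omega>) \<le> op_norm l St / \<tau>\<^sup>2 + Z \<omega> / \<tau>" .
    qed
  qed
  moreover have "spec_norm (mexp M l l Y - Delta M n d L \<tau> z) \<le> spec_norm (mexp M l l Y) + spec_norm (Delta M n d L \<tau> z)"
    by (rule spec_norm_minus[OF mexp_carrier Delta_carrier])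
  ultimately show ?thesis by linarith
qed

text \<open>The pointwise bound of \<open>dissipative_shift\<close>, available where the
  unregularized pencil is invertible, is integrated in weak form. The second moment enters as a
  nonnegative integral, so it needs no measurability of the spectral norm.\<close>

lemma regularization_error:
  assumes R0: "integrable_mat l (\<lambda>\<omega>. resolvent n d (L \<omega>) 0 z)"
    and inv: "AE \<omega> in M. det (pencil n d (cmat (L \<omega>)) 0 z) \<noteq> 0"
    and C: "(\<integral>\<^sup>+\<omega>. ennreal ((spec_norm (resolvent n d (L \<omega>) 0 z))\<^sup>2) \<partial>M) \<le> ennreal C" "0 \<le> C"
  shows "spec_norm (F - mexp M l l (\<lambda>\<omega>. resolvent n d (L \<omega>) 0 z)) \<le> \<tau> * C"
proof (rule spec_norm_le_form)
  let ?R0 = "\<lambda>\<omega>. resolvent n d (L \<omega>) 0 z"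
  show "F - mexp M l l ?R0 \<in> carrier_mat l l" by simp
  show "0 \<le> \<tau> * C" using pos C by simp
  fix u v :: "complex Matrix.vec" assume v: "v \<in> carrier_vec l" and u: "u \<in> carrier_vec l"
  note f1 = mexp_form[OF R_integrable v u] and f0 = mexp_form[OF R0 v u]
  define f where "f \<omega> = (R \<omega> *\<^sub>v v) \<bullet>c u - (?R0 \<omega> *\<^sub>v v) \<bullet>c u" for \<omega>
  have f_int: "integrable M f" unfolding f_def[abs_def] by (rule Bochner_Integration.integrable_diff[OF f1(1) f0(1)])
  have mc: "mexp M l l ?R0 *\<^sub>v v \<in> carrier_vec l" "F *\<^sub>v v \<in> carrier_vec l"
    using v by (auto simp: F_def)
  have "((F - mexp M l l ?R0) *\<^sub>v v) \<bullet>c u = (F *\<^sub>v v) \<bullet>c u - (mexp M l l ?R0 *\<^sub>v v) \<bullet>c u"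
    unfolding minus_mult_distrib_mat_vec[OF F_carrier mexp_carrier v] by (rule cscalar_distrib(2)[OF mc(2,1) u])
  also have "\<dots> = expectation f"
    unfolding f_def F_def f1(2) f0(2) by (rule Bochner_Integration.integral_diff[OF f1(1) f0(1), symmetric])
  finally have eq: "((F - mexp M l l ?R0) *\<^sub>v v) \<bullet>c u = expectation f" .
  let ?\<kappa> = "\<tau> * vnorm v * vnorm u"
  have bound: "AE \<omega> in M. cmod (f \<omega>) \<le> ?\<kappa> * (spec_norm (?R0 \<omega>))\<^sup>2"
    using inv AE_space
  proof eventually_elim
    case (elim \<omega>)
    let ?P = "pencil n d (cmat (L \<omega>)) 0 z"
    have P: "dissipative l 0 ?P" using symmetric_pencil_dissipative[OF L[OF elim(2)] z dim, of 0] by simp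
    have R_eq: "R \<omega> = minv (?P - (\<i> * complex_of_real \<tau>) \<cdot>\<^sub>m 1\<^sub>m l)"
      unfolding R_def resolvent_def using pencil_shift[of "cmat (L \<omega>)" n d \<tau> z] L(1)[OF elim(2)] dim by simp
    have Rc: "R \<omega> \<in> carrier_mat l l" "?R0 \<omega> \<in> carrier_mat l l"
      using R_carrier[OF elim(2)] R0 elim(2) by (auto simp: integrable_mat_def)
    have "spec_norm (R \<omega> - ?R0 \<omega>) \<le> \<tau> * (spec_norm (?R0 \<omega>))\<^sup>2"
      unfolding R_eq resolvent_def using dissipative_shift(2)[OF P elim(1) pos(3)] .
    moreover have "f \<omega> = ((R \<omega> - ?R0 \<omega>) *\<^sub>v v) \<bullet>c u"
      unfolding f_def minus_mult_distrib_mat_vec[OF Rc v] using Rc v u by (intro cscalar_distrib(2)[symmetric, of _ l]) auto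
    moreover have "cmod (((R \<omega> - ?R0 \<omega>) *\<^sub>v v) \<bullet>c u) \<le> spec_norm (R \<omega> - ?R0 \<omega>) * vnorm v * vnorm u"
      using Rc v u by (intro spec_form[of _ l l]) auto
    moreover have "spec_norm (R \<omega> - ?R0 \<omega>) * vnorm v * vnorm u \<le> (\<tau> * (spec_norm (?R0 \<omega>))\<^sup>2) * vnorm v * vnorm u"
      using calculation(1) by (intro mult_right_mono) auto
    ultimately have "cmod (f \<omega>) \<le> (\<tau> * (spec_norm (?R0 \<omega>))\<^sup>2) * vnorm v * vnorm u" by (metis order_trans)
    then show ?case by (simp only: mult_ac)
  qed
  have "expectation (\<lambda>\<omega>. cmod (f \<omega>)) \<le> ?\<kappa> * C"
  \<comment> \<open>The factor \<open>?\<kappa>\<close> is divided out on the left, so that the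
    integral on the right is literally the one bounded by C; its vanishing has to be treated
    apart.\<close>
  proof (cases "?\<kappa> = 0")
    case True
    have "AE \<omega> in M. cmod (f \<omega>) = 0" using bound by eventually_elim (use True in simp)
    then have "expectation (\<lambda>\<omega>. cmod (f \<omega>)) = 0" by (subst integral_cong_AE[of _ _ "\<lambda>_. 0"]) (use f_int in auto)
    then show ?thesis by (simp only: True mult_zero_left)
  next
    case False
    then have \<kappa>: "0 < ?\<kappa>" using pos by (simp add: order.strict_iff_order)
    have "ennreal (expectation (\<lambda>\<omega>. cmod (f \<omega>) / ?\<kappa>)) = (\<integral>\<^sup>+\<omega>. ennreal (cmod (f \<omega>) / ?\<kappa>) \<partial>M)"
      by (rule nn_integral_eq_integral[symmetric]) (use f_int \<kappa> in auto)
    also have "\<dots> \<le> (\<integral>\<^sup>+\<omega>. ennreal ((spec_norm (?R0 \<omega>))\<^sup>2) \<partial>M)"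
    proof (rule nn_integral_mono_AE)
      show "AE \<omega> in M. ennreal (cmod (f \<omega>) / ?\<kappa>) \<le> ennreal ((spec_norm (?R0 \<omega>))\<^sup>2)"
        using bound
      proof eventually_elim
        case (elim \<omega>)
        then show ?case using \<kappa> by (intro ennreal_leI) (simp only: pos_divide_le_eq mult.commute)
      qed
    qed
    also have "\<dots> \<le> ennreal C" by (rule C(1))
    finally have "expectation (\<lambda>\<omega>. cmod (f \<omega>) / ?\<kappa>) \<le> C" using C(2) by (simp add: ennreal_le_iff)
    moreover have "expectation (\<lambda>\<omega>. cmod (f \<omega>) / ?\<kappa>) = expectation (\<lambda>\<omega>. cmod (f \<omega>)) / ?\<kappa>" by (rule integral_divide_zero)
    ultimately show ?thesis using \<kappa> by (simp only: pos_divide_le_eq mult.commute)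
  qed
  moreover have "cmod (expectation f) \<le> expectation (\<lambda>\<omega>. cmod (f \<omega>))" by (rule integral_norm_bound)
  ultimately have "cmod (expectation f) \<le> ?\<kappa> * C" by linarith
  then show "cmod (((F - mexp M l l ?R0) *\<^sub>v v) \<bullet>c u) \<le> \<tau> * C * vnorm v * vnorm u"
    unfolding eq by (simp only: mult_ac)
qed

end

section \<open>Gaussian linearizations\<close>

lemma mtrace_mult_diff:
  assumes "U \<in> carrier_mat l l" "V \<in> carrier_mat l l" "W \<in> carrier_mat l l"
  shows "mtrace (U * (V - W)) = mtrace (U * V) - mtrace (U * W)"
proof -
  have "U * (V - W) = U * V - U * W" using assms by (intro mult_minus_distrib_mat) auto
  then show ?thesis using assms by (simp add: mtrace_def sum_subtractf)
qed

text \<open>The data at a single dimension l. Uniformity in l enters later, through bounds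
  \<open>s0\<close> and \<open>e0\<close> common to all dimensions.\<close>

locale gaussian_linearization = prob_space M
  for M :: "'w measure" +
  fixes n d l \<gamma> :: nat and A B Q L :: "'w \<Rightarrow> real mat" and EL :: "real mat"
    and S :: "complex mat \<Rightarrow> complex mat"
    and g :: "'w \<Rightarrow> nat \<Rightarrow> real" and C :: "(nat \<Rightarrow> real) \<Rightarrow> real mat" and z :: complex
  assumes dim: "n + d = l"
    and lin: "linearization M n d A B Q L"
    and EL: "EL = mexp M l l L"
    and S: "pos_linear l l S"
    and z: "z \<in> uhp"
    and g: "gaussian_vector \<gamma> g"
    and C: "\<And>x. x \<in> euc \<gamma> \<Longrightarrow> C x \<in> carrier_mat l l \<and> transpose_mat (C x) = C x"
      "\<And>i j. i < l \<Longrightarrow> j < l \<Longrightarrow> (\<lambda>x. C x $$ (i, j)) \<in> borel_measurable (euc_borel \<gamma>)"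
    and L_eq: "\<And>\<omega>. \<omega> \<in> space M \<Longrightarrow> L \<omega> = C (g \<omega>) + EL"
begin

lemma g_measurable [measurable]: "g \<in> M \<rightarrow>\<^sub>M euc_borel \<gamma>"
  using g by (simp add: gaussian_vector_def)

lemma g_euc: "\<omega> \<in> space M \<Longrightarrow> g \<omega> \<in> euc \<gamma>"
  using measurable_space[OF g_measurable] by (simp add: space_euc_borel)

lemma L_block:
  assumes "\<omega> \<in> space M"
  shows "A \<omega> \<in> carrier_mat n n" "B \<omega> \<in> carrier_mat d n" "Q \<omega> \<in> carrier_mat d d"
    "transpose_mat (A \<omega>) = A \<omega>" "transpose_mat (Q \<omega>) = Q \<omega>"
    "L \<omega> = four_block_mat (A \<omega>) (transpose_mat (B \<omega>)) (B \<omega>) (Q \<omega>)"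
  using lin assms by (auto simp: linearization_def)

lemma L_symmetric:
  assumes \<omega>: "\<omega> \<in> space M"
  shows "L \<omega> \<in> carrier_mat l l" "transpose_mat (L \<omega>) = L \<omega>"
proof -
  note b = L_block[OF \<omega>]
  show "L \<omega> \<in> carrier_mat l l" unfolding b(6) dim[symmetric] using b by simp
  have "transpose_mat (L \<omega>) = four_block_mat (transpose_mat (A \<omega>)) (transpose_mat (B \<omega>))
      (transpose_mat (transpose_mat (B \<omega>))) (transpose_mat (Q \<omega>))"
    unfolding b(6) using b by (intro transpose_four_block_mat) auto
  then show "transpose_mat (L \<omega>) = L \<omega>" using b by simp
qed

lemma EL_symmetric: "EL \<in> carrier_mat l l" "transpose_mat EL = EL"
proof -
  show c: "EL \<in> carrier_mat l l" by (simp add: EL)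
  have "L \<omega> $$ (j, i) = L \<omega> $$ (i, j)" if "\<omega> \<in> space M" "i < l" "j < l" for \<omega> i j
    using L_symmetric[OF that(1)] that index_transpose_mat(1)[of i "L \<omega>" j] by simp
  then have "EL $$ (j, i) = EL $$ (i, j)" if "i < l" "j < l" for i j
    using that by (auto simp: EL mexp_def intro!: Bochner_Integration.integral_cong)
  then show "transpose_mat EL = EL" using c by (intro eq_matI) auto
qed

lemma C_EL:
  assumes "x \<in> euc \<gamma>"
  shows "C x + EL \<in> carrier_mat l l" "transpose_mat (C x + EL) = C x + EL"
  using C(1)[OF assms] EL_symmetric by (auto simp: transpose_add)

lemma AE_invertible: "AE \<omega> in M. det (pencil n d (cmat (L \<omega>)) 0 z) \<noteq> 0"
proof -
  have "AE \<omega> in M. invertible_mat (Q \<omega>)" using lin by (simp add: linearization_def)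
  then show ?thesis using AE_space
  proof eventually_elim
    case (elim \<omega>)
    note b = L_block[OF elim(2)]
    show ?case
    proof (rule pencil_invertible[OF _ _ b(3) elim(1) _ z])
      show "L \<omega> $$ (n + i, n + j) = Q \<omega> $$ (i, j)" if "i < d" "j < d" for i j
        unfolding b(6) using b that by simp
    qed (use L_symmetric[OF elim(2)] dim in auto)
  qed
qed

lemma random_regularized_dyson:
  assumes "\<And>W. W \<in> carrier_mat l l \<Longrightarrow> spec_norm (S W) \<le> s0 * spec_norm W"
    and "spec_norm (cmat EL) \<le> e0" "0 < s0" "0 \<le> e0" "0 < \<tau>"
  shows "random_regularized_dyson M n d l EL S \<tau> s0 e0 z L"
proof unfold_locales
  show "(\<lambda>\<omega>. L \<omega> $$ (i, j)) \<in> borel_measurable M" "integrable M (\<lambda>\<omega>. (L \<omega> $$ (i, j))\<^sup>2)"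
    if "i < l" "j < l" for i j using lin that dim by (auto simp: linearization_def)
qed (fact assms dim EL EL_symmetric S z L_symmetric)+

lemma resolvent_entries:
  assumes "i < l" "j < l"
  shows "(\<lambda>x. resolvent n d (C x + EL) \<tau> z $$ (i, j)) \<in> borel_measurable (euc_borel \<gamma>)"
    "(\<lambda>x. det (pencil n d (cmat (C x + EL)) \<tau> z)) \<in> borel_measurable (euc_borel \<gamma>)"
proof -
  have e: "(\<lambda>x. (C x + EL) $$ (i, j)) \<in> borel_measurable (euc_borel \<gamma>)" if "i < n + d" "j < n + d" for i j
  proof -
    have "(\<lambda>x. C x $$ (i, j) + EL $$ (i, j)) \<in> borel_measurable (euc_borel \<gamma>)"
      using C(2)[of i j] that dim by simp
    moreover have "(C x + EL) $$ (i, j) = C x $$ (i, j) + EL $$ (i, j)" for x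
      using EL_symmetric that dim by auto
    ultimately show ?thesis by simp
  qed
  show "(\<lambda>x. resolvent n d (C x + EL) \<tau> z $$ (i, j)) \<in> borel_measurable (euc_borel \<gamma>)"
    "(\<lambda>x. det (pencil n d (cmat (C x + EL)) \<tau> z)) \<in> borel_measurable (euc_borel \<gamma>)"
    by (rule resolvent_measurable[of "euc_borel \<gamma>" "\<lambda>x. C x + EL" n d i j, OF _ e];
        use C_EL(1) assms dim in \<open>simp add: space_euc_borel\<close>)+
qed

lemma resolvent_carrier:
  "x \<in> euc \<gamma> \<Longrightarrow> resolvent n d (C x + EL) \<tau> z \<in> carrier_mat l l"
  using C_EL(1)[of x] pencil_carrier[of "cmat (C x + EL)" n d \<tau> z] dim
  by (simp add: resolvent_def)

text \<open>Concentration is stated for a positive Lipschitz constant while the given one may be 0;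
  hence the freedom to enlarge it.\<close>

lemma superoperator_field:
  assumes lip: "lipschitz_euc \<gamma> (euc \<gamma>) spec_norm K (\<lambda>x. S (resolvent n d (C x + EL) \<tau> z))"
    and K: "K \<le> K'"
  shows "lipschitz_field \<gamma> l (euc \<gamma>) K' (\<lambda>x. S (resolvent n d (C x + EL) \<tau> z))"
  unfolding lipschitz_field_def
proof (intro conjI ballI allI impI)
  show "0 \<le> K'" using lip K by (simp add: lipschitz_euc_def)
  show "S (resolvent n d (C x + EL) \<tau> z) \<in> carrier_mat l l" if "x \<in> euc \<gamma>" for x
    using S resolvent_carrier[OF that] by (simp add: pos_linear_def)
  show "(\<lambda>x. S (resolvent n d (C x + EL) \<tau> z) $$ (i, j)) \<in> borel_measurable (euc_borel \<gamma>)"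
    if ij: "i < l" "j < l" for i j
  proof -
    have "(\<lambda>x. \<Sum>p\<in>{..<l} \<times> {..<l}. lin_coeff l S i j p * resolvent n d (C x + EL) \<tau> z $$ p)
        \<in> borel_measurable (euc_borel \<gamma>)"
    proof (rule borel_measurable_sum)
      fix p assume "p \<in> {..<l} \<times> {..<l}"
      then show "(\<lambda>x. lin_coeff l S i j p * resolvent n d (C x + EL) \<tau> z $$ p) \<in> borel_measurable (euc_borel \<gamma>)"
        using resolvent_entries(1)[of "fst p" "snd p" \<tau>] by (cases p) simp
    qed
    then show ?thesis
    proof (rule measurable_cong[THEN iffD1, rotated])
      fix x assume "x \<in> space (euc_borel \<gamma>)"
      then have "x \<in> euc \<gamma>" by (simp add: space_euc_borel)
      from pos_linear_entries[OF S resolvent_carrier[OF this] ij, of \<tau>]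
      show "(\<Sum>p\<in>{..<l} \<times> {..<l}. lin_coeff l S i j p * resolvent n d (C x + EL) \<tau> z $$ p)
        = S (resolvent n d (C x + EL) \<tau> z) $$ (i, j)" by (rule sym)
    qed
  qed
  fix x y assume "x \<in> euc \<gamma>" "y \<in> euc \<gamma>"
  then have "spec_norm (S (resolvent n d (C x + EL) \<tau> z) - S (resolvent n d (C y + EL) \<tau> z))
      \<le> K * L2_set (\<lambda>i. x i - y i) {..<\<gamma>}" using lip by (simp add: lipschitz_euc_def)
  also have "\<dots> \<le> K' * L2_set (\<lambda>i. x i - y i) {..<\<gamma>}" using K by (intro mult_right_mono) auto
  finally show "spec_norm (S (resolvent n d (C x + EL) \<tau> z) - S (resolvent n d (C y + EL) \<tau> z))
      \<le> K' * L2_set (\<lambda>i. x i - y i) {..<\<gamma>}" .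
qed

lemma mexp_cong: "(\<And>\<omega>. \<omega> \<in> space M \<Longrightarrow> X \<omega> = Y \<omega>) \<Longrightarrow> mexp M a b X = mexp M a b Y"
  by (auto simp: mexp_def intro!: eq_matI Bochner_Integration.integral_cong)

text \<open>Concentration supplies the majorant Z for the fluctuation,
  \<open>dyson_error_norm\<close> the defect, and \<open>stability\<close> the conclusion. The
  strict inequality \<open>K < K'\<close> makes \<open>K'\<close>, and with it
  \<open>\<delta>\<close>, positive as stability demands.\<close>

lemma expected_resolvent_near_dyson:
  assumes S_norm: "\<And>W. W \<in> carrier_mat l l \<Longrightarrow> spec_norm (S W) \<le> s0 * spec_norm W"
    and pos: "spec_norm (cmat EL) \<le> e0" "0 < s0" "0 \<le> e0" "0 < \<tau>" "0 < l"
    and lip: "lipschitz_euc \<gamma> (euc \<gamma>) spec_norm K (\<lambda>x. S (resolvent n d (C x + EL) \<tau> z))" "K < K'"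
    and W: "reg_dyson_solution n d EL S \<tau> W"
    and \<delta>: "\<delta> = spec_norm (Delta M n d L \<tau> z) + op_norm l (S_tilde M l L S) / \<tau>\<^sup>2 + 52 * K' * sqrt (real l) / \<tau>"
      "\<delta> \<le> regularized_dyson.gap \<tau> s0 e0 z"
  shows "spec_norm (mexp M l l (\<lambda>\<omega>. resolvent n d (L \<omega>) \<tau> z) - W z) \<le> regularized_dyson.stability_const \<tau> s0 e0 z * \<delta>"
proof -
  interpret rd: random_regularized_dyson M n d l EL S \<tau> s0 e0 z L
    by (rule random_regularized_dyson) (fact S_norm pos)+
  let ?\<Phi> = "\<lambda>x. S (resolvent n d (C x + EL) \<tau> z)"
  have K': "0 < K'" using lip by (auto simp: lipschitz_euc_def)
  have \<Phi>g: "S (rd.R \<omega>) = ?\<Phi> (g \<omega>)" if "\<omega> \<in> space M" for \<omega> by (simp add: rd.R_def L_eq[OF that])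
  have SF: "S rd.F = mexp M l l (\<lambda>\<omega>. ?\<Phi> (g \<omega>))" unfolding rd.S_F by (rule mexp_cong) (rule \<Phi>g)
  have Fe: "rd.F = mexp M l l (\<lambda>\<omega>. resolvent n d (L \<omega>) \<tau> z)" by (simp add: rd.F_def rd.R_def[abs_def])
  from gaussian_matrix_concentration[OF g superoperator_field[OF lip(1) less_imp_le[OF lip(2)]] K' pos(5)]
  obtain Z where Z: "integrable M Z"
      "\<And>\<omega>. \<omega> \<in> space M \<Longrightarrow> spec_norm (?\<Phi> (g \<omega>) - mexp M l l (\<lambda>\<omega>. ?\<Phi> (g \<omega>))) \<le> Z \<omega>"
      "expectation Z \<le> 52 * K' * sqrt (real l)" by blast
  have "spec_norm (S (rd.R \<omega>) - S rd.F) \<le> Z \<omega>" if "\<omega> \<in> space M" for \<omega>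
    unfolding SF \<Phi>g[OF that] by (rule Z(2)[OF that])
  note E = rd.dyson_error_norm[OF Z(1) this Z(3)]
  have op0: "0 \<le> op_norm l rd.St"
    using order_trans[OF spec_norm_nonneg rd.St_norm[of "0\<^sub>m l l"]] by simp
  have \<delta>0: "0 < \<delta>" unfolding \<delta>(1) rd.St_def[symmetric] using op0 K' pos
    by (intro add_nonneg_pos add_nonneg_nonneg divide_pos_pos mult_pos_pos divide_nonneg_nonneg) auto
  have Wc: "W z \<in> carrier_mat l l" and Wpd: "pd l (im_part (W z))" and Weq: "rd.X (W z) * W z = 1\<^sub>m l"
    using W z dim by (auto simp: reg_dyson_solution_def holomorphic_mat_def dyson_eq_def rd.X_def)
  have Wim: "0 \<le> Im ((W z *\<^sub>v v) \<bullet>c v)" if "v \<in> carrier_vec l" for v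
    using psd_im_part_iff[OF Wc] pd_imp_psd[OF Wpd] that by blast
  show ?thesis
    unfolding Fe[symmetric]
  proof (rule rd.stability[OF rd.F_carrier rd.F_im rd.F_norm _ rd.dyson_error _ Wc Wim Weq \<delta>0 \<delta>(2)])
    show "mexp M l l rd.Y - Delta M n d L \<tau> z \<in> carrier_mat l l" using rd.Delta_carrier by simp
    show "spec_norm (mexp M l l rd.Y - Delta M n d L \<tau> z) \<le> \<delta>" using E by (simp add: \<delta>(1) rd.St_def)
  qed
qed

text \<open>The Gaussian parameters at which the unregularized resolvent is a true inverse; they
  have full probability, because Q is almost surely invertible.\<close>

definition D :: "(nat \<Rightarrow> real) set" where
  "D = {x \<in> euc \<gamma>. invertible_mat (pencil n d (cmat (C x + EL)) 0 z)}"

definition R0 :: "(nat \<Rightarrow> real) \<Rightarrow> complex mat" where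
  "R0 x = resolvent n d (C x + EL) 0 z"

lemma D_iff:
  assumes "x \<in> euc \<gamma>"
  shows "x \<in> D \<longleftrightarrow> det (pencil n d (cmat (C x + EL)) 0 z) \<noteq> 0"
  using assms C_EL(1)[OF assms] dim invertible_mat_iff_det[OF pencil_carrier[of "cmat (C x + EL)" n d 0 z]]
  by (simp add: D_def)

lemma almost_domain_D: "almost_domain \<gamma> g D"
  unfolding almost_domain_def
proof (intro conjI g)
  have "D = {x \<in> space (euc_borel \<gamma>). det (pencil n d (cmat (C x + EL)) 0 z) \<noteq> 0}"
    using D_iff by (auto simp: space_euc_borel D_def)
  moreover have "(\<lambda>x. det (pencil n d (cmat (C x + EL)) 0 z)) \<in> borel_measurable (euc_borel \<gamma>)"
  \<comment> \<open>Measurability of the determinant was derived together with that of an entry,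
    hence for a valid pair of indices; in dimension 0 there is none.\<close>
  proof (cases "l = 0")
    case True
    have "det (pencil n d (cmat (C x + EL)) 0 z) = 1" if "x \<in> space (euc_borel \<gamma>)" for x
    proof -
      have "pencil n d (cmat (C x + EL)) 0 z \<in> carrier_mat 0 0"
        using pencil_carrier[of "cmat (C x + EL)" n d 0 z] C_EL(1)[of x] that dim True by (simp add: space_euc_borel)
      then show ?thesis by (rule det_dim_zero)
    qed
    then have "(\<lambda>x. det (pencil n d (cmat (C x + EL)) 0 z)) \<in> borel_measurable (euc_borel \<gamma>)
        \<longleftrightarrow> (\<lambda>x. 1 :: complex) \<in> borel_measurable (euc_borel \<gamma>)"
      by (rule measurable_cong)
    then show ?thesis by simp
  qed (use resolvent_entries(2)[of 0 0 0] in simp)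
  ultimately show "D \<in> sets (euc_borel \<gamma>)" by simp
  show "AE \<omega> in M. g \<omega> \<in> D"
    using AE_invertible AE_space by eventually_elim (simp add: D_iff g_euc L_eq)
qed

context
  fixes K :: real
  assumes lip: "lipschitz_euc \<gamma> {x \<in> euc \<gamma>. invertible_mat (pencil n d (cmat (C x + EL)) 0 z)}
      frob_norm K (\<lambda>x. resolvent n d (C x + EL) 0 z)"
begin

lemma resolvent_field: "lipschitz_field \<gamma> l D K R0"
  unfolding lipschitz_field_def
  using lip[folded D_def] resolvent_carrier resolvent_entries(1)[of _ _ 0] order_trans[OF spec_le_frob]
  by (auto simp: lipschitz_euc_def R0_def[abs_def])

lemma resolvent_integrable: "integrable_mat l (\<lambda>\<omega>. R0 (g \<omega>))"
  by (rule gaussian_lipschitz_integrable[OF almost_domain_D resolvent_field])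

lemma resolvent_regularization_error:
  assumes S_norm: "\<And>W. W \<in> carrier_mat l l \<Longrightarrow> spec_norm (S W) \<le> s0 * spec_norm W"
    and pos: "spec_norm (cmat EL) \<le> e0" "0 < s0" "0 \<le> e0" "0 < \<tau>"
    and b: "(\<integral>\<^sup>+\<omega>. ennreal ((spec_norm (resolvent n d (L \<omega>) 0 z))\<^sup>2) \<partial>M) \<le> ennreal b" "0 \<le> b"
  shows "spec_norm (mexp M l l (\<lambda>\<omega>. resolvent n d (L \<omega>) \<tau> z) - mexp M l l (\<lambda>\<omega>. resolvent n d (L \<omega>) 0 z)) \<le> \<tau> * b"
proof -
  interpret rd: random_regularized_dyson M n d l EL S \<tau> s0 e0 z L
    by (rule random_regularized_dyson) (fact S_norm pos)+
  have "integrable_mat l (\<lambda>\<omega>. resolvent n d (L \<omega>) 0 z)"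
  proof -
    have "resolvent n d (L \<omega>) 0 z = R0 (g \<omega>)" if "\<omega> \<in> space M" for \<omega> by (simp add: R0_def L_eq[OF that])
    moreover from this have "integrable M (\<lambda>\<omega>. resolvent n d (L \<omega>) 0 z $$ (i, j)) \<longleftrightarrow> integrable M (\<lambda>\<omega>. R0 (g \<omega>) $$ (i, j))" for i j
      by (intro Bochner_Integration.integrable_cong) auto
    ultimately show ?thesis using resolvent_integrable by (simp add: integrable_mat_def)
  qed
  from rd.regularization_error[OF this AE_invertible b] show ?thesis
    by (simp add: rd.F_def rd.R_def[abs_def])
qed

text \<open>Trace duality and the domination of the spectral by the Frobenius norm make the trace
  K-Lipschitz on \<open>D\<close>. A deviation of modulus e forces the real or the imaginary part to
  deviate by e / 2: this turns the 4 in the exponent into 16, and two two-sided tails add up to the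
  factor 4.\<close>

lemma resolvent_trace_tail:
  assumes U: "U \<in> carrier_mat l l" "nuc_norm U \<le> 1" and K: "0 < K" and e: "0 < e"
  defines "Y \<equiv> \<lambda>\<omega>. mtrace (U * (resolvent n d (L \<omega>) 0 z - mexp M l l (\<lambda>\<omega>. resolvent n d (L \<omega>) 0 z)))"
  shows "{\<omega> \<in> space M. e \<le> cmod (Y \<omega>)} \<in> events"
    "prob {\<omega> \<in> space M. e \<le> cmod (Y \<omega>)} \<le> 4 * exp (- (e\<^sup>2 / (16 * K\<^sup>2)))"
proof -
  \<comment> \<open>Written through entries, f is measurable on the whole space; it agrees with the
    trace wherever the matrices have the right size.\<close>
  define f where "f x = (\<Sum>i<l. \<Sum>j<l. U $$ (i, j) * R0 x $$ (j, i))" for x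
  have R0c: "R0 x \<in> carrier_mat l l" if "x \<in> euc \<gamma>" for x using resolvent_carrier[OF that] by (simp add: R0_def)
  have f: "f x = mtrace (U * R0 x)" if "x \<in> euc \<gamma>" for x
    unfolding f_def using mtrace_mult[OF U(1) R0c[OF that]] by simp
  have f_meas [measurable]: "f \<in> borel_measurable (euc_borel \<gamma>)"
    unfolding f_def[abs_def]
  proof (intro borel_measurable_sum)
    fix i j assume "i \<in> {..<l}" "j \<in> {..<l}"
    then show "(\<lambda>x. U $$ (i, j) * R0 x $$ (j, i)) \<in> borel_measurable (euc_borel \<gamma>)"
      using resolvent_entries(1)[of j i 0] by (simp add: R0_def)
  qed
  have D_euc: "x \<in> euc \<gamma>" if "x \<in> D" for x using that by (simp add: D_def)
  have f_lip: "cmod (f x - f y) \<le> K * L2_set (\<lambda>i. x i - y i) {..<\<gamma>}" if "x \<in> D" "y \<in> D" for x y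
  proof -
    note c = R0c[OF D_euc[OF that(1)]] R0c[OF D_euc[OF that(2)]]
    have "cmod (f x - f y) = cmod (mtrace (U * (R0 x - R0 y)))"
      using that D_euc by (simp add: f mtrace_mult_diff[OF U(1) c])
    also have "\<dots> \<le> nuc_norm U * spec_norm (R0 x - R0 y)" using c by (intro trace_duality[OF U(1)]) auto
    also have "\<dots> \<le> spec_norm (R0 x - R0 y)" using U(2) mult_right_mono[OF U(2) spec_norm_nonneg] by simp
    also have "\<dots> \<le> K * L2_set (\<lambda>i. x i - y i) {..<\<gamma>}"
      using resolvent_field that by (simp add: lipschitz_field_def)
    finally show ?thesis .
  qed
  have res: "resolvent n d (L \<omega>) 0 z = R0 (g \<omega>)" if "\<omega> \<in> space M" for \<omega> by (simp add: R0_def L_eq[OF that])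
  have int: "integrable M (\<lambda>\<omega>. R0 (g \<omega>) $$ (i, j))" if "i < l" "j < l" for i j
    using resolvent_integrable that by (simp add: integrable_mat_def)
  have f_int: "integrable M (\<lambda>\<omega>. f (g \<omega>))"
    unfolding f_def using int by (intro Bochner_Integration.integrable_sum integrable_mult_right) auto
  let ?E = "mexp M l l (\<lambda>\<omega>. R0 (g \<omega>))"
  have E: "mexp M l l (\<lambda>\<omega>. resolvent n d (L \<omega>) 0 z) = ?E" by (rule mexp_cong) (rule res)
  have "expectation (\<lambda>\<omega>. f (g \<omega>)) = (\<Sum>i<l. \<Sum>j<l. U $$ (i, j) * expectation (\<lambda>\<omega>. R0 (g \<omega>) $$ (j, i)))"
  proof -
    have "expectation (\<lambda>\<omega>. f (g \<omega>)) = (\<Sum>i<l. expectation (\<lambda>\<omega>. \<Sum>j<l. U $$ (i, j) * R0 (g \<omega>) $$ (j, i)))"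
      unfolding f_def using int
      by (intro Bochner_Integration.integral_sum Bochner_Integration.integrable_sum integrable_mult_right) auto
    also have "\<dots> = (\<Sum>i<l. \<Sum>j<l. expectation (\<lambda>\<omega>. U $$ (i, j) * R0 (g \<omega>) $$ (j, i)))"
      using int by (intro sum.cong refl Bochner_Integration.integral_sum integrable_mult_right) auto
    finally show ?thesis by simp
  qed
  also have "\<dots> = mtrace (U * ?E)"
    unfolding mtrace_mult[OF U(1) mexp_carrier] by (intro sum.cong) (auto simp: mexp_def)
  finally have fE: "expectation (\<lambda>\<omega>. f (g \<omega>)) = mtrace (U * ?E)" .
  have Y: "Y \<omega> = f (g \<omega>) - expectation (\<lambda>\<omega>. f (g \<omega>))" if \<omega>: "\<omega> \<in> space M" for \<omega>
    unfolding Y_def E res[OF \<omega>] fE f[OF g_euc[OF \<omega>]]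
    by (rule mtrace_mult_diff[OF U(1) R0c[OF g_euc[OF \<omega>]] mexp_carrier])
  have set_eq: "{\<omega> \<in> space M. e \<le> cmod (Y \<omega>)} = {\<omega> \<in> space M. e \<le> cmod (f (g \<omega>) - expectation (\<lambda>\<omega>. f (g \<omega>)))}"
    using Y by auto
  show "{\<omega> \<in> space M. e \<le> cmod (Y \<omega>)} \<in> events" unfolding set_eq by measurable
  have Re_int: "expectation (\<lambda>\<omega>. Re (f (g \<omega>))) = Re (expectation (\<lambda>\<omega>. f (g \<omega>)))"
    "expectation (\<lambda>\<omega>. Im (f (g \<omega>))) = Im (expectation (\<lambda>\<omega>. f (g \<omega>)))"
    using f_int by (auto simp: integral_Re integral_Im)
  have AD: "D \<in> sets (euc_borel \<gamma>)" "AE \<omega> in M. g \<omega> \<in> D" using almost_domain_D by (simp_all add: almost_domain_def)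
  let ?A = "{\<omega> \<in> space M. e / 2 \<le> \<bar>Re (f (g \<omega>)) - expectation (\<lambda>\<omega>. Re (f (g \<omega>)))\<bar>}"
  let ?B = "{\<omega> \<in> space M. e / 2 \<le> \<bar>Im (f (g \<omega>)) - expectation (\<lambda>\<omega>. Im (f (g \<omega>)))\<bar>}"
  have lipR: "\<bar>Re (f x) - Re (f y)\<bar> \<le> K * L2_set (\<lambda>i. x i - y i) {..<\<gamma>}" if "x \<in> D" "y \<in> D" for x y
    using f_lip[OF that] abs_Re_le_cmod[of "f x - f y"] by simp
  have lipI: "\<bar>Im (f x) - Im (f y)\<bar> \<le> K * L2_set (\<lambda>i. x i - y i) {..<\<gamma>}" if "x \<in> D" "y \<in> D" for x y
    using f_lip[OF that] abs_Im_le_cmod[of "f x - f y"] by simp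
  have e2: "0 < e / 2" using e by simp
  have mR: "(\<lambda>x. Re (f x)) \<in> borel_measurable (euc_borel \<gamma>)" and mI: "(\<lambda>x. Im (f x)) \<in> borel_measurable (euc_borel \<gamma>)"
    by measurable
  have pA: "prob ?A \<le> 2 * exp (- ((e / 2)\<^sup>2 / (4 * K\<^sup>2)))"
    by (rule gaussian_lipschitz_tail[where f = "\<lambda>x. Re (f x)", OF g mR AD K lipR e2])
  have pB: "prob ?B \<le> 2 * exp (- ((e / 2)\<^sup>2 / (4 * K\<^sup>2)))"
    by (rule gaussian_lipschitz_tail[where f = "\<lambda>x. Im (f x)", OF g mI AD K lipI e2])
  have "prob {\<omega> \<in> space M. e \<le> cmod (Y \<omega>)} \<le> prob (?A \<union> ?B)"
    unfolding set_eq
  proof (rule finite_measure_mono)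
    show "{\<omega> \<in> space M. e \<le> cmod (f (g \<omega>) - expectation (\<lambda>\<omega>. f (g \<omega>)))} \<subseteq> ?A \<union> ?B"
    proof
      fix \<omega> assume "\<omega> \<in> {\<omega> \<in> space M. e \<le> cmod (f (g \<omega>) - expectation (\<lambda>\<omega>. f (g \<omega>)))}"
      then have \<omega>: "\<omega> \<in> space M" "e \<le> cmod (f (g \<omega>) - expectation (\<lambda>\<omega>. f (g \<omega>)))" by auto
      have "e \<le> \<bar>Re (f (g \<omega>)) - expectation (\<lambda>\<omega>. Re (f (g \<omega>)))\<bar> + \<bar>Im (f (g \<omega>)) - expectation (\<lambda>\<omega>. Im (f (g \<omega>)))\<bar>"
        using \<omega>(2) cmod_le[of "f (g \<omega>) - expectation (\<lambda>\<omega>. f (g \<omega>))"] by (simp add: Re_int)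
      then have "e / 2 \<le> \<bar>Re (f (g \<omega>)) - expectation (\<lambda>\<omega>. Re (f (g \<omega>)))\<bar> \<or> e / 2 \<le> \<bar>Im (f (g \<omega>)) - expectation (\<lambda>\<omega>. Im (f (g \<omega>)))\<bar>"
        by linarith
      then show "\<omega> \<in> ?A \<union> ?B" using \<omega>(1) by blast
    qed
    show "?A \<union> ?B \<in> events" by measurable
  qed
  also have "\<dots> \<le> prob ?A + prob ?B" by (rule measure_Un_le) measurable
  also have "\<dots> \<le> 4 * exp (- ((e / 2)\<^sup>2 / (4 * K\<^sup>2)))" using pA pB by linarith
  also have "(e / 2)\<^sup>2 / (4 * K\<^sup>2) = e\<^sup>2 / (16 * K\<^sup>2)" by (simp add: power_divide)
  finally show "prob {\<omega> \<in> space M. e \<le> cmod (Y \<omega>)} \<le> 4 * exp (- (e\<^sup>2 / (16 * K\<^sup>2)))" .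
qed

end

end

section \<open>Limits along the sequence of dimensions\<close>

lemma limsup_ereal_bounded:
  fixes f :: "nat \<Rightarrow> real"
  assumes "limsup (\<lambda>l. ereal (f l)) < \<infinity>"
  obtains b where "0 < b" "\<forall>\<^sub>F l in sequentially. f l \<le> b"
proof -
  obtain y where y: "limsup (\<lambda>l. ereal (f l)) < y" "y < \<infinity>" using dense[OF assms] by blast
  then obtain b where b: "y = ereal b" by (cases y) auto
  have "\<forall>\<^sub>F l in sequentially. ereal (f l) < y"
    by (rule Limsup_lessD[OF y(1)])
  then have "\<forall>\<^sub>F l in sequentially. f l \<le> max 1 b" by eventually_elim (simp add: b)
  then show thesis by (intro that[of "max 1 b"]) auto
qed

lemma limsup_ennreal_bounded:
  fixes f :: "nat \<Rightarrow> ennreal"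
  assumes "limsup f < \<infinity>"
  obtains b where "0 \<le> b" "\<forall>\<^sub>F l in sequentially. f l \<le> ennreal b"
proof -
  obtain y where y: "limsup f < y" "y < \<infinity>" using dense[OF assms] by blast
  then obtain b where b: "y = ennreal b" "0 \<le> b" by (cases y) auto
  have "\<forall>\<^sub>F l in sequentially. f l < y"
    by (rule Limsup_lessD[OF y(1)])
  then have "\<forall>\<^sub>F l in sequentially. f l \<le> ennreal b" by eventually_elim (simp add: b)
  then show thesis by (rule that[OF b(2)])
qed

text \<open>Borel-Cantelli for each threshold 1 / (k + 1), followed by a countable intersection.
  Only the summability of the tails matters, so the joint law of the different dimensions may be
  arbitrary.\<close>

lemma (in prob_space) summable_tails_tendsto:
  fixes Y :: "nat \<Rightarrow> 'a \<Rightarrow> complex"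
  assumes Y: "\<And>e. 0 < e \<Longrightarrow> \<forall>\<^sub>F l in sequentially. {\<omega> \<in> space M. e \<le> cmod (Y l \<omega>)} \<in> events \<and>
      prob {\<omega> \<in> space M. e \<le> cmod (Y l \<omega>)} \<le> b e l"
    and b: "\<And>e. 0 < e \<Longrightarrow> summable (b e)"
  shows "AE \<omega> in M. (\<lambda>l. Y l \<omega>) \<longlonglongrightarrow> 0"
proof -
  have "AE \<omega> in M. \<forall>\<^sub>F l in sequentially. cmod (Y l \<omega>) < e" if e: "0 < e" for e
  proof -
    obtain N where N: "\<And>l. N \<le> l \<Longrightarrow> {\<omega> \<in> space M. e \<le> cmod (Y l \<omega>)} \<in> events"
        "\<And>l. N \<le> l \<Longrightarrow> prob {\<omega> \<in> space M. e \<le> cmod (Y l \<omega>)} \<le> b e l"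
      using Y[OF e] by (auto simp: eventually_sequentially)
    \<comment> \<open>The tail sets are known to be events only from N on, hence the shift of the
      index.\<close>
    let ?A = "\<lambda>l. {\<omega> \<in> space M. e \<le> cmod (Y (l + N) \<omega>)}"
    have "AE \<omega> in M. \<forall>\<^sub>F l in sequentially. \<omega> \<in> space M - ?A l"
    proof (rule borel_cantelli_AE1)
      show "?A l \<in> events" for l by (rule N(1)) simp
      show "emeasure M (?A l) < \<infinity>" for l by (simp add: emeasure_eq_measure)
      show "summable (\<lambda>l. prob (?A l))"
      proof (rule summable_comparison_test')
        show "summable (\<lambda>l. b e (l + N))" using b[OF e] by (rule summable_ignore_initial_segment)
        show "norm (prob (?A l)) \<le> b e (l + N)" if "0 \<le> l" for l using N(2)[of "l + N"] by simp
      qed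
    qed
    then show ?thesis
    proof eventually_elim
      case (elim \<omega>)
      then have "\<forall>\<^sub>F l in sequentially. cmod (Y (l + N) \<omega>) < e" by eventually_elim auto
      then show ?case using eventually_sequentially_seg[of "\<lambda>l. cmod (Y l \<omega>) < e" N] by simp
    qed
  qed
  then have "AE \<omega> in M. \<forall>k. \<forall>\<^sub>F l in sequentially. cmod (Y l \<omega>) < 1 / real (Suc k)"
    unfolding AE_all_countable by simp
  then show ?thesis
  proof eventually_elim
    case (elim \<omega>)
    show ?case
    proof (rule tendstoI)
      fix e :: real assume "0 < e"
      then obtain k where k: "1 / real (Suc k) < e" using nat_approx_posE by blast
      from elim have "\<forall>\<^sub>F l in sequentially. cmod (Y l \<omega>) < 1 / real (Suc k)" by blast
      then show "\<forall>\<^sub>F l in sequentially. dist (Y l \<omega>) 0 < e" by eventually_elim (use k in simp)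
    qed
  qed
qed

text \<open>With Lipschitz constant c l^(-r) the exponent grows like l^(2 r), so the tails decay
  faster than any power of l; comparison with l^(-2) suffices for every r > 0.\<close>

lemma summable_gaussian_tails:
  fixes e c r :: real
  assumes "0 < e" "0 < c" "0 < r"
  shows "summable (\<lambda>l. 4 * exp (- (e\<^sup>2 / (16 * (c * real l powr (- r))\<^sup>2))))"
proof (rule summable_comparison_test_ev)
  have "(\<lambda>l. 4 * exp (- (e\<^sup>2 / (16 * (c * real l powr (- r))\<^sup>2))) * (real l)\<^sup>2) \<longlonglongrightarrow> 0"
    using assms by real_asymp
  then have "\<forall>\<^sub>F l in sequentially. 4 * exp (- (e\<^sup>2 / (16 * (c * real l powr (- r))\<^sup>2))) * (real l)\<^sup>2 < 1"
    by (rule order_tendstoD) simp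
  then show "\<forall>\<^sub>F l in sequentially. norm (4 * exp (- (e\<^sup>2 / (16 * (c * real l powr (- r))\<^sup>2)))) \<le> inverse ((real l)\<^sup>2)"
    using eventually_gt_at_top[of 0] by eventually_elim (simp add: field_simps)
  show "summable (\<lambda>l. inverse ((real l)\<^sup>2))" by (rule inverse_power_summable) simp
qed

theorem theorem2p2:
  fixes P :: "'w measure"
    and n d \<gamma> :: "nat \<Rightarrow> nat"
    and A B Q L :: "nat \<Rightarrow> 'w \<Rightarrow> real mat"
    and EL :: "nat \<Rightarrow> real mat"
    and S11 S :: "nat \<Rightarrow> complex mat \<Rightarrow> complex mat"
    and M :: "nat \<Rightarrow> complex \<Rightarrow> complex mat"
    and Mreg :: "nat \<Rightarrow> real \<Rightarrow> complex \<Rightarrow> complex mat"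
    and g :: "nat \<Rightarrow> 'w \<Rightarrow> nat \<Rightarrow> real"
    and C :: "nat \<Rightarrow> (nat \<Rightarrow> real) \<Rightarrow> real mat"
    and s :: "nat \<Rightarrow> real"
    and lam :: "nat \<Rightarrow> real \<Rightarrow> real"
    and c r :: real
    and z :: complex
    and U :: "nat \<Rightarrow> complex mat"
  assumes prob: "prob_space P"
    and dims: "\<And>l. n l + d l = l"
    and lin: "\<And>l. linearization P (n l) (d l) (A l) (B l) (Q l) (L l)"
    and EL: "\<And>l. EL l = mexp P l l (L l)"
    and superop: "\<And>l. superoperator P (n l) (d l) (A l) (B l) (S11 l) (S l)"
    and M: "\<And>l. dyson_solution (n l) (d l) (EL l) (S l) (M l)"
    and Mreg: "\<And>l \<tau>. \<tau> > 0 \<Longrightarrow> reg_dyson_solution (n l) (d l) (EL l) (S l) \<tau> (Mreg l \<tau>)"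
    and z: "z \<in> uhp"
    and C1_s: "\<And>l. s l > 0"
      "\<And>l W. W \<in> carrier_mat l l \<Longrightarrow> spec_norm (S l W) \<le> s l * spec_norm W"
      "limsup (\<lambda>l. ereal (s l)) < \<infinity>"
    and C1_EL: "limsup (\<lambda>l. ereal (spec_norm (cmat (EL l)))) < \<infinity>"
    and C1_res: "limsup (\<lambda>l. \<integral>\<^sup>+ \<omega>. ennreal ((spec_norm (resolvent (n l) (d l) (L l \<omega>) 0 z))\<^sup>2) \<partial>P) < \<infinity>"
    and C2: "\<And>w. w \<in> uhp \<Longrightarrow>
      \<exists>(f :: real \<Rightarrow> real) (t :: nat \<Rightarrow> real).
        (\<forall>k. t k > 0) \<and> t \<longlonglongrightarrow> 0 \<and> (\<lambda>k. f (t k)) \<longlonglongrightarrow> 0 \<and>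
        (\<forall>k. \<exists>e :: nat \<Rightarrow> real. e \<longlonglongrightarrow> 0 \<and>
           (\<forall>\<^sub>F l in sequentially. spec_norm (Mreg l (t k) w - M l w) \<le> f (t k) + e l))"
    and C3_g: "\<And>l. g l \<in> P \<rightarrow>\<^sub>M euc_borel (\<gamma> l)"
      "\<And>l. distr P (euc_borel (\<gamma> l)) (g l) = std_gauss (\<gamma> l)"
    and C3_C: "\<And>l x. x \<in> euc (\<gamma> l) \<Longrightarrow> C l x \<in> carrier_mat l l \<and> transpose_mat (C l x) = C l x"
      "\<And>l i j. i < l \<Longrightarrow> j < l \<Longrightarrow> (\<lambda>x. C l x $$ (i, j)) \<in> borel_measurable (euc_borel (\<gamma> l))"
      "\<And>l. mexp P l l (\<lambda>\<omega>. C l (g l \<omega>)) = 0\<^sub>m l l"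
    and C3_L: "\<And>l \<omega>. \<omega> \<in> space P \<Longrightarrow> L l \<omega> = C l (g l \<omega>) + EL l"
    and small_tau: "\<exists>\<tau>0>0. \<forall>\<tau>. 0 < \<tau> \<and> \<tau> < \<tau>0 \<longrightarrow>
      (\<forall>l. lipschitz_euc (\<gamma> l) (euc (\<gamma> l)) spec_norm (lam l \<tau>)
             (\<lambda>x. S l (resolvent (n l) (d l) (C l x + EL l) \<tau> z))) \<and>
      (\<lambda>l. sqrt (real l) * lam l \<tau>) \<longlonglongrightarrow> 0 \<and>
      (\<lambda>l. op_norm l (S_tilde P l (L l) (S l))) \<longlonglongrightarrow> 0 \<and>
      (\<lambda>l. spec_norm (Delta P (n l) (d l) (L l) \<tau> z)) \<longlonglongrightarrow> 0"
    and cr: "c > 0" "r > 0"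
    and res_lipschitz: "\<And>l. lipschitz_euc (\<gamma> l)
      {x \<in> euc (\<gamma> l). invertible_mat (pencil (n l) (d l) (cmat (C l x + EL l)) 0 z)}
      frob_norm (c * real l powr (- r)) (\<lambda>x. resolvent (n l) (d l) (C l x + EL l) 0 z)"
    and U: "\<And>l. U l \<in> carrier_mat l l" "\<And>l. nuc_norm (U l) \<le> 1"
  shows "AE \<omega> in P. (\<lambda>l. mtrace (U l * (resolvent (n l) (d l) (L l \<omega>) 0 z - M l z))) \<longlonglongrightarrow> 0"
proof -
  interpret prob_space P by (rule prob)
  obtain s1 where s1: "0 < s1" "\<forall>\<^sub>F l in sequentially. s l \<le> s1" by (rule limsup_ereal_bounded[OF C1_s(3)])
  obtain e1 where e1: "0 < e1" "\<forall>\<^sub>F l in sequentially. spec_norm (cmat (EL l)) \<le> e1"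
    by (rule limsup_ereal_bounded[OF C1_EL])
  obtain b where b: "0 \<le> b" "\<forall>\<^sub>F l in sequentially.
      (\<integral>\<^sup>+ \<omega>. ennreal ((spec_norm (resolvent (n l) (d l) (L l \<omega>) 0 z))\<^sup>2) \<partial>P) \<le> ennreal b"
    by (rule limsup_ennreal_bounded[OF C1_res])
  obtain \<tau>0 where \<tau>0: "0 < \<tau>0" and small: "\<And>\<tau>. 0 < \<tau> \<Longrightarrow> \<tau> < \<tau>0 \<Longrightarrow>
      (\<forall>l. lipschitz_euc (\<gamma> l) (euc (\<gamma> l)) spec_norm (lam l \<tau>)
             (\<lambda>x. S l (resolvent (n l) (d l) (C l x + EL l) \<tau> z))) \<and>
      (\<lambda>l. sqrt (real l) * lam l \<tau>) \<longlonglongrightarrow> 0 \<and>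
      (\<lambda>l. op_norm l (S_tilde P l (L l) (S l))) \<longlonglongrightarrow> 0 \<and>
      (\<lambda>l. spec_norm (Delta P (n l) (d l) (L l) \<tau> z)) \<longlonglongrightarrow> 0"
    using small_tau by blast
  have gl: "gaussian_linearization P (n l) (d l) l (\<gamma> l) (A l) (B l) (Q l) (L l) (EL l) (S l) (g l) (C l) z" for l
  proof (rule gaussian_linearization.intro[OF prob gaussian_linearization_axioms.intro])
    show "pos_linear l l (S l)" using superop[of l] dims[of l] by (simp add: superoperator_def)
    show "gaussian_vector (\<gamma> l) (g l)" using C3_g by (simp add: gaussian_vector_def)
  qed (fact dims lin EL z | rule C3_C C3_L | assumption)+
  \<comment> \<open>Replacing \<open>s l\<close> by the common bound \<open>s1\<close> makes the gap
    and the stability constant independent of l.\<close>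
  have S_norm: "spec_norm (S l W) \<le> s1 * spec_norm W" if "s l \<le> s1" "W \<in> carrier_mat l l" for l W
    using C1_s(2)[OF that(2)] mult_right_mono[OF that(1) spec_norm_nonneg[of W]] by linarith
  define F where "F \<tau> l = mexp P l l (\<lambda>\<omega>. resolvent (n l) (d l) (L l \<omega>) \<tau> z)" for \<tau> l
  have Fc: "F \<tau> l \<in> carrier_mat l l" for \<tau> l by (simp add: F_def)
  have Mc: "M l z \<in> carrier_mat l l" for l
    using M[of l] z dims[of l] by (simp add: dyson_solution_def holomorphic_mat_def)
  have Mregc: "Mreg l \<tau> z \<in> carrier_mat l l" if "0 < \<tau>" for l \<tau>
    using Mreg[OF that, of l] z dims[of l] by (simp add: reg_dyson_solution_def holomorphic_mat_def)
  have reg: "(\<lambda>l. spec_norm (F \<tau> l - Mreg l \<tau> z)) \<longlonglongrightarrow> 0" if \<tau>: "0 < \<tau>" "\<tau> < \<tau>0" for \<tau>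
  proof -
    note sm = small[OF \<tau>]
    \<comment> \<open>The summand 1 / l makes the Lipschitz constant positive even if
      \<open>lam l \<tau>\<close> vanishes; multiplied by sqrt l it still tends to 0.\<close>
    let ?K = "\<lambda>l. lam l \<tau> + 1 / real l"
    define \<delta> where "\<delta> l = spec_norm (Delta P (n l) (d l) (L l) \<tau> z)
      + op_norm l (S_tilde P l (L l) (S l)) / \<tau>\<^sup>2 + 52 * ?K l * sqrt (real l) / \<tau>" for l
    have "(\<lambda>l. 52 * (sqrt (real l) * lam l \<tau>) / \<tau> + 52 * (sqrt (real l) / real l) / \<tau>) \<longlonglongrightarrow> 52 * 0 / \<tau> + 52 * 0 / \<tau>"
    proof (intro tendsto_intros)
      show "(\<lambda>l. sqrt (real l) / real l) \<longlonglongrightarrow> 0" by real_asymp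
    qed (use sm \<tau> in auto)
    then have "(\<lambda>l. 52 * ?K l * sqrt (real l) / \<tau>) \<longlonglongrightarrow> 0" by (simp add: algebra_simps add_divide_distrib)
    then have "\<delta> \<longlonglongrightarrow> 0 + 0 / \<tau>\<^sup>2 + 0"
      unfolding \<delta>_def using sm \<tau> by (intro tendsto_intros) auto
    then have \<delta>: "\<delta> \<longlonglongrightarrow> 0" by simp
    let ?c = "regularized_dyson.stability_const \<tau> s1 e1 z"
    \<comment> \<open>The gap does not depend on l, so its positivity may be read off at any one
      dimension where the uniform bounds hold.\<close>
    have gap: "0 < regularized_dyson.gap \<tau> s1 e1 z"
    proof -
      obtain l where "s l \<le> s1" "spec_norm (cmat (EL l)) \<le> e1"
        using eventually_happens'[OF _ eventually_conj[OF s1(2) e1(2)]] by auto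
      then interpret rd: random_regularized_dyson P "n l" "d l" l "EL l" "S l" \<tau> s1 e1 z "L l"
        using s1 e1 \<tau> S_norm by (intro gaussian_linearization.random_regularized_dyson[OF gl]) auto
      show ?thesis by (rule rd.gap_pos)
    qed
    have "\<forall>\<^sub>F l in sequentially. \<delta> l < regularized_dyson.gap \<tau> s1 e1 z" by (rule order_tendstoD(2)[OF \<delta> gap])
    then have "\<forall>\<^sub>F l in sequentially. spec_norm (F \<tau> l - Mreg l \<tau> z) \<le> ?c * \<delta> l"
      using s1(2) e1(2) eventually_gt_at_top[of 0]
    proof eventually_elim
      case (elim l)
      show ?case
        unfolding F_def
      proof (rule gaussian_linearization.expected_resolvent_near_dyson[OF gl S_norm])
        show "\<delta> l = spec_norm (Delta P (n l) (d l) (L l) \<tau> z)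
          + op_norm l (S_tilde P l (L l) (S l)) / \<tau>\<^sup>2 + 52 * ?K l * sqrt (real l) / \<tau>" by (rule \<delta>_def)
        show "lipschitz_euc (\<gamma> l) (euc (\<gamma> l)) spec_norm (lam l \<tau>) (\<lambda>x. S l (resolvent (n l) (d l) (C l x + EL l) \<tau> z))"
          using sm by blast
        show "reg_dyson_solution (n l) (d l) (EL l) (S l) \<tau> (Mreg l \<tau>)" by (rule Mreg[OF \<tau>(1)])
      qed (use elim s1 e1 \<tau> in auto)
    qed
    then have "\<forall>\<^sub>F l in sequentially. norm (spec_norm (F \<tau> l - Mreg l \<tau> z)) \<le> ?c * \<delta> l" by simp
    moreover have "(\<lambda>l. ?c * \<delta> l) \<longlonglongrightarrow> 0" using tendsto_mult_left[OF \<delta>, of ?c] by simp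
    ultimately show ?thesis by (rule Lim_null_comparison)
  qed
  have conv: "(\<lambda>l. spec_norm (F 0 l - M l z)) \<longlonglongrightarrow> 0"
  proof (rule tendstoI)
    fix \<epsilon> :: real assume \<epsilon>: "0 < \<epsilon>"
    obtain f t where t: "\<And>k. t k > 0" "t \<longlonglongrightarrow> 0" "(\<lambda>k. f (t k)) \<longlonglongrightarrow> 0"
      and ex: "\<And>k. \<exists>e :: nat \<Rightarrow> real. e \<longlonglongrightarrow> 0 \<and>
           (\<forall>\<^sub>F l in sequentially. spec_norm (Mreg l (t k) z - M l z) \<le> f (t k) + e l)"
      using C2[OF z] by blast
    have tb: "(\<lambda>k. t k * b) \<longlonglongrightarrow> 0" using tendsto_mult_right[OF t(2), of b] by simp
    have "\<forall>\<^sub>F k in sequentially. t k < \<tau>0 \<and> t k * b < \<epsilon> / 4 \<and> f (t k) < \<epsilon> / 4"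
      using order_tendstoD(2)[OF t(2) \<tau>0] order_tendstoD(2)[OF tb, of "\<epsilon> / 4"] order_tendstoD(2)[OF t(3), of "\<epsilon> / 4"] \<epsilon>
      by (intro eventually_conj) auto
    \<comment> \<open>The regularization is fixed here, before l grows. Four errors of
      \<open>\<epsilon> / 4\<close> are shared out: removal of the regularization by
      \<open>t k * b\<close>, the assumed \<open>f (t k)\<close>, and two that vanish as l grows,
      namely \<open>e l\<close> and the distance to the regularized solution.\<close>
    then obtain k where k: "t k < \<tau>0" "t k * b < \<epsilon> / 4" "f (t k) < \<epsilon> / 4"
      using eventually_happens'[OF sequentially_bot] by blast
    obtain e where e: "e \<longlonglongrightarrow> 0" "\<forall>\<^sub>F l in sequentially. spec_norm (Mreg l (t k) z - M l z) \<le> f (t k) + e l"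
      using ex[of k] by blast
    have "\<forall>\<^sub>F l in sequentially. e l < \<epsilon> / 4" "\<forall>\<^sub>F l in sequentially. spec_norm (F (t k) l - Mreg l (t k) z) < \<epsilon> / 4"
      by (rule order_tendstoD(2)[OF e(1)] order_tendstoD(2)[OF reg[OF t(1) k(1)]], use \<epsilon> in simp)+
    then show "\<forall>\<^sub>F l in sequentially. dist (spec_norm (F 0 l - M l z)) 0 < \<epsilon>"
      using e(2) s1(2) e1(2) b(2)
    proof eventually_elim
      case (elim l)
      have "spec_norm (F (t k) l - F 0 l) \<le> t k * b"
        unfolding F_def
        by (rule gaussian_linearization.resolvent_regularization_error[OF gl res_lipschitz S_norm, where ?e0.0 = e1])
          (use elim s1 e1 t b in auto)
      moreover have "spec_norm (F 0 l - M l z) \<le> spec_norm (F 0 l - F (t k) l) + spec_norm (F (t k) l - M l z)"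
        by (rule spec_norm_triangle_diff[OF Fc Fc Mc])
      moreover have "spec_norm (F (t k) l - M l z) \<le> spec_norm (F (t k) l - Mreg l (t k) z) + spec_norm (Mreg l (t k) z - M l z)"
        by (rule spec_norm_triangle_diff[OF Fc Mregc[OF t(1)] Mc])
      moreover have "spec_norm (F 0 l - F (t k) l) = spec_norm (F (t k) l - F 0 l)"
        by (rule spec_norm_minus_commute[OF Fc Fc])
      ultimately show ?case using elim k by simp
    qed
  qed
  let ?R = "\<lambda>l \<omega>. resolvent (n l) (d l) (L l \<omega>) 0 z"
  \<comment> \<open>Only the deviation from the mean is random; the deterministic remainder
    \<open>F 0 l - M l z\<close> is settled by \<open>conv\<close> and trace duality.\<close>
  have "AE \<omega> in P. (\<lambda>l. mtrace (U l * (?R l \<omega> - F 0 l))) \<longlonglongrightarrow> 0"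
  proof (rule summable_tails_tendsto[OF _ summable_gaussian_tails[OF _ cr]])
    fix e :: real assume e: "0 < e"
    show "\<forall>\<^sub>F l in sequentially. {\<omega> \<in> space P. e \<le> cmod (mtrace (U l * (?R l \<omega> - F 0 l)))} \<in> events \<and>
      prob {\<omega> \<in> space P. e \<le> cmod (mtrace (U l * (?R l \<omega> - F 0 l)))}
        \<le> 4 * exp (- (e\<^sup>2 / (16 * (c * real l powr (- r))\<^sup>2)))"
      using eventually_gt_at_top[of 0]
    proof eventually_elim
      case (elim l)
      \<comment> \<open>At l = 0 the Lipschitz constant is 0, since \<open>0 powr x = 0\<close>,
        whereas the tail bound needs a positive one; positive l is all that the limit sees.\<close>
      then have K: "0 < c * real l powr (- r)" using cr by simp
      show ?case
        unfolding F_def using gaussian_linearization.resolvent_trace_tail[OF gl res_lipschitz U K e] by blast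
    qed
  qed
  then show ?thesis
    using AE_space
  proof eventually_elim
    case (elim \<omega>)
    have "(\<lambda>l. mtrace (U l * (F 0 l - M l z))) \<longlonglongrightarrow> 0"
    proof (rule Lim_null_comparison[OF _ conv])
      have "norm (mtrace (U l * (F 0 l - M l z))) \<le> spec_norm (F 0 l - M l z)" for l
      proof -
        have "norm (mtrace (U l * (F 0 l - M l z))) \<le> nuc_norm (U l) * spec_norm (F 0 l - M l z)"
          using Fc Mc by (intro trace_duality[OF U(1)]) auto
        then show ?thesis using mult_right_mono[OF U(2)[of l] spec_norm_nonneg[of "F 0 l - M l z"]] by simp
      qed
      then show "\<forall>\<^sub>F l in sequentially. norm (mtrace (U l * (F 0 l - M l z))) \<le> spec_norm (F 0 l - M l z)" by simp
    qed
    from tendsto_add[OF elim(1) this]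
    have "(\<lambda>l. mtrace (U l * (?R l \<omega> - F 0 l)) + mtrace (U l * (F 0 l - M l z))) \<longlonglongrightarrow> 0" by simp
    moreover have "mtrace (U l * (?R l \<omega> - F 0 l)) + mtrace (U l * (F 0 l - M l z)) = mtrace (U l * (?R l \<omega> - M l z))" for l
    proof -
      have Rc: "?R l \<omega> \<in> carrier_mat l l"
        using gaussian_linearization.resolvent_carrier[OF gl gaussian_linearization.g_euc[OF gl elim(2)], of l 0]
        by (simp add: C3_L[OF elim(2)])
      show ?thesis
        using mtrace_mult_diff[OF U(1) Rc Fc] mtrace_mult_diff[OF U(1) Fc Mc] mtrace_mult_diff[OF U(1) Rc Mc] by simp
    qed
    ultimately show ?case by simp
  qed
qed

end
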